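(* Let $T>0$, $\nu>0$, $u_0\in V^2$, $f\in L^2(0,T;V)\cap L^1(0,T;V^2)$ and let $u\in L^{\infty}(0,T;V^2)\cap L^2(0,T;V^3)$ be a strong solution of the Navier-Stokes equations $$\frac{\mathrm{d}u}{\mathrm{d}t}+\nu Au+B(u,u)=f(t)\quad\text{with}\quad u(0)=u_0.$$ Then $u_n$, the solution of the Galerkin system $$\frac{\mathrm{d}u_n}{\mathrm{d}t}+\nu Au_n+P_nB(u_n,u_n)=P_nf(t)\quad\text{with}\quad u_n(0)=P_nu_0,$$ converges strongly to $u$ in both $L^{\infty}(0,T;V^2)$ and $L^2(0,T;V^3)$ as $n\to\infty$.
   Context: Three-dimensional incompressible Navier-Stokes equations in functional form on a periodic cubic domain $Q$ (periodic boundary conditions, zero average). Let $\mathcal{H}$ be the space of divergence-free smooth periodic vector-valued functions on $Q$ with zero average; $H$ is the closure of $\mathcal{H}$ in $[L^2(Q)]^3$, $V$ the closure of $\mathcal{H}$ in $[H^1(Q)]^3$, and $V^m=H^m\cap V$ with norm $\|u\|_m=|A^{m/2}u|$, where $|\cdot|$ is the norm of $H$. $\Pi$ is the orthogonal projection of $L^2$ onto $H$, $Au=-\Pi\Delta u$ is the Stokes operator, and $B(u,v)=\Pi(u\cdot\nabla)v$. A strong solution on $[0,T]$ is a solution in $L^\infty(0,T;V)\cap L^2(0,T;V^2)$ (then $\mathrm{d}u/\mathrm{d}t\in L^2(0,T;H)$ and the equation holds in $H$ for a.e. $t$). $P_n$ is the orthogonal projection in $H$ onto the span of the first $n$ eigenfunctions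 $w_1,\dots,w_n$ of $A$, ordered so that the corresponding eigenvalues satisfy $0<\lambda_1\le\lambda_2\le\cdots$; $u_n(t)$ takes values in $P_nH$. *)

theory Defs
  imports "HOL-Analysis.Analysis" "HOL-Probability.Essential_Supremum"
begin

text \<open>
  Elements of the function spaces below are functions on the whole of \<open>real^3\<close>, of which only the
  restriction to the periodicity cell \<open>[0,L]^3\<close>, modulo null sets, matters. All spaces are closed
  under equality almost everywhere on the cell, and the norms are seminorms whose kernel is
  almost-everywhere equality.
\<close>

type_synonym vfield = "real^3 \<Rightarrow> real^3"

definition cell :: "real \<Rightarrow> (real^3) measure" where
  "cell L = lebesgue_on (cbox 0 (\<chi> i. L))"

definition ae_eq :: "real \<Rightarrow> vfield \<Rightarrow> vfield \<Rightarrow> bool" where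
  "ae_eq L g h \<longleftrightarrow> (AE x in cell L. g x = h x)"

definition periodic :: "real \<Rightarrow> (real^3 \<Rightarrow> 'b) \<Rightarrow> bool" where
  "periodic L g \<longleftrightarrow> (\<forall>x i. g (x + axis i L) = g x)"

definition pderivative :: "3 \<Rightarrow> (real^3 \<Rightarrow> 'b::real_normed_vector) \<Rightarrow> real^3 \<Rightarrow> 'b" where
  "pderivative i g x = frechet_derivative g (at x) (axis i 1)"

text \<open>Iterated partial derivatives; the multi-index is given as a list of directions.\<close>

definition pderivs :: "3 list \<Rightarrow> (real^3 \<Rightarrow> 'b::real_normed_vector) \<Rightarrow> real^3 \<Rightarrow> 'b" where
  "pderivs \<alpha> g = foldr pderivative \<alpha> g"

definition smooth :: "(real^3 \<Rightarrow> 'b::real_normed_vector) \<Rightarrow> bool" where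
  "smooth g \<longleftrightarrow> (\<forall>\<alpha> x. pderivs \<alpha> g differentiable (at x))"

definition divergence :: "vfield \<Rightarrow> real^3 \<Rightarrow> real" where
  "divergence g x = (\<Sum>i\<in>UNIV. pderivative i g x $ i)"

definition smooth_solenoidal :: "real \<Rightarrow> vfield set" where
  "smooth_solenoidal L = {g. smooth g \<and> periodic L g \<and> (\<forall>x. divergence g x = 0)
     \<and> integral\<^sup>L (cell L) g = 0}"

definition L2 :: "real \<Rightarrow> vfield set" where
  "L2 L = {g. g \<in> borel_measurable (cell L) \<and> integrable (cell L) (\<lambda>x. (norm (g x))\<^sup>2)}"

definition L2_inner :: "real \<Rightarrow> vfield \<Rightarrow> vfield \<Rightarrow> real" where
  "L2_inner L g h = (LINT x|cell L. g x \<bullet> h x)"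

definition L2_norm :: "real \<Rightarrow> vfield \<Rightarrow> real" where
  "L2_norm L g = sqrt (L2_inner L g g)"

text \<open>
  Weak derivatives are tested against all smooth periodic functions (not only those compactly
  supported in the open cell), so \<open>sobolev L m\<close> is the Sobolev space of order \<open>m\<close> of the torus.
\<close>

definition is_weak_deriv :: "real \<Rightarrow> 3 list \<Rightarrow> vfield \<Rightarrow> vfield \<Rightarrow> bool" where
  "is_weak_deriv L \<alpha> g h \<longleftrightarrow> h \<in> L2 L \<and>
     (\<forall>\<phi>::real^3 \<Rightarrow> real. smooth \<phi> \<and> periodic L \<phi> \<longrightarrow>
        (LINT x|cell L. pderivs \<alpha> \<phi> x *\<^sub>R g x) = (-1) ^ length \<alpha> *\<^sub>R (LINT x|cell L. \<phi> x *\<^sub>R h x))"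

definition weak_deriv :: "real \<Rightarrow> 3 list \<Rightarrow> vfield \<Rightarrow> vfield" where
  "weak_deriv L \<alpha> g = (SOME h. is_weak_deriv L \<alpha> g h)"

definition sobolev :: "real \<Rightarrow> nat \<Rightarrow> vfield set" where
  "sobolev L m = {g \<in> L2 L. \<forall>\<alpha>. length \<alpha> \<le> m \<longrightarrow> (\<exists>h. is_weak_deriv L \<alpha> g h)}"

definition H1_norm :: "real \<Rightarrow> vfield \<Rightarrow> real" where
  "H1_norm L g = sqrt ((L2_norm L g)\<^sup>2 + (\<Sum>i\<in>UNIV. (L2_norm L (weak_deriv L [i] g))\<^sup>2))"

definition H_space :: "real \<Rightarrow> vfield set" where
  "H_space L = {g \<in> L2 L. \<exists>h. (\<forall>k::nat. h k \<in> smooth_solenoidal L) \<and>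
     (\<lambda>k. L2_norm L (\<lambda>x. h k x - g x)) \<longlonglongrightarrow> 0}"

definition V_space :: "real \<Rightarrow> vfield set" where
  "V_space L = {g \<in> sobolev L 1. \<exists>h. (\<forall>k::nat. h k \<in> smooth_solenoidal L) \<and>
     (\<lambda>k. H1_norm L (\<lambda>x. h k x - g x)) \<longlonglongrightarrow> 0}"

definition Vm :: "real \<Rightarrow> nat \<Rightarrow> vfield set" where
  "Vm L m = sobolev L m \<inter> V_space L"

definition orth_proj :: "real \<Rightarrow> vfield set \<Rightarrow> vfield \<Rightarrow> vfield" where
  "orth_proj L S g = (SOME h. h \<in> S \<and> (\<forall>\<phi>\<in>S. L2_inner L (\<lambda>x. g x - h x) \<phi> = 0))"

definition leray :: "real \<Rightarrow> vfield \<Rightarrow> vfield" where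
  "leray L = orth_proj L (H_space L)"

definition laplacian :: "real \<Rightarrow> vfield \<Rightarrow> vfield" where
  "laplacian L u x = (\<Sum>i\<in>UNIV. weak_deriv L [i, i] u x)"

text \<open>The domain of the Stokes operator is \<open>Vm L 2\<close>.\<close>

definition stokes :: "real \<Rightarrow> vfield \<Rightarrow> vfield" where
  "stokes L u x = - leray L (laplacian L u) x"

definition advect :: "real \<Rightarrow> vfield \<Rightarrow> vfield \<Rightarrow> vfield" where
  "advect L u v x = (\<Sum>i\<in>UNIV. u x $ i *\<^sub>R weak_deriv L [i] v x)"

definition NS_B :: "real \<Rightarrow> vfield \<Rightarrow> vfield \<Rightarrow> vfield" where
  "NS_B L u v = leray L (advect L u v)"

text \<open>
  \<open>w\<close> is an orthonormal basis of H consisting of eigenfunctions of the Stokes operator, listed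
  with non-decreasing positive eigenvalues \<open>lam\<close>. Indices start at 0: \<open>w 0\<close> is the first one.
\<close>

definition stokes_eigenbasis :: "real \<Rightarrow> (nat \<Rightarrow> vfield) \<Rightarrow> (nat \<Rightarrow> real) \<Rightarrow> bool" where
  "stokes_eigenbasis L w lam \<longleftrightarrow>
     (\<forall>j. w j \<in> Vm L 2 \<and> ae_eq L (stokes L (w j)) (\<lambda>x. lam j *\<^sub>R w j x)) \<and>
     (\<forall>i j. L2_inner L (w i) (w j) = (if i = j then 1 else 0)) \<and>
     (\<forall>g\<in>H_space L. (\<lambda>N. L2_norm L (\<lambda>x. g x - (\<Sum>j<N. L2_inner L g (w j) *\<^sub>R w j x))) \<longlonglongrightarrow> 0) \<and>
     0 < lam 0 \<and> mono lam"

text \<open>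
  The power \<open>A\<^sup>s\<close> of the Stokes operator, by the spectral expansion
  \<open>A\<^sup>s u = \<Sum>j. lam j\<^sup>s (u, w j) w j\<close> with convergence in H.
\<close>

definition stokes_power ::
    "real \<Rightarrow> (nat \<Rightarrow> vfield) \<Rightarrow> (nat \<Rightarrow> real) \<Rightarrow> real \<Rightarrow> vfield \<Rightarrow> vfield" where
  "stokes_power L w lam s u = (SOME h. h \<in> H_space L \<and>
     (\<lambda>N. L2_norm L (\<lambda>x. h x - (\<Sum>j<N. (lam j powr s * L2_inner L u (w j)) *\<^sub>R w j x))) \<longlonglongrightarrow> 0)"

definition Vm_norm :: "real \<Rightarrow> (nat \<Rightarrow> vfield) \<Rightarrow> (nat \<Rightarrow> real) \<Rightarrow> nat \<Rightarrow> vfield \<Rightarrow> real" where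
  "Vm_norm L w lam m u = L2_norm L (stokes_power L w lam (real m / 2) u)"

definition PnH :: "real \<Rightarrow> (nat \<Rightarrow> vfield) \<Rightarrow> nat \<Rightarrow> vfield set" where
  "PnH L w n = {g. \<exists>c::nat \<Rightarrow> real. ae_eq L g (\<lambda>x. \<Sum>j<n. c j *\<^sub>R w j x)}"

definition Pn :: "real \<Rightarrow> (nat \<Rightarrow> vfield) \<Rightarrow> nat \<Rightarrow> vfield \<Rightarrow> vfield" where
  "Pn L w n = orth_proj L (PnH L w n)"

text \<open>
  \<open>X\<close> is a set of vector fields and \<open>N\<close> its (semi)norm. Since these are not types, Bochner
  measurability (almost-everywhere limit in norm of simple functions) is spelled out.
\<close>

definition bochner_measurable ::
    "real \<Rightarrow> vfield set \<Rightarrow> (vfield \<Rightarrow> real) \<Rightarrow> (real \<Rightarrow> vfield) \<Rightarrow> bool" where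
  "bochner_measurable T X N u \<longleftrightarrow>
     (AE t in lebesgue_on {0..T}. u t \<in> X) \<and>
     (\<exists>s. (\<forall>k::nat. simple_function (lebesgue_on {0..T}) (s k) \<and> s k ` {0..T} \<subseteq> X) \<and>
       (AE t in lebesgue_on {0..T}. (\<lambda>k. N (\<lambda>x. s k t x - u t x)) \<longlonglongrightarrow> 0))"

definition bochner_Lp ::
    "real \<Rightarrow> nat \<Rightarrow> vfield set \<Rightarrow> (vfield \<Rightarrow> real) \<Rightarrow> (real \<Rightarrow> vfield) set" where
  "bochner_Lp T p X N = {u. bochner_measurable T X N u \<and>
     integrable (lebesgue_on {0..T}) (\<lambda>t. N (u t) ^ p)}"

definition bochner_Lp_norm :: "real \<Rightarrow> nat \<Rightarrow> (vfield \<Rightarrow> real) \<Rightarrow> (real \<Rightarrow> vfield) \<Rightarrow> real" where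
  "bochner_Lp_norm T p N u = root p (LINT t|lebesgue_on {0..T}. N (u t) ^ p)"

definition bochner_Linf_norm :: "real \<Rightarrow> (vfield \<Rightarrow> real) \<Rightarrow> (real \<Rightarrow> vfield) \<Rightarrow> ereal" where
  "bochner_Linf_norm T N u = esssup (lebesgue_on {0..T}) (\<lambda>t. ereal (N (u t)))"

definition bochner_Linf ::
    "real \<Rightarrow> vfield set \<Rightarrow> (vfield \<Rightarrow> real) \<Rightarrow> (real \<Rightarrow> vfield) set" where
  "bochner_Linf T X N = {u. bochner_measurable T X N u \<and> bochner_Linf_norm T N u < \<infinity>}"

definition converges_Lp ::
    "real \<Rightarrow> nat \<Rightarrow> vfield set \<Rightarrow> (vfield \<Rightarrow> real) \<Rightarrow> (nat \<Rightarrow> real \<Rightarrow> vfield) \<Rightarrow> (real \<Rightarrow> vfield) \<Rightarrow> bool"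
  where
  "converges_Lp T p X N un u \<longleftrightarrow> (\<forall>n. un n \<in> bochner_Lp T p X N) \<and> u \<in> bochner_Lp T p X N \<and>
     (\<lambda>n. bochner_Lp_norm T p N (\<lambda>t x. un n t x - u t x)) \<longlonglongrightarrow> 0"

definition converges_Linf ::
    "real \<Rightarrow> vfield set \<Rightarrow> (vfield \<Rightarrow> real) \<Rightarrow> (nat \<Rightarrow> real \<Rightarrow> vfield) \<Rightarrow> (real \<Rightarrow> vfield) \<Rightarrow> bool"
  where
  "converges_Linf T X N un u \<longleftrightarrow> (\<forall>n. un n \<in> bochner_Linf T X N) \<and> u \<in> bochner_Linf T X N \<and>
     (\<lambda>n. bochner_Linf_norm T N (\<lambda>t x. un n t x - u t x)) \<longlonglongrightarrow> 0"

text \<open>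
  \<open>du/dt = g\<close> for an absolutely continuous H-valued \<open>u\<close>, i.e. \<open>u(t) = u(0) + \<integral>\<^sub>0\<^sup>t g(s) ds\<close> in H with
  \<open>g \<in> L\<^sup>1(0,T;H)\<close>; the H-valued (Bochner) integral is identified by its inner products with H.
  In particular \<open>u\<close> is the continuous representative, which gives a meaning to \<open>u(0)\<close>.
\<close>

definition has_time_derivative :: "real \<Rightarrow> real \<Rightarrow> (real \<Rightarrow> vfield) \<Rightarrow> (real \<Rightarrow> vfield) \<Rightarrow> bool" where
  "has_time_derivative L T u g \<longleftrightarrow>
     g \<in> bochner_Lp T 1 (H_space L) (L2_norm L) \<and>
     (\<forall>t\<in>{0..T}. u t \<in> H_space L \<and>
        (\<forall>\<phi>\<in>H_space L. L2_inner L (u t) \<phi> =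
           L2_inner L (u 0) \<phi> + (LINT s|lebesgue_on {0..t}. L2_inner L (g s) \<phi>)))"

definition strong_solution ::
    "real \<Rightarrow> (nat \<Rightarrow> vfield) \<Rightarrow> (nat \<Rightarrow> real) \<Rightarrow> real \<Rightarrow> real \<Rightarrow> (real \<Rightarrow> vfield) \<Rightarrow> vfield
      \<Rightarrow> (real \<Rightarrow> vfield) \<Rightarrow> bool" where
  "strong_solution L w lam T \<nu> f u0 u \<longleftrightarrow>
     u \<in> bochner_Linf T (Vm L 1) (Vm_norm L w lam 1) \<inter> bochner_Lp T 2 (Vm L 2) (Vm_norm L w lam 2) \<and>
     ae_eq L (u 0) u0 \<and>
     (\<exists>du. du \<in> bochner_Lp T 2 (H_space L) (L2_norm L) \<and> has_time_derivative L T u du \<and>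
       (AE t in lebesgue_on {0..T}.
          ae_eq L (\<lambda>x. du t x + \<nu> *\<^sub>R stokes L (u t) x + NS_B L (u t) (u t) x) (f t)))"

definition galerkin_solution ::
    "real \<Rightarrow> (nat \<Rightarrow> vfield) \<Rightarrow> real \<Rightarrow> real \<Rightarrow> (real \<Rightarrow> vfield) \<Rightarrow> vfield \<Rightarrow> nat
      \<Rightarrow> (real \<Rightarrow> vfield) \<Rightarrow> bool" where
  "galerkin_solution L w T \<nu> f u0 n v \<longleftrightarrow>
     (\<forall>t\<in>{0..T}. v t \<in> PnH L w n) \<and>
     ae_eq L (v 0) (Pn L w n u0) \<and>
     (\<exists>dv. has_time_derivative L T v dv \<and>
       (AE t in lebesgue_on {0..T}.
          ae_eq L (\<lambda>x. dv t x + \<nu> *\<^sub>R stokes L (v t) x + Pn L w n (NS_B L (v t) (v t)) x)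
            (Pn L w n (f t))))"

end

theory Submission
  imports Defs
begin

text \<open>
  Write \<open>z = P\<^sub>n u - u\<^sub>n\<close> and \<open>q = u - P\<^sub>n u\<close>. On the torus the Stokes operator is the Fourier multiplier
  \<open>|2 \<pi> k / L|\<^sup>2\<close>, every eigenfunction has its frequencies on one sphere, and \<open>H\<^sup>2\<close> embeds into the Wiener
  algebra; hence \<open>\<parallel>B(a, b)\<parallel>\<^sub>1 \<le> C \<parallel>a\<parallel>\<^sub>2 \<parallel>b\<parallel>\<^sub>2\<close>. The energy identity for the modes \<open>j \<ge> n\<close> of \<open>u\<close> bounds
  \<open>\<parallel>q(t)\<parallel>\<^sub>2\<^sup>2\<close>, uniformly in \<open>t\<close>, by a quantity \<open>\<tau>\<^sub>n\<close> that tends to \<open>0\<close> by dominated convergence. Testing the equation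
  for \<open>z\<close> with \<open>A\<^sup>2 z\<close> and absorbing \<open>\<parallel>z\<parallel>\<^sub>3\<close> by viscosity gives, for \<open>E = \<parallel>z\<parallel>\<^sub>2\<^sup>2\<close>,
  \<open>E(t) + \<nu> \<integral>\<^sub>0\<^sup>t \<parallel>z\<parallel>\<^sub>3\<^sup>2 \<le> \<delta>\<^sub>n + K \<integral>\<^sub>0\<^sup>t (E + E\<^sup>2)\<close> with \<open>\<delta>\<^sub>n \<rightarrow> 0\<close>; since \<open>E(0) = 0\<close>, a Gronwall argument for this
  quadratic inequality forces \<open>E \<rightarrow> 0\<close> uniformly on \<open>[0, T]\<close> and \<open>\<integral>\<^sub>0\<^sup>T \<parallel>z\<parallel>\<^sub>3\<^sup>2 \<rightarrow> 0\<close>.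
\<close>

section \<open>Square integrable functions\<close>

text \<open>No bound on \<open>u_n\<close> in V^2 is available in advance. The quadratic term is
  therefore expanded around \<open>u\<close>: with e = u - u_n = z + q, B(u,u) - B(u_n,u_n) = B(e,u)
  + B(u,e) - B(e,e), where only \<open>u\<close> has to be bounded. The last term makes the
  inequality for E quadratic, so that it closes only once its initial defect is small, that is for
  large n. Since B maps V^2 x V^2 to V^1 and is paired with z in V^3, the discarded part q enters
  through its V^2 norm alone. A second obstacle is that \<open>u\<close> and \<open>u_n\<close> are
  known only through integrated identities for inner products, and that the operators are choices
  modulo null sets. Everything is therefore brought down to the real coefficients with respect to
  \<open>w\<close>, which are indefinite integrals; for these the rule for the derivative of a
  square is proved by hand. Finally, \<open>w\<close> is an arbitrary eigenbasis, not the Fourier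
  basis. The two expansions communicate only through the sphere property: a Fourier multiplier F(|2
  pi k / L|^2) acts on the j-th coefficient as F(\<open>lam j\<close>).\<close>

definition sq_int :: "'a measure \<Rightarrow> ('a \<Rightarrow> 'b::{banach,second_countable_topology}) \<Rightarrow> bool" where
  "sq_int M f \<longleftrightarrow> f \<in> borel_measurable M \<and> integrable M (\<lambda>x. (norm (f x))\<^sup>2)"

definition l2 :: "'a measure \<Rightarrow> ('a \<Rightarrow> 'b::{banach,second_countable_topology}) \<Rightarrow> real" where
  "l2 M f = sqrt (LINT x|M. (norm (f x))\<^sup>2)"

lemma sq_intD:
  assumes "sq_int M f"
  shows "f \<in> borel_measurable M" "integrable M (\<lambda>x. (norm (f x))\<^sup>2)"
  using assms by (auto simp: sq_int_def)

lemma l2_nonneg [simp]: "0 \<le> l2 M f"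
  by (simp add: l2_def)

lemma l2_sq: "(l2 M f)\<^sup>2 = (LINT x|M. (norm (f x))\<^sup>2)"
  by (simp add: l2_def)

lemma sq_int_bound:
  assumes f: "sq_int M f" and g: "g \<in> borel_measurable M"
    and le: "AE x in M. norm (g x) \<le> C * norm (f x)"
  shows "sq_int M g"
  unfolding sq_int_def
proof (intro conjI g)
  show "integrable M (\<lambda>x. (norm (g x))\<^sup>2)"
  proof (rule Bochner_Integration.integrable_bound)
    show "integrable M (\<lambda>x. C\<^sup>2 * (norm (f x))\<^sup>2)" using f by (simp add: sq_int_def)
    show "(\<lambda>x. (norm (g x))\<^sup>2) \<in> borel_measurable M" using g by measurable
    show "AE x in M. norm ((norm (g x))\<^sup>2) \<le> norm (C\<^sup>2 * (norm (f x))\<^sup>2)"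
      using le
    proof eventually_elim
      case (elim x)
      then have "(norm (g x))\<^sup>2 \<le> (C * norm (f x))\<^sup>2" by (intro power_mono) auto
      then show ?case by (simp add: power_mult_distrib)
    qed
  qed
qed

lemma sq_int_AE_cong:
  assumes "sq_int M f" "g \<in> borel_measurable M" "AE x in M. f x = g x"
  shows "sq_int M g"
  by (rule sq_int_bound[where C=1, OF assms(1,2)]) (use assms(3) in auto)

lemma l2_AE_cong:
  assumes "f \<in> borel_measurable M" "g \<in> borel_measurable M" "AE x in M. f x = g x"
  shows "l2 M f = l2 M g"
proof -
  have "(LINT x|M. (norm (f x))\<^sup>2) = (LINT x|M. (norm (g x))\<^sup>2)"
    by (rule integral_cong_AE) (use assms in \<open>auto intro: borel_measurable_power borel_measurable_norm\<close>)
  then show ?thesis by (simp add: l2_def)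
qed

lemma sq_int_add:
  assumes f: "sq_int M f" and g: "sq_int M g"
  shows "sq_int M (\<lambda>x. f x + g x)"
  unfolding sq_int_def
proof (intro conjI)
  note [measurable] = sq_intD(1)[OF f] sq_intD(1)[OF g]
  show m: "(\<lambda>x. f x + g x) \<in> borel_measurable M" by measurable
  show "integrable M (\<lambda>x. (norm (f x + g x))\<^sup>2)"
  proof (rule Bochner_Integration.integrable_bound)
    show "integrable M (\<lambda>x. 2 * (norm (f x))\<^sup>2 + 2 * (norm (g x))\<^sup>2)"
      using f g by (simp add: sq_int_def)
    show "(\<lambda>x. (norm (f x + g x))\<^sup>2) \<in> borel_measurable M" by measurable
    have "(norm (f x + g x))\<^sup>2 \<le> 2 * (norm (f x))\<^sup>2 + 2 * (norm (g x))\<^sup>2" for x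
    proof -
      have "(norm (f x + g x))\<^sup>2 \<le> (norm (f x) + norm (g x))\<^sup>2"
        by (intro power_mono norm_triangle_ineq) auto
      also have "\<dots> \<le> 2 * (norm (f x))\<^sup>2 + 2 * (norm (g x))\<^sup>2"
        using sum_squares_ge_zero[of "norm (f x) - norm (g x)" 0] by (simp add: power2_eq_square algebra_simps)
      finally show ?thesis .
    qed
    then show "AE x in M. norm ((norm (f x + g x))\<^sup>2) \<le> norm (2 * (norm (f x))\<^sup>2 + 2 * (norm (g x))\<^sup>2)"
      by simp
  qed
qed

lemma sq_int_scaleR:
  assumes "sq_int M f"
  shows "sq_int M (\<lambda>x. c *\<^sub>R f x)"
proof -
  note [measurable] = sq_intD(1)[OF assms]
  show ?thesis by (rule sq_int_bound[where C="\<bar>c\<bar>", OF assms]) auto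
qed

lemma sq_int_uminus: "sq_int M f \<Longrightarrow> sq_int M (\<lambda>x. - f x)"
  using sq_int_scaleR[of M f "-1"] by simp

lemma sq_int_diff:
  assumes f: "sq_int M f" and g: "sq_int M g"
  shows "sq_int M (\<lambda>x. f x - g x)"
  using sq_int_add[OF f sq_int_uminus[OF g]] by simp

lemma sq_int_zero [simp]: "sq_int M (\<lambda>x. 0)"
  by (simp add: sq_int_def)

lemma sq_int_sum:
  "(\<And>i. i \<in> I \<Longrightarrow> sq_int M (f i)) \<Longrightarrow> sq_int M (\<lambda>x. \<Sum>i\<in>I. f i x)"
  by (induction I rule: infinite_finite_induct) (auto intro: sq_int_add)

lemma sq_int_norm_mult:
  assumes f: "sq_int M f" and g: "sq_int M g"
  shows "integrable M (\<lambda>x. norm (f x) * norm (g x))"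
proof (rule Bochner_Integration.integrable_bound)
  note [measurable] = sq_intD(1)[OF f] sq_intD(1)[OF g]
  show "integrable M (\<lambda>x. (norm (f x))\<^sup>2 + (norm (g x))\<^sup>2)"
    using f g by (simp add: sq_int_def)
  show "(\<lambda>x. norm (f x) * norm (g x)) \<in> borel_measurable M" by measurable
  show "AE x in M. norm (norm (f x) * norm (g x)) \<le> norm ((norm (f x))\<^sup>2 + (norm (g x))\<^sup>2)"
  proof (rule AE_I2)
    fix x
    show "norm (norm (f x) * norm (g x)) \<le> norm ((norm (f x))\<^sup>2 + (norm (g x))\<^sup>2)"
      using sum_squares_bound[of "norm (f x)" "norm (g x)"] mult_nonneg_nonneg[of "norm (f x)" "norm (g x)"]
      by (simp del: mult_nonneg_nonneg)
  qed
qed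

lemma l2_Cauchy_Schwarz:
  assumes f: "sq_int M f" and g: "sq_int M g"
  shows "(LINT x|M. norm (f x) * norm (g x)) \<le> l2 M f * l2 M g"
proof -
  note [measurable] = sq_intD(1)[OF f] sq_intD(1)[OF g]
  have e1: "(\<integral>\<^sup>+x. ennreal (norm (f x)) * ennreal (norm (g x)) \<partial>M) = ennreal (LINT x|M. norm (f x) * norm (g x))"
    using nn_integral_eq_integral[OF sq_int_norm_mult[OF f g]] by (simp add: ennreal_mult)
  have e2: "(\<integral>\<^sup>+x. (ennreal (norm (f x)))\<^sup>2 \<partial>M) = ennreal ((l2 M f)\<^sup>2)"
    using nn_integral_eq_integral[OF sq_intD(2)[OF f]] by (simp add: ennreal_power l2_sq)
  have e3: "(\<integral>\<^sup>+x. (ennreal (norm (g x)))\<^sup>2 \<partial>M) = ennreal ((l2 M g)\<^sup>2)"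
    using nn_integral_eq_integral[OF sq_intD(2)[OF g]] by (simp add: ennreal_power l2_sq)
  have nn: "0 \<le> (LINT x|M. norm (f x) * norm (g x))" by simp
  have "(\<integral>\<^sup>+x. ennreal (norm (f x)) * ennreal (norm (g x)) \<partial>M)\<^sup>2
      \<le> (\<integral>\<^sup>+x. (ennreal (norm (f x)))\<^sup>2 \<partial>M) * (\<integral>\<^sup>+x. (ennreal (norm (g x)))\<^sup>2 \<partial>M)"
    by (rule Cauchy_Schwarz_nn_integral) measurable
  then have "ennreal ((LINT x|M. norm (f x) * norm (g x))\<^sup>2) \<le> ennreal ((l2 M f * l2 M g)\<^sup>2)"
    unfolding e1 e2 e3 using nn by (simp add: ennreal_power ennreal_mult[symmetric] power_mult_distrib)
  then have "(LINT x|M. norm (f x) * norm (g x))\<^sup>2 \<le> (l2 M f * l2 M g)\<^sup>2"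
    by (subst (asm) ennreal_le_iff) auto
  then show ?thesis by (rule power2_le_imp_le) simp
qed

lemma l2_triangle:
  assumes f: "sq_int M f" and g: "sq_int M g"
  shows "l2 M (\<lambda>x. f x + g x) \<le> l2 M f + l2 M g"
proof -
  have "(l2 M (\<lambda>x. f x + g x))\<^sup>2 \<le> (LINT x|M. (norm (f x))\<^sup>2 + 2 * (norm (f x) * norm (g x)) + (norm (g x))\<^sup>2)"
    unfolding l2_sq
  proof (rule integral_mono)
    show "integrable M (\<lambda>x. (norm (f x + g x))\<^sup>2)" using sq_int_add[OF f g] by (simp add: sq_int_def)
    show "integrable M (\<lambda>x. (norm (f x))\<^sup>2 + 2 * (norm (f x) * norm (g x)) + (norm (g x))\<^sup>2)"
      using f g sq_int_norm_mult[OF f g] by (simp add: sq_int_def)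
    fix x
    have "(norm (f x + g x))\<^sup>2 \<le> (norm (f x) + norm (g x))\<^sup>2"
      by (intro power_mono norm_triangle_ineq) auto
    then show "(norm (f x + g x))\<^sup>2 \<le> (norm (f x))\<^sup>2 + 2 * (norm (f x) * norm (g x)) + (norm (g x))\<^sup>2"
      by (simp add: power2_sum)
  qed
  also have "\<dots> = (l2 M f)\<^sup>2 + 2 * (LINT x|M. norm (f x) * norm (g x)) + (l2 M g)\<^sup>2"
    using f g sq_int_norm_mult[OF f g] by (simp add: sq_int_def l2_sq)
  also have "\<dots> \<le> (l2 M f + l2 M g)\<^sup>2"
    using l2_Cauchy_Schwarz[OF f g] by (simp add: power2_sum)
  finally show ?thesis by (rule power2_le_imp_le) simp
qed

lemma l2_minus_commute: "l2 M (\<lambda>x. f x - g x) = l2 M (\<lambda>x. g x - f x)"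
  by (simp add: l2_def norm_minus_commute)

lemma l2_eq_0:
  assumes "sq_int M f" "l2 M f = 0"
  shows "AE x in M. f x = 0"
proof -
  have "(LINT x|M. (norm (f x))\<^sup>2) = 0" using assms(2) l2_sq[of M f] by simp
  then have "AE x in M. (norm (f x))\<^sup>2 = 0"
    using integral_nonneg_eq_0_iff_AE[OF sq_intD(2)[OF assms(1)]] by auto
  then show ?thesis by auto
qed

lemma (in finite_measure) sq_int_integrable:
  assumes f: "sq_int M f"
  shows "integrable M f" "(LINT x|M. norm (f x)) \<le> l2 M f * sqrt (measure M (space M))"
proof -
  have c: "sq_int M (\<lambda>x. 1::real)" by (simp add: sq_int_def)
  have i: "integrable M (\<lambda>x. norm (f x))" using sq_int_norm_mult[OF f c] by simp
  then show "integrable M f" by (rule integrable_norm_cancel) (rule sq_intD(1)[OF f])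
  show "(LINT x|M. norm (f x)) \<le> l2 M f * sqrt (measure M (space M))"
    using l2_Cauchy_Schwarz[OF f c] by (simp add: l2_def)
qed

text \<open>Fatou's lemma for the squared norms. It transfers a Cauchy estimate to the pointwise
  limit in \<open>l2_complete\<close>.\<close>

lemma l2_Fatou:
  assumes s: "\<And>i. sq_int M (s i)" and g: "g \<in> borel_measurable M"
    and lim: "AE x in M. (\<lambda>i. s i x) \<longlonglongrightarrow> g x"
    and bd: "eventually (\<lambda>i. l2 M (s i) \<le> e) sequentially"
  shows "sq_int M g \<and> l2 M g \<le> e"
proof -
  note [measurable] = g sq_intD(1)[OF s]
  have e0: "0 \<le> e" using bd l2_nonneg order_trans by (metis (mono_tags, lifting) eventually_happens' sequentially_bot)
  have "(\<integral>\<^sup>+x. ennreal ((norm (g x))\<^sup>2) \<partial>M) = (\<integral>\<^sup>+x. liminf (\<lambda>i. ennreal ((norm (s i x))\<^sup>2)) \<partial>M)"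
  proof (rule nn_integral_cong_AE)
    show "AE x in M. ennreal ((norm (g x))\<^sup>2) = liminf (\<lambda>i. ennreal ((norm (s i x))\<^sup>2))"
      using lim
    proof eventually_elim
      case (elim x)
      then have "(\<lambda>i. ennreal ((norm (s i x))\<^sup>2)) \<longlonglongrightarrow> ennreal ((norm (g x))\<^sup>2)"
        by (intro tendsto_ennrealI tendsto_power tendsto_norm)
      from lim_imp_Liminf[OF _ this] show ?case by simp
    qed
  qed
  also have "\<dots> \<le> liminf (\<lambda>i. \<integral>\<^sup>+x. ennreal ((norm (s i x))\<^sup>2) \<partial>M)"
    by (rule nn_integral_liminf) measurable
  also have "\<dots> = liminf (\<lambda>i. ennreal ((l2 M (s i))\<^sup>2))"
    using nn_integral_eq_integral[OF sq_intD(2)[OF s]] by (simp add: l2_sq)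
  also have "\<dots> \<le> liminf (\<lambda>i. ennreal (e\<^sup>2))"
    by (rule Liminf_mono, rule eventually_mono[OF bd]) (auto intro!: ennreal_leI power_mono)
  finally have fin: "(\<integral>\<^sup>+x. ennreal ((norm (g x))\<^sup>2) \<partial>M) \<le> ennreal (e\<^sup>2)"
    by (simp add: Liminf_const)
  then have "(\<integral>\<^sup>+x. ennreal (norm ((norm (g x))\<^sup>2)) \<partial>M) < \<infinity>"
    using ennreal_less_top le_less_trans by fastforce
  then have i: "integrable M (\<lambda>x. (norm (g x))\<^sup>2)" by (intro integrableI_bounded) auto
  then have "ennreal (LINT x|M. (norm (g x))\<^sup>2) \<le> ennreal (e\<^sup>2)"
    using fin nn_integral_eq_integral[OF i] by simp
  then have "(l2 M g)\<^sup>2 \<le> e\<^sup>2" by (simp add: l2_sq)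
  then have "l2 M g \<le> e" using e0 by (rule power2_le_imp_le)
  then show ?thesis using i g by (simp add: sq_int_def)
qed

text \<open>Riesz-Fischer argument: along a fast subsequence the increments have L^2 norm at most
  2^(-j). Finiteness of the measure turns this into a summable L^1 bound, so the subsequence
  converges almost everywhere, and Fatou gives convergence in L^2 to that limit.\<close>

lemma (in finite_measure) l2_complete:
  fixes f :: "nat \<Rightarrow> 'a \<Rightarrow> 'b::{banach,second_countable_topology}"
  assumes f: "\<And>n. sq_int M (f n)"
    and cau: "\<And>e. e > 0 \<Longrightarrow> \<exists>N. \<forall>m\<ge>N. \<forall>n\<ge>N. l2 M (\<lambda>x. f m x - f n x) \<le> e"
  obtains g where "sq_int M g" "(\<lambda>n. l2 M (\<lambda>x. f n x - g x)) \<longlonglongrightarrow> 0"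
proof -
  have fm[measurable]: "\<And>n. f n \<in> borel_measurable M" using f by (simp add: sq_int_def)
  have "\<forall>j. \<exists>N. \<forall>m\<ge>N. \<forall>n\<ge>N. l2 M (\<lambda>x. f m x - f n x) \<le> (1/2)^j"
    using cau by auto
  then obtain N where N: "\<And>j m n. N j \<le> m \<Longrightarrow> N j \<le> n \<Longrightarrow> l2 M (\<lambda>x. f m x - f n x) \<le> (1/2)^j"
    by metis
  \<comment> \<open>Summing the \<open>N i\<close> makes the index sequence monotone and at least
    \<open>N j\<close>; the extra \<open>j\<close> forces it to infinity.\<close>
  define R where "R j = (\<Sum>i\<le>j. N i) + j" for j
  have RN: "N j \<le> R j" for j using member_le_sum[of j "{..j}" N] by (simp add: R_def)
  have Rmono: "R j \<le> R (Suc j)" for j by (simp add: R_def)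
  have Rge: "j \<le> R j" for j by (simp add: R_def)
  define D where "D j x = f (R (Suc j)) x - f (R j) x" for j x
  have Dsq: "sq_int M (D j)" for j unfolding D_def by (intro sq_int_diff f)
  have [measurable]: "D j \<in> borel_measurable M" for j using Dsq by (simp add: sq_int_def)
  define m where "m = sqrt (measure M (space M))"
  have m0: "0 \<le> m" by (simp add: m_def)
  have Dint: "(LINT x|M. norm (D j x)) \<le> (1/2)^j * m" for j
  proof -
    have "l2 M (D j) \<le> (1/2)^j" unfolding D_def
      by (rule N) (use RN Rmono order_trans in blast)+
    then show ?thesis using sq_int_integrable(2)[OF Dsq, of j] m0 unfolding m_def[symmetric]
      by (meson mult_right_mono order_trans)
  qed
  have "(\<integral>\<^sup>+x. (\<Sum>j. ennreal (norm (D j x))) \<partial>M) = (\<Sum>j. \<integral>\<^sup>+x. ennreal (norm (D j x)) \<partial>M)"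
    by (rule nn_integral_suminf) measurable
  also have "\<dots> = (\<Sum>j. ennreal (LINT x|M. norm (D j x)))"
    using nn_integral_eq_integral[OF integrable_norm[OF sq_int_integrable(1)[OF Dsq]]] by simp
  also have "\<dots> \<le> (\<Sum>j. ennreal ((1/2)^j * m))"
    by (intro suminf_le ennreal_leI Dint) auto
  also have "\<dots> = ennreal (\<Sum>j. (1/2)^j * m)"
    by (rule suminf_ennreal2) (use m0 in \<open>auto intro!: summable_mult2 summable_geometric\<close>)
  also have "\<dots> < \<infinity>" by simp
  finally have "AE x in M. (\<Sum>j. ennreal (norm (D j x))) \<noteq> \<infinity>"
    by (intro nn_integral_PInf_AE) auto
  then have conv: "AE x in M. convergent (\<lambda>j. f (R j) x)"
  proof eventually_elim
    case (elim x)
    then have "summable (\<lambda>j. norm (D j x))"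
      by (intro summable_suminf_not_top) auto
    then have "summable (\<lambda>j. D j x)" by (rule summable_norm_cancel)
    then have "convergent (\<lambda>n. \<Sum>j<n. D j x)" by (simp add: summable_iff_convergent)
    then have "convergent (\<lambda>n. f (R 0) x + (\<Sum>j<n. D j x))"
      by (simp add: convergent_add_const_iff)
    moreover have "f (R 0) x + (\<Sum>j<n. D j x) = f (R n) x" for n
      unfolding D_def by (subst sum_lessThan_telescope) simp
    ultimately show ?case by simp
  qed
  define g where "g x = lim (\<lambda>j. f (R j) x)" for x
  have gm[measurable]: "g \<in> borel_measurable M" unfolding g_def by (rule borel_measurable_lim_metric) measurable
  have lim: "AE x in M. (\<lambda>j. f (R j) x) \<longlonglongrightarrow> g x"
    using conv unfolding g_def by (auto simp: convergent_LIMSEQ_iff)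
  have key: "sq_int M (\<lambda>x. f n x - g x) \<and> l2 M (\<lambda>x. f n x - g x) \<le> e"
    if n: "n \<ge> K" and K: "\<forall>m\<ge>K. \<forall>n\<ge>K. l2 M (\<lambda>x. f m x - f n x) \<le> e" for n K e
  proof (rule l2_Fatou)
    show "sq_int M (\<lambda>x. f n x - f (R i) x)" for i by (intro sq_int_diff f)
    show "AE x in M. (\<lambda>i. f n x - f (R i) x) \<longlonglongrightarrow> f n x - g x"
      using lim by eventually_elim (intro tendsto_intros)
    show "\<forall>\<^sub>F i in sequentially. l2 M (\<lambda>x. f n x - f (R i) x) \<le> e"
      using eventually_ge_at_top[of K] by eventually_elim (use n K Rge order_trans in blast)
  qed measurable
  obtain K where "\<forall>m\<ge>K. \<forall>n\<ge>K. l2 M (\<lambda>x. f m x - f n x) \<le> 1" using cau[of 1] by auto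
  then have "sq_int M (\<lambda>x. f K x - g x)" using key by blast
  then have "sq_int M (\<lambda>x. f K x - (f K x - g x))" by (rule sq_int_diff[OF f])
  then have g: "sq_int M g" by simp
  moreover have "(\<lambda>n. l2 M (\<lambda>x. f n x - g x)) \<longlonglongrightarrow> 0"
  proof (rule LIMSEQ_I)
    fix r :: real assume r: "0 < r"
    then obtain K where "\<forall>m\<ge>K. \<forall>n\<ge>K. l2 M (\<lambda>x. f m x - f n x) \<le> r/2" using cau[of "r/2"] by auto
    then have "\<forall>n\<ge>K. l2 M (\<lambda>x. f n x - g x) \<le> r/2" using key by blast
    then show "\<exists>no. \<forall>n\<ge>no. norm (l2 M (\<lambda>x. f n x - g x) - 0) < r"
      using r by (intro exI[of _ K]) (auto intro: le_less_trans)
  qed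
  ultimately show thesis by (rule that)
qed

text \<open>Completeness of Lebesgue measure. Objects obtained by choice are known only up to null
  sets, and this is how they inherit measurability from an explicit representative.\<close>

lemma lebesgue_on_AE_measurable:
  fixes f g :: "'a::euclidean_space \<Rightarrow> 'b::euclidean_space"
  assumes S: "S \<in> sets lebesgue" and e: "AE x in lebesgue_on S. f x = g x"
    and g: "g \<in> borel_measurable (lebesgue_on S)"
  shows "f \<in> borel_measurable (lebesgue_on S)"
proof -
  have "AE x in lebesgue. x \<in> S \<longrightarrow> f x = g x"
    using e S by (subst (asm) AE_restrict_space_iff) auto
  then obtain N where N: "N \<in> null_sets lebesgue" "{x \<in> space lebesgue. \<not> (x \<in> S \<longrightarrow> f x = g x)} \<subseteq> N"
    unfolding eventually_ae_filter by blast
  then have "negligible N" by (simp add: negligible_iff_null_sets)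
  moreover have eq: "f x = g x" if "x \<in> S - N" for x using N(2) that by auto
  moreover have "g measurable_on S" by (rule iffD2[OF measurable_on_iff_borel_measurable[OF S] g])
  ultimately have "f measurable_on S" by (intro measurable_on_spike[of g S N f])
  then show ?thesis by (rule iffD1[OF measurable_on_iff_borel_measurable[OF S]])
qed

section \<open>Fourier modes on the cell\<close>

abbreviation corner :: "real \<Rightarrow> real^3" where
  "corner L \<equiv> (\<chi> i. L)"

definition rvec :: "int^3 \<Rightarrow> real^3" where
  "rvec k = (\<chi> i. of_int (k $ i))"

definition fmode :: "real \<Rightarrow> int^3 \<Rightarrow> real^3 \<Rightarrow> complex" where
  "fmode L k x = cis (2 * pi / L * (rvec k \<bullet> x))"

definition fcoef :: "real \<Rightarrow> (real^3 \<Rightarrow> complex) \<Rightarrow> int^3 \<Rightarrow> complex" where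
  "fcoef L f k = (LINT x|cell L. f x * cnj (fmode L k x)) / of_real (L ^ 3)"

lemma space_cell [simp]: "space (cell L) = cbox 0 (corner L)"
  by (simp add: cell_def)

lemma finite_measure_cell: "finite_measure (cell L)"
  unfolding cell_def by (rule finite_measure_lebesgue_on) auto

lemma measure_cell: "0 \<le> L \<Longrightarrow> measure (cell L) (cbox 0 (corner L)) = L ^ 3"
  by (subst cell_def, subst measure_restrict_space) (auto simp: content_cbox_cart interval_eq_empty_cart)

lemma continuous_borel_measurable_cell:
  fixes f :: "real^3 \<Rightarrow> 'b::euclidean_space"
  assumes "continuous_on UNIV f"
  shows "f \<in> borel_measurable (cell L)"
  unfolding cell_def
  by (rule continuous_imp_measurable_on_sets_lebesgue) (auto intro: continuous_on_subset[OF assms])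

lemma continuous_integrable_cell:
  fixes f :: "real^3 \<Rightarrow> 'b::euclidean_space"
  assumes "continuous_on UNIV f"
  shows "integrable (cell L) f"
  unfolding cell_def
  by (rule continuous_imp_integrable) (auto intro: continuous_on_subset[OF assms])

lemma integral_cell:
  fixes f :: "real^3 \<Rightarrow> 'b::euclidean_space"
  assumes "continuous_on UNIV f"
  shows "integral\<^sup>L (cell L) f = integral (cbox 0 (corner L)) f"
  using continuous_integrable_cell[OF assms, of L] unfolding cell_def
  by (rule lebesgue_integral_eq_integral) auto

text \<open>The boundary of a box is negligible. It is the part of the cell where the
  parametrization of the torus fails to be injective.\<close>

lemma AE_cell_interior: "AE x in cell L. \<forall>i. 0 < x $ i \<and> x $ i < L"
proof -
  have "cbox 0 (corner L) - box 0 (corner L) \<in> null_sets lebesgue"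
    using negligible_frontier_interval negligible_iff_null_sets by blast
  then have "AE x in lebesgue. x \<notin> cbox 0 (corner L) - box 0 (corner L)" by (rule AE_not_in)
  then have "AE x in lebesgue. x \<in> cbox 0 (corner L) \<longrightarrow> (\<forall>i. 0 < x $ i \<and> x $ i < L)"
    by eventually_elim (auto simp: mem_box_cart)
  then show ?thesis unfolding cell_def by (subst AE_restrict_space_iff) auto
qed

text \<open>The shifted cube is cut at the hyperplane where coordinate \<open>i\<close> equals
  \<open>L\<close>. Periodicity moves the protruding slab back by one period, and the two pieces
  reassemble to the original cube.\<close>

lemma integral_shift_periodic:
  fixes D :: "real^3 \<Rightarrow> 'b::euclidean_space"
  assumes cont: "continuous_on UNIV D" and per: "\<And>x. D (x + axis i L) = D x"
    and s: "0 \<le> s" "s \<le> L"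
  shows "integral (cbox 0 (corner L)) (\<lambda>x. D (x + axis i s)) = integral (cbox 0 (corner L)) D"
proof -
  have int: "D integrable_on cbox a b" for a b
    by (rule integrable_continuous) (rule continuous_on_subset[OF cont], simp)
  let ?b = "corner L"
  have sp: "cbox a b \<inter> {x. x $ i \<le> c} = cbox a (\<chi> j. if j = i then min (b$i) c else b$j)"
    "cbox a b \<inter> {x. x $ i \<ge> c} = cbox (\<chi> j. if j = i then max (a$i) c else a$j) b" for a b :: "real^3" and c
    using interval_split_cart[where a=a and b=b and k=i and c=c] by (simp_all add: interval_cbox_cart)
  have ax: "(axis i 1 :: real^3) \<in> Basis" by (simp add: axis_in_Basis_iff)
  have "integral (cbox 0 ?b) (\<lambda>x. D (x + axis i s)) = integral (cbox (axis i s) (?b + axis i s)) D"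
    using integral_shift_cbox[of "axis i s" "axis i s" "?b + axis i s" D] by simp
  also have "\<dots> = integral (cbox (axis i s) (?b + axis i s) \<inter> {x. x \<bullet> axis i 1 \<le> L}) D
      + integral (cbox (axis i s) (?b + axis i s) \<inter> {x. x \<bullet> axis i 1 \<ge> L}) D"
    by (rule integral_split[OF int ax])
  also have "cbox (axis i s) (?b + axis i s) \<inter> {x. x \<bullet> axis i 1 \<le> L} = cbox (axis i s) ?b"
    unfolding inner_axis inner_real_def mult_1_right mult_1 sp using s
    by (intro arg_cong2[where f=cbox]) (auto simp: vec_eq_iff axis_def)
  also have "cbox (axis i s) (?b + axis i s) \<inter> {x. x \<bullet> axis i 1 \<ge> L} = cbox (axis i L) (?b + axis i s)"
    unfolding inner_axis inner_real_def mult_1_right mult_1 sp using s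
    by (intro arg_cong2[where f=cbox]) (auto simp: vec_eq_iff axis_def)
  also have "integral (cbox (axis i L) (?b + axis i s)) D
      = integral (cbox 0 (?b + axis i s - axis i L)) D"
    using integral_shift_cbox[of "axis i L" "axis i L" "?b + axis i s" D] by (simp add: per)
  finally have *: "integral (cbox 0 ?b) (\<lambda>x. D (x + axis i s))
      = integral (cbox (axis i s) ?b) D + integral (cbox 0 (?b + axis i s - axis i L)) D" .
  have "integral (cbox 0 ?b) D = integral (cbox 0 ?b \<inter> {x. x \<bullet> axis i 1 \<le> s}) D
      + integral (cbox 0 ?b \<inter> {x. x \<bullet> axis i 1 \<ge> s}) D"
    by (rule integral_split[OF int ax])
  also have "cbox 0 ?b \<inter> {x. x \<bullet> axis i 1 \<le> s} = cbox 0 (?b + axis i s - axis i L)"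
    unfolding inner_axis inner_real_def mult_1_right mult_1 sp using s
    by (intro arg_cong2[where f=cbox]) (auto simp: vec_eq_iff axis_def)
  also have "cbox 0 ?b \<inter> {x. x \<bullet> axis i 1 \<ge> s} = cbox (axis i s) ?b"
    unfolding inner_axis inner_real_def mult_1_right mult_1 sp using s
    by (intro arg_cong2[where f=cbox]) (auto simp: vec_eq_iff axis_def)
  finally show ?thesis using * by simp
qed

text \<open>Average the fundamental theorem of calculus in direction \<open>i\<close> over the cell.\<close>

lemma integral_cell_derivative:
  fixes g D :: "real^3 \<Rightarrow> 'b::euclidean_space"
  assumes L: "L > 0"
    and deriv: "\<And>x. ((\<lambda>s. g (x + axis i s)) has_vector_derivative D x) (at 0)"
    and cont: "continuous_on UNIV D"
    and per: "\<And>x. g (x + axis i L) = g x" "\<And>x. D (x + axis i L) = D x"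
  shows "integral\<^sup>L (cell L) D = 0"
proof -
  have d: "((\<lambda>s. g (x + axis i s)) has_vector_derivative D (x + axis i t)) (at t)" for x t
  proof -
    have "((\<lambda>s. g ((x + axis i t) + axis i s)) has_vector_derivative D (x + axis i t)) (at (t - t))"
      using deriv[of "x + axis i t"] by simp
    then have "(((\<lambda>s. g ((x + axis i t) + axis i s)) \<circ> (\<lambda>s. s - t)) has_vector_derivative 1 *\<^sub>R D (x + axis i t)) (at t)"
      by (intro vector_diff_chain_at) (auto intro!: derivative_eq_intros)
    moreover have "(\<lambda>s. g ((x + axis i t) + axis i s)) \<circ> (\<lambda>s. s - t) = (\<lambda>s. g (x + axis i s))"
    proof
      fix s
      have "axis i t + axis i (s - t) = (axis i s :: real^3)"
        by (simp add: vec_eq_iff axis_def)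
      then show "((\<lambda>s. g ((x + axis i t) + axis i s)) \<circ> (\<lambda>s. s - t)) s = g (x + axis i s)"
        by (simp add: add.assoc)
    qed
    ultimately show ?thesis by simp
  qed
  have z: "integral (cbox 0 L) (\<lambda>s. D (x + axis i s)) = 0" for x
  proof -
    have "((\<lambda>s. D (x + axis i s)) has_integral (g (x + axis i L) - g (x + axis i 0))) {0..L}"
    proof (rule fundamental_theorem_of_calculus)
      show "((\<lambda>s. g (x + axis i s)) has_vector_derivative D (x + axis i t)) (at t within {0..L})" for t
        by (rule has_vector_derivative_at_within[OF d])
    qed (use L in simp)
    moreover have "(axis i 0 :: real^3) = 0" by (simp add: vec_eq_iff axis_def)
    ultimately show ?thesis using per by (simp add: integral_unique)
  qed
  have axs: "axis i s = s *\<^sub>R (axis i 1 :: real^3)" for s by (simp add: vec_eq_iff axis_def)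
  have c2: "continuous_on (cbox (0, 0) (corner L, L)) (\<lambda>(x, s). D (x + axis i s))"
    unfolding split_def
  proof (rule continuous_on_compose2[OF cont])
    have "continuous_on (cbox (0, 0) (corner L, L)) (\<lambda>p. fst p + snd p *\<^sub>R (axis i 1 :: real^3))"
      by (intro continuous_intros)
    then show "continuous_on (cbox (0, 0) (corner L, L)) (\<lambda>p. fst p + axis i (snd p))"
      by (subst axs)
  qed simp
  have "0 = integral (cbox 0 (corner L)) (\<lambda>x. integral (cbox 0 L) (\<lambda>s. D (x + axis i s)))"
    by (simp only: z integral_0)
  also have "\<dots> = integral (cbox 0 L) (\<lambda>s. integral (cbox 0 (corner L)) (\<lambda>x. D (x + axis i s)))"
    by (rule integral_swap_continuous[OF c2])
  also have "\<dots> = integral (cbox 0 L) (\<lambda>s. integral (cbox 0 (corner L)) D)"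
    by (rule Henstock_Kurzweil_Integration.integral_cong) (auto intro!: integral_shift_periodic cont per)
  also have "\<dots> = L *\<^sub>R integral (cbox 0 (corner L)) D"
    using L by simp
  finally show ?thesis using L by (simp add: integral_cell[OF cont])
qed

lemma rvec_simps [simp]: "rvec 0 = 0" "rvec (k + l) = rvec k + rvec l" "rvec (k - l) = rvec k - rvec l"
  "rvec (- k) = - rvec k" "rvec k $ i = of_int (k $ i)"
  by (auto simp: rvec_def vec_eq_iff)

lemma rvec_eq_0 [simp]: "rvec k = 0 \<longleftrightarrow> k = 0"
  by (auto simp: vec_eq_iff)

lemma fmode_0 [simp]: "fmode L 0 x = 1"
  by (simp add: fmode_def)

lemma fmode_add: "fmode L (k + l) x = fmode L k x * fmode L l x"
  by (simp add: fmode_def inner_add_left distrib_left cis_mult flip: add_divide_distrib)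

lemma cnj_fmode: "cnj (fmode L k x) = fmode L (- k) x"
  by (simp add: fmode_def cis_cnj)

lemma norm_fmode [simp]: "cmod (fmode L k x) = 1"
  by (simp add: fmode_def)

lemma fmode_continuous [continuous_intros]: "continuous_on S (fmode L k)"
  unfolding fmode_def by (intro continuous_intros)

lemma fmode_measurable [measurable]: "fmode L k \<in> borel_measurable (cell L')"
  by (rule continuous_borel_measurable_cell) (rule fmode_continuous)

lemma fmode_periodic: "L > 0 \<Longrightarrow> fmode L k (x + axis i L) = fmode L k x"
proof -
  assume L: "L > 0"
  have "2 * pi / L * (rvec k \<bullet> (x + axis i L)) = 2 * pi / L * (rvec k \<bullet> x) + 2 * pi * of_int (k $ i)"
    using L by (simp add: inner_add_right inner_axis field_simps)
  then show ?thesis unfolding fmode_def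
    by (simp add: cis_mult[symmetric] cis_multiple_2pi)
qed

lemma fmode_axis: "fmode L (axis i 1) x = cis (2 * pi / L * x $ i)"
proof -
  have "rvec (axis i 1) = axis i 1" by (simp add: vec_eq_iff axis_def rvec_def)
  then show ?thesis by (simp add: fmode_def inner_axis' )
qed

lemma fmode_has_derivative:
  "(fmode L k has_derivative (\<lambda>h. (\<i> * of_real (2 * pi / L * (rvec k \<bullet> h))) * fmode L k x)) (at x)"
proof -
  have "bounded_linear (\<lambda>h. \<i> * complex_of_real (2 * pi / L * (rvec k \<bullet> h)))"
    by (intro bounded_linear_const_mult bounded_linear_compose[OF bounded_linear_of_real] bounded_linear_inner_right)
  then have "((\<lambda>h. \<i> * complex_of_real (2 * pi / L * (rvec k \<bullet> h))) has_derivative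
      (\<lambda>h. \<i> * complex_of_real (2 * pi / L * (rvec k \<bullet> h)))) (at x)"
    by (rule bounded_linear_imp_has_derivative)
  from has_derivative_compose[OF this DERIV_exp[unfolded has_field_derivative_def]]
  have "((\<lambda>x. exp (\<i> * of_real (2 * pi / L * (rvec k \<bullet> x)))) has_derivative
      (\<lambda>h. (\<i> * of_real (2 * pi / L * (rvec k \<bullet> h))) * exp (\<i> * of_real (2 * pi / L * (rvec k \<bullet> x))))) (at x)"
    by (simp add: mult.commute)
  then show ?thesis by (simp add: fmode_def[abs_def] cis_conv_exp)
qed

lemma axis_derivative:
  fixes g :: "real^3 \<Rightarrow> 'b::real_normed_vector"
  assumes "(g has_derivative g') (at x)"
  shows "((\<lambda>s. g (x + axis i s)) has_vector_derivative g' (axis i 1)) (at (0::real))"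
proof -
  have axs: "axis i s = s *\<^sub>R (axis i 1 :: real^3)" for s by (simp add: vec_eq_iff axis_def)
  have "((\<lambda>s. x + s *\<^sub>R axis i 1) has_vector_derivative axis i 1) (at 0)"
    by (auto intro!: derivative_eq_intros)
  then have "((\<lambda>s. x + s *\<^sub>R axis i 1) has_derivative (\<lambda>s. s *\<^sub>R axis i 1)) (at 0)"
    by (simp add: has_vector_derivative_def)
  moreover have "(g has_derivative g') (at (x + 0 *\<^sub>R axis i 1))" using assms by simp
  ultimately have "((\<lambda>s. g (x + s *\<^sub>R axis i 1)) has_derivative (\<lambda>s. g' (s *\<^sub>R axis i 1))) (at 0)"
    by (rule has_derivative_compose)
  moreover have "g' (s *\<^sub>R axis i 1) = s *\<^sub>R g' (axis i 1)" for s
    using assms has_derivative_bounded_linear linear_simps(5) by blast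
  ultimately show ?thesis unfolding has_vector_derivative_def by (subst axs) simp
qed

text \<open>In a direction where \<open>k\<close> has a nonzero entry the mode is, up to a nonzero
  factor, its own derivative, so \<open>integral_cell_derivative\<close> makes its integral
  vanish.\<close>

lemma integral_fmode:
  assumes L: "L > 0"
  shows "integral\<^sup>L (cell L) (fmode L k) = (if k = 0 then of_real (L ^ 3) else 0)"
proof (cases "k = 0")
  case True
  then have "fmode L k = (\<lambda>x. 1)" by auto
  then show ?thesis using True L measure_cell[of L] by (simp add: scaleR_conv_of_real)
next
  case False
  then obtain i where i: "k $ i \<noteq> 0" by (auto simp: vec_eq_iff)
  define c where "c = \<i> * complex_of_real (2 * pi / L * of_int (k $ i))"
  have c0: "c \<noteq> 0" using i L by (simp add: c_def)
  have "integral\<^sup>L (cell L) (\<lambda>x. c * fmode L k x) = 0"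
  proof (rule integral_cell_derivative[OF L])
    show "((\<lambda>s. fmode L k (x + axis i s)) has_vector_derivative c * fmode L k x) (at 0)" for x
      using axis_derivative[OF fmode_has_derivative[of L k x], of i] by (simp add: c_def inner_axis)
  qed (auto intro!: continuous_intros fmode_periodic L simp: fmode_periodic[OF L])
  then show ?thesis using c0 False by simp
qed

section \<open>Trigonometric polynomials and uniqueness of Fourier coefficients\<close>

inductive trigpoly :: "real \<Rightarrow> (real^3 \<Rightarrow> complex) \<Rightarrow> bool" for L where
  mode: "trigpoly L (\<lambda>x. c * fmode L k x)"
| plus: "trigpoly L f \<Longrightarrow> trigpoly L g \<Longrightarrow> trigpoly L (\<lambda>x. f x + g x)"

lemma trigpoly_mult:
  assumes "trigpoly L f" "trigpoly L g"
  shows "trigpoly L (\<lambda>x. f x * g x)"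
  using assms
proof (induction rule: trigpoly.induct)
  case (mode c k)
  from mode show ?case
  proof (induction rule: trigpoly.induct)
    case (mode c' k')
    have "(\<lambda>x. c * fmode L k x * (c' * fmode L k' x)) = (\<lambda>x. (c * c') * fmode L (k + k') x)"
      by (simp add: fmode_add fun_eq_iff)
    then show ?case by (simp add: trigpoly.mode)
  next
    case (plus f g)
    then show ?case using trigpoly.plus by (simp add: distrib_left)
  qed
next
  case (plus f g)
  then show ?case using trigpoly.plus by (simp add: distrib_right)
qed

lemma trigpoly_sum: "(\<And>i. i \<in> I \<Longrightarrow> trigpoly L (f i)) \<Longrightarrow> trigpoly L (\<lambda>x. \<Sum>i\<in>I. f i x)"
proof (induction I rule: infinite_finite_induct)
  case (insert a I)
  then have "trigpoly L (\<lambda>x. f a x + (\<Sum>i\<in>I. f i x))" by (intro trigpoly.plus) auto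
  then show ?case using insert by simp
qed (use trigpoly.mode[of L 0] in auto)

text \<open>The torus embedded as a product of unit circles. On its compact image the
  Stone-Weierstrass theorem for real polynomials replaces Fejer-type summation.\<close>

definition torus_point :: "real \<Rightarrow> real^3 \<Rightarrow> complex^3" where
  "torus_point L x = (\<chi> i. cis (2 * pi / L * x $ i))"

lemma torus_point_continuous: "continuous_on S (torus_point L)"
  unfolding torus_point_def by (intro continuous_intros)

text \<open>Real and imaginary parts of \<open>cis\<close> are combinations of the modes with
  frequencies plus and minus \<open>axis i 1\<close>, and trigonometric polynomials are closed under
  sums and products.\<close>

lemma trigpoly_polynomial:
  assumes "real_polynomial_function P"
  shows "trigpoly L (\<lambda>x. complex_of_real (P (torus_point L x)))"
  using assms
proof (induction rule: real_polynomial_function.induct)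
  case (linear f)
  interpret bounded_linear f by fact
  \<comment> \<open>A functional that is only real-linear on \<open>complex^3\<close> is expanded in
    the real basis formed by \<open>axis i 1\<close> and \<open>axis i \<i>\<close>.\<close>
  have ex: "f z = (\<Sum>i\<in>UNIV. Re (z $ i) * f (axis i 1) + Im (z $ i) * f (axis i \<i>))" for z
  proof -
    have "z = (\<Sum>i\<in>UNIV. Re (z $ i) *\<^sub>R axis i 1 + Im (z $ i) *\<^sub>R axis i \<i>)"
      by (simp add: vec_eq_iff axis_def if_distrib sum.delta complex_eq_iff sum.distrib cong: if_cong)
    then have "f z = f (\<Sum>i\<in>UNIV. Re (z $ i) *\<^sub>R axis i 1 + Im (z $ i) *\<^sub>R axis i \<i>)" by simp
    also have "\<dots> = (\<Sum>i\<in>UNIV. Re (z $ i) * f (axis i 1) + Im (z $ i) * f (axis i \<i>))"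
      by (simp add: sum add scaleR)
    finally show ?thesis .
  qed
  have "trigpoly L (\<lambda>x. complex_of_real (Re (cis (2 * pi / L * x $ i)) * a + Im (cis (2 * pi / L * x $ i)) * b))"
    for i a b
  proof -
    have eq: "complex_of_real (Re (cis (2 * pi / L * x $ i)) * a + Im (cis (2 * pi / L * x $ i)) * b)
       = ((of_real a - \<i> * of_real b) / 2) * fmode L (axis i 1) x + ((of_real a + \<i> * of_real b) / 2) * fmode L (- axis i 1) x" for x
      by (simp add: cnj_fmode[symmetric] fmode_axis complex_eq_iff field_simps)
    show ?thesis unfolding eq by (intro trigpoly.intros)
  qed
  then have "trigpoly L (\<lambda>x. \<Sum>i\<in>UNIV. complex_of_real
      (Re (torus_point L x $ i) * f (axis i 1) + Im (torus_point L x $ i) * f (axis i \<i>)))"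
    by (intro trigpoly_sum) (simp add: torus_point_def)
  moreover have "complex_of_real (f (torus_point L x)) = (\<Sum>i\<in>UNIV. complex_of_real
      (Re (torus_point L x $ i) * f (axis i 1) + Im (torus_point L x $ i) * f (axis i \<i>)))" for x
    by (subst ex) (simp only: of_real_sum)
  ultimately show ?case by simp
next
  case (const c)
  then show ?case using trigpoly.mode[of L "of_real c" 0] by simp
next
  case (add f g)
  then show ?case by (simp add: trigpoly.plus)
next
  case (mult f g)
  then show ?case by (simp add: trigpoly_mult)
qed

lemma integral_polynomial_zero:
  fixes f :: "real^3 \<Rightarrow> real"
  assumes f: "integrable (cell L) f"
    and z: "\<And>k. (LINT x|cell L. of_real (f x) * fmode L k x) = 0"
    and P: "real_polynomial_function P"
  shows "(LINT x|cell L. f x * P (torus_point L x)) = 0"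
proof -
  have "integrable (cell L) (\<lambda>x. of_real (f x) * h x) \<and> (LINT x|cell L. of_real (f x) * h x) = 0"
    if "trigpoly L h" for h
    using that
  proof (induction rule: trigpoly.induct)
    case (mode c k)
    have m: "f \<in> borel_measurable (cell L)" using f by auto
    have i: "integrable (cell L) (\<lambda>x. of_real (f x) * fmode L k x)"
      by (rule Bochner_Integration.integrable_bound[OF f]) (use m in \<open>auto simp: norm_mult\<close>)
    have eq: "(\<lambda>x. of_real (f x) * (c * fmode L k x)) = (\<lambda>x. c * (of_real (f x) * fmode L k x))"
      by (simp add: fun_eq_iff)
    show ?case unfolding eq using i z[of k] by simp
  next
    case (plus f g)
    then show ?case by (simp add: distrib_left)
  qed
  from this[OF trigpoly_polynomial[OF P, of L]]
  have "(LINT x|cell L. complex_of_real (f x * P (torus_point L x))) = 0" by simp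
  then show ?thesis by (simp only: integral_complex_of_real of_real_eq_0_iff)
qed

text \<open>Stone-Weierstrass: \<open>\<Phi>\<close> is uniformly close to a polynomial on the image
  of the cell, polynomials integrate to zero against \<open>f\<close>, and the error is at most the
  L^1 norm of \<open>f\<close> times the distance.\<close>

lemma integral_torus_zero:
  fixes f :: "real^3 \<Rightarrow> real"
  assumes f: "integrable (cell L) f"
    and z: "\<And>k. (LINT x|cell L. of_real (f x) * fmode L k x) = 0"
    and Phi: "continuous_on {z. \<forall>i. cmod (z $ i) = 1} \<Phi>"
  shows "(LINT x|cell L. f x * \<Phi> (torus_point L x)) = 0"
proof -
  define S where "S = torus_point L ` cbox 0 (corner L)"
  have S: "compact S" unfolding S_def
    by (intro compact_continuous_image torus_point_continuous compact_cbox)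
  have sub: "S \<subseteq> {z. \<forall>i. cmod (z $ i) = 1}" by (auto simp: S_def torus_point_def)
  have cS: "continuous_on S \<Phi>" by (rule continuous_on_subset[OF Phi sub])
  note [measurable] = borel_measurable_integrable[OF f]
  have meas: "(\<lambda>x. h (torus_point L x)) \<in> borel_measurable (cell L)" if "continuous_on S h" for h :: "_ \<Rightarrow> real"
    unfolding cell_def
    by (rule continuous_imp_measurable_on_sets_lebesgue, rule continuous_on_compose2[OF that torus_point_continuous])
      (auto simp: S_def)
  have int: "integrable (cell L) (\<lambda>x. f x * h (torus_point L x))" if h: "continuous_on S h" for h :: "_ \<Rightarrow> real"
  proof -
    have "bounded (h ` S)" using compact_continuous_image[OF h S] compact_imp_bounded by blast
    then obtain B where B: "\<And>z. z \<in> S \<Longrightarrow> \<bar>h z\<bar> \<le> B" unfolding bounded_iff by auto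
    show ?thesis
    proof (rule Bochner_Integration.integrable_bound)
      show "integrable (cell L) (\<lambda>x. B * f x)" using f by simp
      show "(\<lambda>x. f x * h (torus_point L x)) \<in> borel_measurable (cell L)" using meas[OF h] by measurable
      show "AE x in cell L. norm (f x * h (torus_point L x)) \<le> norm (B * f x)"
      proof (rule AE_I2)
        fix x assume "x \<in> space (cell L)"
        then have "\<bar>h (torus_point L x)\<bar> \<le> \<bar>B\<bar>" using B[of "torus_point L x"] by (auto simp: S_def)
        then have "\<bar>f x\<bar> * \<bar>h (torus_point L x)\<bar> \<le> \<bar>f x\<bar> * \<bar>B\<bar>" by (intro mult_left_mono) auto
        then show "norm (f x * h (torus_point L x)) \<le> norm (B * f x)"
          by (simp add: abs_mult mult.commute)
      qed
    qed
  qed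
  define m where "m = (LINT x|cell L. \<bar>f x\<bar>)"
  have m0: "0 \<le> m" by (simp add: m_def)
  have "\<bar>LINT x|cell L. f x * \<Phi> (torus_point L x)\<bar> \<le> 0 + e" if e: "e > 0" for e
  proof -
    \<comment> \<open>The summand 1 keeps the tolerance meaningful when the L^1 norm
      \<open>m\<close> is zero; the final error is then m e / (m + 1) \<le> e.\<close>
    have "e / (m + 1) > 0" using e m0 by simp
    from Stone_Weierstrass_real_polynomial_function[OF S cS this]
    obtain P where P: "real_polynomial_function P" "\<And>z. z \<in> S \<Longrightarrow> \<bar>\<Phi> z - P z\<bar> < e / (m + 1)" by blast
    have cP: "continuous_on S P" using P(1) continuous_on_polymonial_function
      by (simp add: real_polynomial_function_eq continuous_on_polymonial_function)
    have "(LINT x|cell L. f x * \<Phi> (torus_point L x))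
        = (LINT x|cell L. f x * \<Phi> (torus_point L x)) - (LINT x|cell L. f x * P (torus_point L x))"
      using integral_polynomial_zero[OF f z P(1)] by simp
    also have "\<dots> = (LINT x|cell L. f x * \<Phi> (torus_point L x) - f x * P (torus_point L x))"
      by (rule Bochner_Integration.integral_diff[symmetric]) (intro int cS cP)+
    also have "\<bar>\<dots>\<bar> \<le> (LINT x|cell L. \<bar>f x\<bar> * (e / (m + 1)))"
    proof (rule integral_abs_bound[THEN order_trans], rule integral_mono)
      show "integrable (cell L) (\<lambda>x. \<bar>f x * \<Phi> (torus_point L x) - f x * P (torus_point L x)\<bar>)"
        by (intro integrable_abs Bochner_Integration.integrable_diff int cS cP)
      show "integrable (cell L) (\<lambda>x. \<bar>f x\<bar> * (e / (m + 1)))" using f by simp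
      fix x assume "x \<in> space (cell L)"
      then have "\<bar>\<Phi> (torus_point L x) - P (torus_point L x)\<bar> \<le> e / (m + 1)"
        using P(2)[of "torus_point L x"] by (auto simp: S_def)
      then show "\<bar>f x * \<Phi> (torus_point L x) - f x * P (torus_point L x)\<bar> \<le> \<bar>f x\<bar> * (e / (m + 1))"
        unfolding right_diff_distrib[symmetric] abs_mult by (intro mult_left_mono) auto
    qed
    also have "\<dots> = m * (e / (m + 1))" by (simp add: m_def)
    also have "\<dots> \<le> e" using e m0 by (simp add: field_simps)
    finally show ?thesis by simp
  qed
  then have "\<bar>LINT x|cell L. f x * \<Phi> (torus_point L x)\<bar> \<le> 0" by (rule field_le_epsilon)
  then show ?thesis by simp
qed


text \<open>\<open>Arg2pi\<close> is discontinuous on the nonnegative real axis, which meets the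
  unit circle only at 1. There a factor of the product vanishes, and boundedness of
  \<open>\<phi>\<close> forces the whole expression to zero; elsewhere all factors are
  continuous.\<close>

lemma torus_function_continuous:
  fixes \<phi> :: "real^3 \<Rightarrow> real"
  assumes c: "continuous_on UNIV \<phi>" and b: "\<And>x. \<bar>\<phi> x\<bar> \<le> 1"
  shows "continuous_on {z::complex^3. \<forall>i. cmod (z $ i) = 1}
    (\<lambda>z. \<phi> (\<chi> i. L / (2 * pi) * Arg2pi (z $ i)) * (\<Prod>i\<in>UNIV. cmod (1 - z $ i)))"
    (is "continuous_on ?S (\<lambda>z. ?A z * ?R z)")
proof (unfold continuous_on_eq_continuous_within, intro ballI)
  fix z :: "complex^3" assume z: "z \<in> ?S"
  have cR: "continuous (at z within ?S) ?R"
    by (intro continuous_intros)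
  show "continuous (at z within ?S) (\<lambda>z. ?A z * ?R z)"
  proof (cases "\<exists>i. z $ i = 1")
    case True
    then have R0: "?R z = 0" by auto
    have "((\<lambda>y. ?A y * ?R y) \<longlongrightarrow> 0) (at z within ?S)"
    proof (rule Lim_null_comparison)
      show "\<forall>\<^sub>F y in at z within ?S. norm (?A y * ?R y) \<le> ?R y"
        using b by (intro always_eventually allI) (auto simp: abs_mult prod_nonneg intro!: mult_left_le_one_le)
      show "(?R \<longlongrightarrow> 0) (at z within ?S)"
        using cR unfolding continuous_within R0 .
    qed
    then show ?thesis unfolding continuous_within R0 by simp
  next
    case False
    have n: "z $ i \<notin> \<real>\<^sub>\<ge>\<^sub>0" for i
    proof
      assume a: "z $ i \<in> \<real>\<^sub>\<ge>\<^sub>0"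
      moreover have "cmod (z $ i) = 1" using z by auto
      ultimately have "z $ i = 1"
        by (auto simp: complex_nonneg_Reals_iff complex_eq_iff cmod_def)
      then show False using False by blast
    qed
    have "continuous (at z within ?S) (\<lambda>z. Arg2pi (z $ i))" for i
      by (rule continuous_within_compose3[where f="\<lambda>z. z $ i", OF continuous_at_Arg2pi[OF n]]) (intro continuous_intros)
    then have "continuous (at z within ?S) (\<lambda>z. (\<chi> i. L / (2 * pi) * Arg2pi (z $ i)) :: real^3)"
      unfolding continuous_within by (intro tendsto_vec_lambda tendsto_mult tendsto_const) auto
    moreover have "isCont \<phi> (\<chi> i. L / (2 * pi) * Arg2pi (z $ i))"
      using c by (simp add: continuous_on_eq_continuous_at)
    ultimately have "continuous (at z within ?S) ?A"
      by (rule continuous_within_compose3[where g=\<phi> and f="\<lambda>z. \<chi> i. L / (2 * pi) * Arg2pi (z $ i)", rotated])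
    then show ?thesis using cR by (rule continuous_mult)
  qed
qed

text \<open>The weight \<open>\<rho>\<close> vanishes where the cell is glued, so that \<open>\<rho> \<phi>\<close> descends to a continuous
  function on the torus for every continuous \<open>\<phi>\<close>, periodic or not.\<close>

lemma fourier_unique_real:
  fixes f :: "real^3 \<Rightarrow> real"
  assumes L: "L > 0" and f: "integrable (cell L) f"
    and z: "\<And>k. (LINT x|cell L. of_real (f x) * fmode L k x) = 0"
  shows "AE x in cell L. f x = 0"
proof -
  define \<rho> where "\<rho> x = (\<Prod>i\<in>UNIV. cmod (1 - cis (2 * pi / L * x $ i)))" for x :: "real^3"
  have \<rho>c: "continuous_on UNIV \<rho>" unfolding \<rho>_def by (intro continuous_intros)
  have \<rho>m[measurable]: "\<rho> \<in> borel_measurable (cell L)" by (rule continuous_borel_measurable_cell[OF \<rho>c])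
  have fm[measurable]: "f \<in> borel_measurable (cell L)" using f by auto
  have \<rho>0: "0 \<le> \<rho> x" for x unfolding \<rho>_def by (intro prod_nonneg) auto
  have \<rho>8: "\<rho> x \<le> 8" for x
  proof -
    have "\<rho> x \<le> (\<Prod>i\<in>(UNIV::3 set). 2)" unfolding \<rho>_def
      by (intro prod_mono conjI norm_ge_zero order_trans[OF norm_triangle_ineq4]) auto
    then show ?thesis by simp
  qed
  have arg: "L / (2 * pi) * Arg2pi (cis (2 * pi / L * s)) = s" if "0 \<le> s" "s < L" for s
  proof -
    have "Arg2pi (exp (\<i> * of_real (2 * pi / L * s))) = 2 * pi / L * s"
      using that L by (subst Arg2pi_exp) (auto simp: field_simps)
    then show ?thesis using L by (simp add: cis_conv_exp)
  qed
  have test: "(LINT x|cell L. f x * (\<phi> x * \<rho> x)) = 0"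
    if c: "continuous_on UNIV \<phi>" and b: "\<And>x. \<bar>\<phi> x\<bar> \<le> 1" for \<phi> :: "real^3 \<Rightarrow> real"
  proof -
    let ?Phi = "\<lambda>z. \<phi> (\<chi> i. L / (2 * pi) * Arg2pi (z $ i)) * (\<Prod>i\<in>UNIV. cmod (1 - z $ i))"
    have "?Phi (torus_point L x) = \<phi> x * \<rho> x" if x: "x \<in> space (cell L)" for x
    proof (cases "\<forall>i. x $ i < L")
      case True
      then have "(\<chi> i. L / (2 * pi) * Arg2pi (torus_point L x $ i)) = x"
        using x arg by (auto simp: torus_point_def vec_eq_iff mem_box_cart)
      then show ?thesis by (simp add: \<rho>_def torus_point_def)
    next
      case False
      then obtain i where "x $ i = L" using x by (auto simp: mem_box_cart not_less intro: antisym)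
      then have "cis (2 * pi / L * x $ i) = 1" using L by simp
      then have "(\<Prod>i\<in>UNIV. cmod (1 - cis (2 * pi / L * x $ i))) = 0"
        by (intro prod_zero) (auto intro!: exI[of _ i])
      then show ?thesis by (simp add: \<rho>_def torus_point_def)
    qed
    then have "(LINT x|cell L. f x * (\<phi> x * \<rho> x)) = (LINT x|cell L. f x * ?Phi (torus_point L x))"
      by (intro Bochner_Integration.integral_cong) auto
    also have "\<dots> = 0"
      by (rule integral_torus_zero[OF f z torus_function_continuous[OF c b]])
    finally show ?thesis .
  qed
  have S: "cbox 0 (corner L) \<in> sets lebesgue" by auto
  \<comment> \<open>Lebesgue measurability provides continuous functions converging to sgn f off a
    negligible set. Truncated to [-1,1] they are admissible in \<open>test\<close>, and dominated
    convergence shows that |f| \<open>\<rho>\<close> has integral zero.\<close>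
  have "(\<lambda>x. sgn (f x)) \<in> borel_measurable (lebesgue_on (cbox 0 (corner L)))"
    using measurable_compose[OF fm borel_measurable_sgn] by (simp add: cell_def)
  then have "(\<lambda>x. sgn (f x)) measurable_on cbox 0 (corner L)"
    using measurable_on_iff_borel_measurable[OF S] by blast
  then obtain N g where N: "negligible N" and gc: "\<And>n. continuous_on UNIV (g n)"
    and gl: "\<And>x. x \<notin> N \<Longrightarrow> (\<lambda>n. g n x) \<longlonglongrightarrow> (if x \<in> cbox 0 (corner L) then sgn (f x) else 0)"
    unfolding measurable_on_def by blast
  define h where "h n x = max (-1) (min 1 (g n x))" for n x
  have hc: "continuous_on UNIV (h n)" for n unfolding h_def by (intro continuous_intros gc)
  have hb: "\<bar>h n x\<bar> \<le> 1" for n x by (auto simp: h_def)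
  have "AE x in lebesgue. x \<notin> N" using N negligible_iff_null_sets AE_not_in by blast
  then have "AE x in cell L. x \<notin> N" unfolding cell_def by (subst AE_restrict_space_iff) auto
  then have hl: "AE x in cell L. (\<lambda>n. f x * (h n x * \<rho> x)) \<longlonglongrightarrow> \<bar>f x\<bar> * \<rho> x"
    using AE_space
  proof eventually_elim
    case (elim x)
    then have "(\<lambda>n. h n x) \<longlonglongrightarrow> max (-1) (min 1 (sgn (f x)))"
      unfolding h_def using gl[of x] by (intro tendsto_intros) auto
    moreover have "max (-1) (min 1 (sgn (f x))) = sgn (f x)" by (auto simp: sgn_if)
    ultimately have "(\<lambda>n. f x * (h n x * \<rho> x)) \<longlonglongrightarrow> f x * (sgn (f x) * \<rho> x)"
      by (intro tendsto_intros) auto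
    then show ?case by (simp add: abs_sgn mult.assoc)
  qed
  have hm[measurable]: "h n \<in> borel_measurable (cell L)" for n by (rule continuous_borel_measurable_cell[OF hc])
  have "(\<lambda>n. LINT x|cell L. f x * (h n x * \<rho> x)) \<longlonglongrightarrow> (LINT x|cell L. \<bar>f x\<bar> * \<rho> x)"
  proof (rule integral_dominated_convergence[where w="\<lambda>x. \<bar>f x\<bar> * 8"])
    show "AE x in cell L. (\<lambda>n. f x * (h n x * \<rho> x)) \<longlonglongrightarrow> \<bar>f x\<bar> * \<rho> x" by (rule hl)
    show "AE x in cell L. norm (f x * (h n x * \<rho> x)) \<le> \<bar>f x\<bar> * 8" for n
    proof (rule AE_I2)
      fix x
      have "\<bar>h n x\<bar> * \<rho> x \<le> 1 * 8" using hb \<rho>8 \<rho>0 by (intro mult_mono) auto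
      then show "norm (f x * (h n x * \<rho> x)) \<le> \<bar>f x\<bar> * 8"
        using \<rho>0 by (simp add: abs_mult mult_left_mono)
    qed
  qed (use f in auto)
  then have i0: "(LINT x|cell L. \<bar>f x\<bar> * \<rho> x) = 0"
    unfolding test[OF hc hb] by (simp add: LIMSEQ_const_iff)
  have "integrable (cell L) (\<lambda>x. \<bar>f x\<bar> * \<rho> x)"
  proof (rule Bochner_Integration.integrable_bound)
    show "integrable (cell L) (\<lambda>x. f x * 8)" using f by simp
    show "AE x in cell L. norm (\<bar>f x\<bar> * \<rho> x) \<le> norm (f x * 8)"
    proof (rule AE_I2)
      fix x
      have "\<bar>f x\<bar> * \<rho> x \<le> \<bar>f x\<bar> * 8" by (intro mult_left_mono \<rho>8) simp
      then show "norm (\<bar>f x\<bar> * \<rho> x) \<le> norm (f x * 8)" using \<rho>0[of x] by (simp add: abs_mult)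
    qed
  qed measurable
  then have "AE x in cell L. \<bar>f x\<bar> * \<rho> x = 0"
    using i0 integral_nonneg_eq_0_iff_AE[of "cell L" "\<lambda>x. \<bar>f x\<bar> * \<rho> x"] \<rho>0 by auto
  then show ?thesis using AE_cell_interior
  proof eventually_elim
    case (elim x)
    \<comment> \<open>In the open cell no coordinate is glued: if \<open>cis\<close> took the value
      1, the inversion formula \<open>arg\<close> would give x_i = 0. Hence the weight is positive
      almost everywhere.\<close>
    have "cis (2 * pi / L * x $ i) \<noteq> 1" for i
    proof
      assume e: "cis (2 * pi / L * x $ i) = 1"
      have "x $ i = L / (2 * pi) * Arg2pi (cis (2 * pi / L * x $ i))" 
        by (rule arg[symmetric]) (use elim in \<open>auto intro: less_imp_le\<close>)
      also have "\<dots> = 0" unfolding e using Arg2pi_of_real[of 1] by simp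
      finally show False using elim(2)[rule_format, of i] by simp
    qed
    then have "cmod (1 - cis (2 * pi / L * x $ i)) \<noteq> 0" for i
      by (metis norm_eq_zero right_minus_eq)
    then have "\<rho> x \<noteq> 0" unfolding \<rho>_def by simp
    then show ?case using elim by simp
  qed
qed

text \<open>The coefficients of the complex conjugate vanish together with those of
  \<open>f\<close>, so the real case applies to real and imaginary part separately.\<close>

lemma fourier_unique:
  assumes L: "L > 0" and f: "integrable (cell L) f" and z: "\<And>k. fcoef L f k = 0"
  shows "AE x in cell L. f x = 0"
proof -
  have m: "f \<in> borel_measurable (cell L)" using f by auto
  have i: "integrable (cell L) (\<lambda>x. f x * fmode L k x)" for k
    by (rule Bochner_Integration.integrable_bound[OF f]) (use m in \<open>auto simp: norm_mult\<close>)
  have z': "(LINT x|cell L. f x * fmode L k x) = 0" for k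
    using z[of "- k"] L by (simp add: fcoef_def cnj_fmode)
  have zc: "(LINT x|cell L. cnj (f x) * fmode L k x) = 0" for k
  proof -
    have "(LINT x|cell L. cnj (f x * fmode L (- k) x)) = cnj 0" by (simp only: Bochner_Integration.integral_cnj z')
    then show ?thesis by (simp add: cnj_fmode)
  qed
  have ic: "integrable (cell L) (\<lambda>x. cnj (f x) * fmode L k x)" for k
  proof -
    have "integrable (cell L) (\<lambda>x. cnj (f x * fmode L (- k) x))" by (rule integrable_cnj[OF i])
    then show ?thesis by (simp add: cnj_fmode)
  qed
  have re: "AE x in cell L. Re (f x) = 0"
  proof (rule fourier_unique_real[OF L])
    show "integrable (cell L) (\<lambda>x. Re (f x))" using f by simp
    fix k
    have "(\<lambda>x. complex_of_real (Re (f x)) * fmode L k x) = (\<lambda>x. (f x * fmode L k x + cnj (f x) * fmode L k x) / 2)"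
      by (rule ext) (simp add: complex_eq_iff field_simps)
    then show "(LINT x|cell L. complex_of_real (Re (f x)) * fmode L k x) = 0"
      using z' zc i ic by simp
  qed
  have im: "AE x in cell L. Im (f x) = 0"
  proof (rule fourier_unique_real[OF L])
    show "integrable (cell L) (\<lambda>x. Im (f x))" using f by simp
    fix k
    have "(\<lambda>x. complex_of_real (Im (f x)) * fmode L k x)
        = (\<lambda>x. (f x * fmode L k x - cnj (f x) * fmode L k x) * (- \<i> / 2))"
      by (rule ext) (simp add: complex_eq_iff field_simps)
    then show "(LINT x|cell L. complex_of_real (Im (f x)) * fmode L k x) = 0"
      using z' zc i ic by simp
  qed
  from re im show ?thesis by eventually_elim (simp add: complex_eq_iff)
qed

section \<open>Fourier synthesis and Parseval's identity\<close>

lemma sq_int_cell_integrable: "sq_int (cell L) f \<Longrightarrow> integrable (cell L) f"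
  by (rule finite_measure.sq_int_integrable(1)[OF finite_measure_cell])

lemma sq_int_cell_continuous:
  fixes f :: "real^3 \<Rightarrow> 'b::euclidean_space"
  assumes "continuous_on UNIV f"
  shows "sq_int (cell L) f"
  unfolding sq_int_def
  by (intro conjI continuous_borel_measurable_cell continuous_integrable_cell assms continuous_intros)

lemma sq_int_fmode [simp]: "sq_int (cell L) (fmode L' k)"
  by (intro sq_int_cell_continuous continuous_intros)

lemma sq_int_mult_left:
  fixes f :: "'a \<Rightarrow> 'b::{real_normed_algebra,banach,second_countable_topology}"
  assumes "sq_int M f"
  shows "sq_int M (\<lambda>x. c * f x)"
proof -
  note [measurable] = sq_intD(1)[OF assms]
  show ?thesis by (rule sq_int_bound[where C="norm c", OF assms]) (auto simp: norm_mult_ineq)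
qed

lemma sq_int_prod_integrable:
  fixes f g :: "'a \<Rightarrow> complex"
  assumes f: "sq_int M f" and g: "sq_int M g"
  shows "integrable M (\<lambda>x. f x * g x)"
proof -
  note [measurable] = sq_intD(1)[OF f] sq_intD(1)[OF g]
  show ?thesis
    by (rule Bochner_Integration.integrable_bound[OF sq_int_norm_mult[OF f g]]) (auto simp: norm_mult)
qed

lemma borel_measurable_cnj [measurable (raw)]:
  "f \<in> borel_measurable M \<Longrightarrow> (\<lambda>x. cnj (f x)) \<in> borel_measurable M"
  by (erule measurable_compose) (intro borel_measurable_continuous_onI continuous_intros)

lemma sq_int_cnj: "sq_int M f \<Longrightarrow> sq_int M (\<lambda>x. cnj (f x))"
  by (rule sq_int_bound[where C=1]) (auto simp: sq_int_def)

lemma l2_prod_bound: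
  fixes f g :: "'a \<Rightarrow> complex"
  assumes f: "sq_int M f" and g: "sq_int M g"
  shows "cmod (LINT x|M. f x * g x) \<le> l2 M f * l2 M g"
  using integral_norm_bound[of M "\<lambda>x. f x * g x"] l2_Cauchy_Schwarz[OF f g]
  by (simp add: norm_mult)

lemma l2_fmode: "0 \<le> L \<Longrightarrow> l2 (cell L) (fmode L k) = sqrt (L ^ 3)"
  by (simp add: l2_def measure_cell)

lemma fcoef_norm_le:
  assumes L: "L > 0" and f: "sq_int (cell L) f"
  shows "cmod (fcoef L f k) \<le> l2 (cell L) f * sqrt (L ^ 3) / L ^ 3"
proof -
  have "cmod (LINT x|cell L. f x * cnj (fmode L k x)) \<le> l2 (cell L) f * sqrt (L ^ 3)"
    using l2_prod_bound[OF f sq_int_fmode[of L L "- k"]] L by (simp add: cnj_fmode l2_fmode)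
  then show ?thesis using L by (simp add: fcoef_def norm_divide norm_power divide_right_mono)
qed

lemma fcoef_add:
  assumes "sq_int (cell L) f" "sq_int (cell L) g"
  shows "fcoef L (\<lambda>x. f x + g x) k = fcoef L f k + fcoef L g k"
  using sq_int_prod_integrable[OF assms(1) sq_int_fmode[of L L "-k"]]
    sq_int_prod_integrable[OF assms(2) sq_int_fmode[of L L "-k"]]
  by (simp add: fcoef_def cnj_fmode distrib_right add_divide_distrib)

lemma fcoef_cmult: "fcoef L (\<lambda>x. c * f x) k = c * fcoef L f k"
  by (simp add: fcoef_def mult.assoc)

lemma fcoef_diff:
  assumes "sq_int (cell L) f" "sq_int (cell L) g"
  shows "fcoef L (\<lambda>x. f x - g x) k = fcoef L f k - fcoef L g k"
  using fcoef_add[OF assms(1) sq_int_mult_left[OF assms(2), of "-1"]] fcoef_cmult[of L "-1" g k] by simp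

lemma fcoef_sum:
  assumes "\<And>i. i \<in> I \<Longrightarrow> sq_int (cell L) (f i)"
  shows "fcoef L (\<lambda>x. \<Sum>i\<in>I. f i x) k = (\<Sum>i\<in>I. fcoef L (f i) k)"
  using assms
proof (induction I rule: infinite_finite_induct)
  case (insert a I)
  then have "fcoef L (\<lambda>x. f a x + (\<Sum>i\<in>I. f i x)) k = fcoef L (f a) k + fcoef L (\<lambda>x. \<Sum>i\<in>I. f i x) k"
    by (intro fcoef_add sq_int_sum) auto
  then show ?case using insert by simp
qed (auto simp: fcoef_def)

lemma fcoef_cnj: "fcoef L (\<lambda>x. cnj (f x)) k = cnj (fcoef L f (- k))"
  unfolding fcoef_def complex_cnj_divide complex_cnj_complex_of_real Bochner_Integration.integral_cnj[symmetric]
  by (simp add: cnj_fmode)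

lemma fcoef_AE_cong:
  assumes "f \<in> borel_measurable (cell L)" "g \<in> borel_measurable (cell L)" "AE x in cell L. f x = g x"
  shows "fcoef L f k = fcoef L g k"
proof -
  note [measurable] = assms(1,2)
  have "(LINT x|cell L. f x * cnj (fmode L k x)) = (LINT x|cell L. g x * cnj (fmode L k x))"
    unfolding cnj_fmode by (rule integral_cong_AE) (use assms(3) in auto)
  then show ?thesis by (simp add: fcoef_def)
qed

lemma fcoef_shift: "fcoef L (\<lambda>x. f x * fmode L l x) k = fcoef L f (k - l)"
proof -
  have "f x * fmode L l x * cnj (fmode L k x) = f x * cnj (fmode L (k - l) x)" for x
    unfolding cnj_fmode using fmode_add[of L l "- k" x] by (simp add: mult.assoc)
  then show ?thesis by (simp only: fcoef_def)
qed

lemma fcoef_one: "L > 0 \<Longrightarrow> fcoef L (fmode L l) k = (if k = l then 1 else 0)"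
  using fcoef_shift[of L "\<lambda>x. 1" l k] integral_fmode[of L "l - k"] by (simp add: fcoef_def cnj_fmode)

definition trig_sum :: "real \<Rightarrow> (int^3 \<Rightarrow> complex) \<Rightarrow> (int^3) set \<Rightarrow> real^3 \<Rightarrow> complex" where
  "trig_sum L c F x = (\<Sum>k\<in>F. c k * fmode L k x)"

lemma sq_int_trig_sum [simp]: "sq_int (cell L) (trig_sum L' c F)"
  unfolding trig_sum_def by (intro sq_int_sum sq_int_mult_left sq_int_fmode)

lemma fcoef_trig_sum:
  assumes "L > 0" "finite F"
  shows "fcoef L (trig_sum L c F) k = (if k \<in> F then c k else 0)"
proof -
  have "fcoef L (trig_sum L c F) k = (\<Sum>l\<in>F. c l * fcoef L (fmode L l) k)"
    unfolding trig_sum_def[abs_def]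
    by (subst fcoef_sum) (auto intro: sq_int_mult_left simp: fcoef_cmult)
  also have "\<dots> = (\<Sum>l\<in>F. if k = l then c l else 0)"
    using assms by (intro sum.cong) (auto simp: fcoef_one)
  finally show ?thesis using assms by simp
qed

lemma integral_trig_sum:
  assumes L: "L > 0" and f: "sq_int (cell L) f"
  shows "(LINT x|cell L. trig_sum L c F x * cnj (f x)) = of_real (L ^ 3) * (\<Sum>k\<in>F. c k * cnj (fcoef L f k))"
proof -
  have e: "(LINT x|cell L. fmode L k x * cnj (f x)) = of_real (L ^ 3) * cnj (fcoef L f k)" for k
  proof -
    have "cnj (fcoef L f k) = (LINT x|cell L. cnj (f x * cnj (fmode L k x))) / of_real (L ^ 3)"
      unfolding fcoef_def complex_cnj_divide complex_cnj_complex_of_real Bochner_Integration.integral_cnj[symmetric] ..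
    then show ?thesis using L by (simp add: mult.commute)
  qed
  have i: "integrable (cell L) (\<lambda>x. fmode L k x * cnj (f x))" for k
    by (intro sq_int_prod_integrable sq_int_fmode sq_int_cnj f)
  have "(LINT x|cell L. trig_sum L c F x * cnj (f x)) = (LINT x|cell L. (\<Sum>k\<in>F. c k * (fmode L k x * cnj (f x))))"
    by (simp add: trig_sum_def sum_distrib_right mult.assoc)
  also have "\<dots> = (\<Sum>k\<in>F. c k * (of_real (L ^ 3) * cnj (fcoef L f k)))"
    by (subst Bochner_Integration.integral_sum) (auto simp: i e)
  finally show ?thesis by (simp add: sum_distrib_left mult.left_commute)
qed

lemma l2_trig_sum:
  assumes L: "L > 0" and F: "finite F"
  shows "(l2 (cell L) (trig_sum L c F))\<^sup>2 = L ^ 3 * (\<Sum>k\<in>F. (cmod (c k))\<^sup>2)"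
proof -
  have "complex_of_real ((l2 (cell L) (trig_sum L c F))\<^sup>2)
      = (LINT x|cell L. trig_sum L c F x * cnj (trig_sum L c F x))"
    by (simp add: l2_sq complex_norm_square[symmetric] flip: integral_complex_of_real)
  also have "\<dots> = of_real (L ^ 3) * (\<Sum>k\<in>F. c k * cnj (c k))"
    using integral_trig_sum[OF L sq_int_trig_sum, of c F L c F] F by (simp add: fcoef_trig_sum[OF L F])
  also have "\<dots> = of_real (L ^ 3 * (\<Sum>k\<in>F. (cmod (c k))\<^sup>2))"
    by (simp only: complex_norm_square of_real_mult of_real_sum)
  finally show ?thesis using of_real_eq_iff by blast
qed

text \<open>Pythagoras. Nonnegativity of the left side is Bessel's inequality, and its convergence
  to zero is Parseval's identity.\<close>

lemma l2_diff_trig_sum: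
  assumes L: "L > 0" and F: "finite F" and f: "sq_int (cell L) f"
  shows "(l2 (cell L) (\<lambda>x. f x - trig_sum L (fcoef L f) F x))\<^sup>2
     = (l2 (cell L) f)\<^sup>2 - L ^ 3 * (\<Sum>k\<in>F. (cmod (fcoef L f k))\<^sup>2)"
proof -
  let ?S = "trig_sum L (fcoef L f) F"
  have i2: "integrable (cell L) (\<lambda>x. ?S x * cnj (f x))"
    by (intro sq_int_prod_integrable sq_int_trig_sum sq_int_cnj f)
  have "(LINT x|cell L. Re (?S x * cnj (f x))) = Re (LINT x|cell L. ?S x * cnj (f x))"
    using i2 by (rule integral_Re)
  also have "\<dots> = Re (of_real (L ^ 3) * (\<Sum>k\<in>F. fcoef L f k * cnj (fcoef L f k)))"
    by (subst integral_trig_sum[OF L f]) simp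
  also have "\<dots> = L ^ 3 * (\<Sum>k\<in>F. (cmod (fcoef L f k))\<^sup>2)"
    unfolding complex_norm_square[symmetric] of_real_sum[symmetric] of_real_mult[symmetric] by (simp only: Re_complex_of_real)
  finally have R: "(LINT x|cell L. Re (?S x * cnj (f x))) = L ^ 3 * (\<Sum>k\<in>F. (cmod (fcoef L f k))\<^sup>2)" .
  have "(cmod (f x - ?S x))\<^sup>2 = (cmod (f x))\<^sup>2 - 2 * Re (?S x * cnj (f x)) + (cmod (?S x))\<^sup>2" for x
    unfolding cmod_power2 by (simp add: power2_eq_square algebra_simps)
  then have "(l2 (cell L) (\<lambda>x. f x - ?S x))\<^sup>2
      = (LINT x|cell L. (cmod (f x))\<^sup>2 - 2 * Re (?S x * cnj (f x)) + (cmod (?S x))\<^sup>2)"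
    by (simp add: l2_sq)
  also have "\<dots> = (l2 (cell L) f)\<^sup>2 - 2 * (LINT x|cell L. Re (?S x * cnj (f x))) + (l2 (cell L) ?S)\<^sup>2"
    using sq_intD(2)[OF f] integrable_Re[OF i2] sq_intD(2)[OF sq_int_trig_sum, of L L "fcoef L f" F]
    by (simp add: l2_sq del: times_complex.sel)
  finally show ?thesis using R l2_trig_sum[OF L F] by simp
qed

text \<open>An exhaustion of the frequency lattice by finite sets, so that unordered sums become
  limits of sequences. The invariance under k -> -k keeps the truncations of real fields
  real.\<close>

definition cube :: "nat \<Rightarrow> (int^3) set" where
  "cube N = {k. \<forall>i. \<bar>k $ i\<bar> \<le> int N}"

lemma finite_cube [simp]: "finite (cube N)"
proof -
  have "cube N \<subseteq> vec_lambda ` (PiE UNIV (\<lambda>_. {- int N..int N}))"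
  proof
    fix k assume "k \<in> cube N"
    then have "vec_nth k \<in> PiE UNIV (\<lambda>_. {- int N..int N})" by (auto simp: cube_def PiE_def abs_le_iff) (smt (verit))
    then have "vec_lambda (vec_nth k) \<in> vec_lambda ` (PiE UNIV (\<lambda>_. {- int N..int N}))" by (rule imageI)
    then show "k \<in> vec_lambda ` (PiE UNIV (\<lambda>_. {- int N..int N}))" by simp
  qed
  then show ?thesis by (rule finite_subset) (intro finite_imageI finite_PiE; simp)
qed

lemma cube_mono: "m \<le> n \<Longrightarrow> cube m \<subseteq> cube n"
  unfolding cube_def by (auto intro: order_trans[of _ "int m" "int n"])

lemma cube_uminus [simp]: "- k \<in> cube N \<longleftrightarrow> k \<in> cube N"
  by (simp add: cube_def)

lemma in_cube_ex: "\<exists>N. k \<in> cube N"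
proof -
  have "\<bar>k $ i\<bar> \<le> (\<Sum>i\<in>UNIV. \<bar>k $ i\<bar>)" for i by (rule member_le_sum) auto
  then have "k \<in> cube (nat (\<Sum>i\<in>UNIV. \<bar>k $ i\<bar>))" by (simp add: cube_def sum_nonneg)
  then show ?thesis by blast
qed

lemma filterlim_cube: "filterlim cube (finite_subsets_at_top UNIV) sequentially"
  unfolding filterlim_finite_subsets_at_top
proof (intro allI impI)
  fix X :: "(int^3) set" assume "finite X \<and> X \<subseteq> UNIV"
  then have "finite X" by simp
  then have "\<exists>N. X \<subseteq> cube N"
  proof (induction X rule: finite_induct)
    case (insert x X)
    then obtain N where N: "X \<subseteq> cube N" by blast
    obtain M where "x \<in> cube M" using in_cube_ex by blast
    then have "insert x X \<subseteq> cube (max M N)"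
      using N cube_mono[of M "max M N"] cube_mono[of N "max M N"] by auto
    then show ?case by blast
  qed auto
  then obtain N where "X \<subseteq> cube N" ..
  then have "\<forall>\<^sub>F n in sequentially. X \<subseteq> cube n"
    using cube_mono by (intro eventually_sequentiallyI[of N]) blast
  then show "\<forall>\<^sub>F y in sequentially. finite (cube y) \<and> X \<subseteq> cube y \<and> cube y \<subseteq> UNIV"
    by simp
qed

lemma has_sum_cube: "(f has_sum s) UNIV \<Longrightarrow> (\<lambda>N. sum f (cube N)) \<longlonglongrightarrow> s"
  unfolding has_sum_def by (rule filterlim_compose[OF _ filterlim_cube])

text \<open>By orthogonality the distance between two cubic partial sums is a difference of partial
  sums of |c_k|^2, so they are Cauchy in L^2. Coefficients are continuous in L^2, and each one is
  eventually constant along the partial sums.\<close>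

lemma fourier_synthesis:
  assumes L: "L > 0" and c: "(\<lambda>k. (cmod (c k))\<^sup>2) summable_on UNIV"
  obtains f where "sq_int (cell L) f" "\<And>k. fcoef L f k = c k"
    "(\<lambda>N. l2 (cell L) (\<lambda>x. trig_sum L c (cube N) x - f x)) \<longlonglongrightarrow> 0"
proof -
  define s where "s N = (\<Sum>k\<in>cube N. (cmod (c k))\<^sup>2)" for N
  have "Cauchy s"
    using has_sum_cube[OF has_sum_infsum[OF c]] unfolding s_def by (rule LIMSEQ_imp_Cauchy)
  have d: "(l2 (cell L) (\<lambda>x. trig_sum L c (cube m) x - trig_sum L c (cube n) x))\<^sup>2 = L ^ 3 * (s m - s n)"
    if "n \<le> m" for m n
  proof -
    have sub: "cube n \<subseteq> cube m" using that by (rule cube_mono)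
    have "(\<lambda>x. trig_sum L c (cube m) x - trig_sum L c (cube n) x) = trig_sum L c (cube m - cube n)"
      using sub by (simp add: trig_sum_def fun_eq_iff sum_diff)
    moreover have "(\<Sum>k\<in>cube m - cube n. (cmod (c k))\<^sup>2) = s m - s n"
      using sub by (simp add: s_def sum_diff)
    ultimately show ?thesis using l2_trig_sum[OF L, of "cube m - cube n" c] by simp
  qed
  have d2: "(l2 (cell L) (\<lambda>x. trig_sum L c (cube m) x - trig_sum L c (cube n) x))\<^sup>2 = L ^ 3 * \<bar>s m - s n\<bar>" for m n
  proof (cases "n \<le> m")
    case True
    have "0 \<le> L ^ 3 * (s m - s n)" using d[OF True] by (metis zero_le_power2)
    then have "0 \<le> s m - s n" using L by (simp add: zero_le_mult_iff)
    then show ?thesis using d[OF True] by simp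
  next
    case False
    then have nm: "m \<le> n" by simp
    have "0 \<le> L ^ 3 * (s n - s m)" using d[OF nm] by (metis zero_le_power2)
    then have "0 \<le> s n - s m" using L by (simp add: zero_le_mult_iff)
    then show ?thesis using d[OF nm] l2_minus_commute[of "cell L" "trig_sum L c (cube m)" "trig_sum L c (cube n)"] by simp
  qed
  obtain f where f: "sq_int (cell L) f" and lim: "(\<lambda>N. l2 (cell L) (\<lambda>x. trig_sum L c (cube N) x - f x)) \<longlonglongrightarrow> 0"
  proof (rule finite_measure.l2_complete[OF finite_measure_cell, where f="\<lambda>N. trig_sum L c (cube N)"])
    fix e :: real assume e: "0 < e"
    then have "0 < e\<^sup>2 / L ^ 3" using L by simp
    with \<open>Cauchy s\<close> obtain N where N: "\<And>m n. N \<le> m \<Longrightarrow> N \<le> n \<Longrightarrow> \<bar>s m - s n\<bar> < e\<^sup>2 / L ^ 3"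
      unfolding Cauchy_def dist_real_def by blast
    have "l2 (cell L) (\<lambda>x. trig_sum L c (cube m) x - trig_sum L c (cube n) x) \<le> e" if "N \<le> m" "N \<le> n" for m n
    proof (rule power2_le_imp_le)
      show "(l2 (cell L) (\<lambda>x. trig_sum L c (cube m) x - trig_sum L c (cube n) x))\<^sup>2 \<le> e\<^sup>2"
        unfolding d2 using N[OF that] L by (simp add: field_simps)
    qed (use e in simp)
    then show "\<exists>N. \<forall>m\<ge>N. \<forall>n\<ge>N. l2 (cell L) (\<lambda>x. trig_sum L c (cube m) x - trig_sum L c (cube n) x) \<le> e" by blast
  qed (auto intro: that)
  have "fcoef L f k = c k" for k
  proof -
    define b where "b = sqrt (L ^ 3) / L ^ 3"
    have "(\<lambda>N. fcoef L (trig_sum L c (cube N)) k - fcoef L f k) \<longlonglongrightarrow> 0"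
    proof (rule Lim_null_comparison)
      show "\<forall>\<^sub>F N in sequentially. norm (fcoef L (trig_sum L c (cube N)) k - fcoef L f k)
          \<le> l2 (cell L) (\<lambda>x. trig_sum L c (cube N) x - f x) * b"
        using fcoef_norm_le[OF L sq_int_diff[OF sq_int_trig_sum f]]
        by (intro always_eventually allI) (simp add: fcoef_diff[OF sq_int_trig_sum f, symmetric] b_def)
      show "(\<lambda>N. l2 (cell L) (\<lambda>x. trig_sum L c (cube N) x - f x) * b) \<longlonglongrightarrow> 0"
        using tendsto_mult_right[OF lim, of b] by simp
    qed
    then have "(\<lambda>N. fcoef L (trig_sum L c (cube N)) k) \<longlonglongrightarrow> fcoef L f k" by (simp add: LIM_zero_iff)
    moreover have "\<forall>\<^sub>F N in sequentially. fcoef L (trig_sum L c (cube N)) k = c k"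
    proof -
      obtain M where "k \<in> cube M" using in_cube_ex by blast
      then have "\<And>N. M \<le> N \<Longrightarrow> k \<in> cube N" using cube_mono by blast
      then show ?thesis by (intro eventually_sequentiallyI[of M]) (simp add: fcoef_trig_sum[OF L])
    qed
    then have "(\<lambda>N. fcoef L (trig_sum L c (cube N)) k) \<longlonglongrightarrow> c k" by (rule tendsto_eventually)
    ultimately show ?thesis by (rule LIMSEQ_unique)
  qed
  then show thesis using f lim that by blast
qed

text \<open>Bessel makes the coefficients square summable, so they synthesize some \<open>g\<close>;
  by uniqueness \<open>g\<close> equals \<open>f\<close> almost everywhere. Hence the partial sums
  converge to \<open>f\<close> itself and the defect in Pythagoras tends to zero.\<close>

lemma parseval_norm:
  assumes L: "L > 0" and f: "sq_int (cell L) f"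
  shows "((\<lambda>k. (cmod (fcoef L f k))\<^sup>2) has_sum (l2 (cell L) f)\<^sup>2 / L ^ 3) UNIV"
proof -
  let ?c = "fcoef L f"
  have bessel: "(\<Sum>k\<in>F. (cmod (?c k))\<^sup>2) \<le> (l2 (cell L) f)\<^sup>2 / L ^ 3" if "finite F" for F
  proof -
    have "0 \<le> (l2 (cell L) f)\<^sup>2 - L ^ 3 * (\<Sum>k\<in>F. (cmod (?c k))\<^sup>2)"
      unfolding l2_diff_trig_sum[OF L that f, symmetric] by simp
    then show ?thesis using L by (simp add: field_simps)
  qed
  then have sum: "(\<lambda>k. (cmod (?c k))\<^sup>2) summable_on UNIV"
    by (intro nonneg_bdd_above_summable_on) (auto intro!: bdd_aboveI)
  then obtain g where g: "sq_int (cell L) g" "\<And>k. fcoef L g k = ?c k"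
    and lim: "(\<lambda>N. l2 (cell L) (\<lambda>x. trig_sum L ?c (cube N) x - g x)) \<longlonglongrightarrow> 0"
    using fourier_synthesis[OF L] by blast
  have "AE x in cell L. f x - g x = 0"
    by (rule fourier_unique[OF L sq_int_cell_integrable[OF sq_int_diff[OF f g(1)]]])
      (simp add: fcoef_diff[OF f g(1)] g(2))
  then have ae: "AE x in cell L. trig_sum L ?c (cube N) x - g x = trig_sum L ?c (cube N) x - f x" for N
    by eventually_elim simp
  have "l2 (cell L) (\<lambda>x. trig_sum L ?c (cube N) x - g x) = l2 (cell L) (\<lambda>x. f x - trig_sum L ?c (cube N) x)" for N
    using l2_AE_cong[OF sq_intD(1) sq_intD(1) ae, OF sq_int_diff[OF sq_int_trig_sum g(1)] sq_int_diff[OF sq_int_trig_sum f]]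
      l2_minus_commute by metis
  then have "(\<lambda>N. (l2 (cell L) (\<lambda>x. f x - trig_sum L ?c (cube N) x))\<^sup>2) \<longlonglongrightarrow> 0\<^sup>2"
    using lim by (intro tendsto_power) simp
  then have "(\<lambda>N. (l2 (cell L) f)\<^sup>2 - L ^ 3 * (\<Sum>k\<in>cube N. (cmod (?c k))\<^sup>2)) \<longlonglongrightarrow> 0"
    unfolding l2_diff_trig_sum[OF L finite_cube f] by simp
  moreover have "(\<lambda>N. (l2 (cell L) f)\<^sup>2 - L ^ 3 * (\<Sum>k\<in>cube N. (cmod (?c k))\<^sup>2))
      \<longlonglongrightarrow> (l2 (cell L) f)\<^sup>2 - L ^ 3 * infsum (\<lambda>k. (cmod (?c k))\<^sup>2) UNIV"
    by (intro tendsto_intros has_sum_cube has_sum_infsum sum)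
  ultimately have "(l2 (cell L) f)\<^sup>2 - L ^ 3 * infsum (\<lambda>k. (cmod (?c k))\<^sup>2) UNIV = 0"
    using LIMSEQ_unique by blast
  then have "infsum (\<lambda>k. (cmod (?c k))\<^sup>2) UNIV = (l2 (cell L) f)\<^sup>2 / L ^ 3" using L by (simp add: field_simps)
  then show ?thesis using sum by (simp add: has_sum_iff)
qed

text \<open>The error after summing over a finite set is the inner product of f - S_F with g, and
  the norm of f - S_F tends to zero along finite sets by \<open>parseval_norm\<close>.\<close>

theorem parseval:
  assumes L: "L > 0" and f: "sq_int (cell L) f" and g: "sq_int (cell L) g"
  shows "((\<lambda>k. fcoef L f k * cnj (fcoef L g k)) has_sum (LINT x|cell L. f x * cnj (g x)) / of_real (L ^ 3)) UNIV"
proof -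
  let ?c = "fcoef L f"
  let ?F = "finite_subsets_at_top (UNIV :: (int^3) set)"
  have fin: "\<forall>\<^sub>F F in ?F. finite F" by (rule eventually_finite_subsets_at_top_weakI) simp
  have "((\<lambda>F. sqrt ((l2 (cell L) f)\<^sup>2 - L ^ 3 * (\<Sum>k\<in>F. (cmod (?c k))\<^sup>2))) \<longlongrightarrow>
      sqrt ((l2 (cell L) f)\<^sup>2 - L ^ 3 * ((l2 (cell L) f)\<^sup>2 / L ^ 3))) ?F"
    using parseval_norm[OF L f] unfolding has_sum_def by (intro tendsto_intros)
  then have lim: "((\<lambda>F. sqrt ((l2 (cell L) f)\<^sup>2 - L ^ 3 * (\<Sum>k\<in>F. (cmod (?c k))\<^sup>2))) \<longlongrightarrow> 0) ?F"
    using L by simp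
  have "((\<lambda>F. (LINT x|cell L. f x * cnj (g x)) - of_real (L ^ 3) * (\<Sum>k\<in>F. ?c k * cnj (fcoef L g k))) \<longlongrightarrow> 0) ?F"
  proof (rule Lim_null_comparison)
    show "\<forall>\<^sub>F F in ?F. norm ((LINT x|cell L. f x * cnj (g x)) - of_real (L ^ 3) * (\<Sum>k\<in>F. ?c k * cnj (fcoef L g k)))
        \<le> sqrt ((l2 (cell L) f)\<^sup>2 - L ^ 3 * (\<Sum>k\<in>F. (cmod (?c k))\<^sup>2)) * l2 (cell L) (\<lambda>x. cnj (g x))"
      using fin
    proof eventually_elim
      case (elim F)
      have "(LINT x|cell L. f x * cnj (g x)) - of_real (L ^ 3) * (\<Sum>k\<in>F. ?c k * cnj (fcoef L g k))
          = (LINT x|cell L. f x * cnj (g x)) - (LINT x|cell L. trig_sum L ?c F x * cnj (g x))"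
        by (simp only: integral_trig_sum[OF L g])
      also have "\<dots> = (LINT x|cell L. (f x - trig_sum L ?c F x) * cnj (g x))"
        unfolding left_diff_distrib
        by (intro Bochner_Integration.integral_diff[symmetric] sq_int_prod_integrable f g sq_int_cnj sq_int_trig_sum)
      also have "cmod \<dots> \<le> l2 (cell L) (\<lambda>x. f x - trig_sum L ?c F x) * l2 (cell L) (\<lambda>x. cnj (g x))"
        by (intro l2_prod_bound sq_int_diff f g sq_int_cnj sq_int_trig_sum)
      also have "l2 (cell L) (\<lambda>x. f x - trig_sum L ?c F x) = sqrt ((l2 (cell L) f)\<^sup>2 - L ^ 3 * (\<Sum>k\<in>F. (cmod (?c k))\<^sup>2))"
        unfolding l2_diff_trig_sum[OF L elim f, symmetric] by simp
      finally show ?case .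
    qed
    show "((\<lambda>F. sqrt ((l2 (cell L) f)\<^sup>2 - L ^ 3 * (\<Sum>k\<in>F. (cmod (?c k))\<^sup>2)) * l2 (cell L) (\<lambda>x. cnj (g x))) \<longlongrightarrow> 0) ?F"
      using tendsto_mult_right[OF lim] by (simp add: mult_ac)
  qed
  then have "((\<lambda>F. ((LINT x|cell L. f x * cnj (g x)) -
      ((LINT x|cell L. f x * cnj (g x)) - of_real (L ^ 3) * (\<Sum>k\<in>F. ?c k * cnj (fcoef L g k)))) / of_real (L ^ 3))
      \<longlongrightarrow> ((LINT x|cell L. f x * cnj (g x)) - 0) / of_real (L ^ 3)) ?F"
    using L by (intro tendsto_intros) auto
  then show ?thesis using L unfolding has_sum_def by simp
qed

section \<open>Vector fields and their Fourier coefficients\<close>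

definition vcoef :: "real \<Rightarrow> vfield \<Rightarrow> int^3 \<Rightarrow> complex^3" where
  "vcoef L g k = (\<chi> i. fcoef L (\<lambda>x. complex_of_real (g x $ i)) k)"

lemma L2_iff: "g \<in> L2 L \<longleftrightarrow> sq_int (cell L) g"
  by (simp add: L2_def sq_int_def)

lemma L2_norm_eq: "L2_norm L g = l2 (cell L) g"
  by (simp add: L2_norm_def L2_inner_def l2_def dot_square_norm)

lemma borel_measurable_vec_nth [measurable (raw)]:
  fixes f :: "'a \<Rightarrow> ('b::euclidean_space)^'n"
  shows "f \<in> borel_measurable M \<Longrightarrow> (\<lambda>x. f x $ i) \<in> borel_measurable M"
  by (erule measurable_compose) (intro borel_measurable_continuous_onI continuous_intros)

lemma sq_int_component:
  fixes g :: "'a \<Rightarrow> real^3"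
  assumes g: "sq_int M g"
  shows "sq_int M (\<lambda>x. complex_of_real (g x $ i))"
proof -
  note [measurable] = sq_intD(1)[OF g]
  show ?thesis
    by (rule sq_int_bound[where C=1, OF g]) (use component_le_norm_cart in \<open>auto\<close>)
qed

lemma L2_component: "g \<in> L2 L \<Longrightarrow> sq_int (cell L) (\<lambda>x. complex_of_real (g x $ i))"
  unfolding L2_iff by (rule sq_int_component)

lemma L2_add: "g \<in> L2 L \<Longrightarrow> h \<in> L2 L \<Longrightarrow> (\<lambda>x. g x + h x) \<in> L2 L"
  and L2_diff: "g \<in> L2 L \<Longrightarrow> h \<in> L2 L \<Longrightarrow> (\<lambda>x. g x - h x) \<in> L2 L"
  and L2_scaleR: "g \<in> L2 L \<Longrightarrow> (\<lambda>x. c *\<^sub>R g x) \<in> L2 L"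
  and L2_uminus: "g \<in> L2 L \<Longrightarrow> (\<lambda>x. - g x) \<in> L2 L"
  unfolding L2_iff by (auto intro: sq_int_add sq_int_diff sq_int_scaleR sq_int_uminus)

lemma L2_zero [simp]: "(\<lambda>x. 0) \<in> L2 L"
  by (simp add: L2_iff)

lemma L2_sum: "(\<And>i. i \<in> I \<Longrightarrow> f i \<in> L2 L) \<Longrightarrow> (\<lambda>x. \<Sum>i\<in>I. f i x) \<in> L2 L"
  unfolding L2_iff by (rule sq_int_sum)

lemma L2_prod_integrable:
  assumes "g \<in> L2 L" "h \<in> L2 L"
  shows "integrable (cell L) (\<lambda>x. g x \<bullet> h x)"
proof -
  have g: "sq_int (cell L) g" and h: "sq_int (cell L) h" using assms by (auto simp: L2_iff)
  note [measurable] = sq_intD(1)[OF g] sq_intD(1)[OF h]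
  show ?thesis
    by (rule Bochner_Integration.integrable_bound[OF sq_int_norm_mult[OF g h]])
      (auto simp: Cauchy_Schwarz_ineq2)
qed

lemma L2_inner_commute: "L2_inner L g h = L2_inner L h g"
  by (simp add: L2_inner_def inner_commute)

lemma L2_inner_add_left:
  "g \<in> L2 L \<Longrightarrow> g' \<in> L2 L \<Longrightarrow> h \<in> L2 L \<Longrightarrow> L2_inner L (\<lambda>x. g x + g' x) h = L2_inner L g h + L2_inner L g' h"
  by (simp add: L2_inner_def inner_add_left L2_prod_integrable)

lemma L2_inner_diff_left:
  "g \<in> L2 L \<Longrightarrow> g' \<in> L2 L \<Longrightarrow> h \<in> L2 L \<Longrightarrow> L2_inner L (\<lambda>x. g x - g' x) h = L2_inner L g h - L2_inner L g' h"
  by (simp add: L2_inner_def inner_diff_left L2_prod_integrable)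

lemma L2_inner_scaleR_left: "L2_inner L (\<lambda>x. c *\<^sub>R g x) h = c * L2_inner L g h"
  by (simp add: L2_inner_def)

lemma L2_inner_scaleR_right: "L2_inner L g (\<lambda>x. c *\<^sub>R h x) = c * L2_inner L g h"
  by (simp add: L2_inner_def)

lemma L2_inner_sum_left:
  "(\<And>i. i \<in> I \<Longrightarrow> f i \<in> L2 L) \<Longrightarrow> h \<in> L2 L \<Longrightarrow> L2_inner L (\<lambda>x. \<Sum>i\<in>I. f i x) h = (\<Sum>i\<in>I. L2_inner L (f i) h)"
  by (simp add: L2_inner_def inner_sum_left L2_prod_integrable)

lemma L2_inner_sum_right:
  "(\<And>i. i \<in> I \<Longrightarrow> f i \<in> L2 L) \<Longrightarrow> h \<in> L2 L \<Longrightarrow> L2_inner L h (\<lambda>x. \<Sum>i\<in>I. f i x) = (\<Sum>i\<in>I. L2_inner L h (f i))"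
  using L2_inner_sum_left[of I f L h] by (simp add: L2_inner_commute)

lemma L2_inner_Cauchy_Schwarz:
  assumes "g \<in> L2 L" "h \<in> L2 L"
  shows "\<bar>L2_inner L g h\<bar> \<le> L2_norm L g * L2_norm L h"
proof -
  have g: "sq_int (cell L) g" and h: "sq_int (cell L) h" using assms by (auto simp: L2_iff)
  have "\<bar>L2_inner L g h\<bar> \<le> (LINT x|cell L. \<bar>g x \<bullet> h x\<bar>)"
    unfolding L2_inner_def by (rule integral_abs_bound)
  also have "\<dots> \<le> (LINT x|cell L. norm (g x) * norm (h x))"
    by (intro integral_mono integrable_abs L2_prod_integrable assms sq_int_norm_mult g h Cauchy_Schwarz_ineq2)
  finally show ?thesis using l2_Cauchy_Schwarz[OF g h] by (simp add: L2_norm_eq)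
qed

lemma L2_norm_sq: "(L2_norm L g)\<^sup>2 = L2_inner L g g"
  by (simp add: L2_norm_def L2_inner_def)

lemma ae_eq_refl [simp]: "ae_eq L g g"
  by (simp add: ae_eq_def)

lemma ae_eq_sym: "ae_eq L g h \<Longrightarrow> ae_eq L h g"
  unfolding ae_eq_def by auto

lemma ae_eq_measurable:
  "ae_eq L g h \<Longrightarrow> h \<in> borel_measurable (cell L) \<Longrightarrow> g \<in> borel_measurable (cell L)"
  unfolding ae_eq_def cell_def by (rule lebesgue_on_AE_measurable) auto

lemma ae_eq_L2:
  assumes e: "ae_eq L g h" and h: "h \<in> L2 L"
  shows "g \<in> L2 L"
proof -
  have h': "sq_int (cell L) h" using h by (simp add: L2_iff)
  have "AE x in cell L. h x = g x" using ae_eq_sym[OF e] by (simp add: ae_eq_def)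
  from sq_int_AE_cong[OF h' ae_eq_measurable[OF e sq_intD(1)[OF h']] this]
  show ?thesis by (simp add: L2_iff)
qed

lemma ae_eq_vcoef:
  assumes "ae_eq L g h" "h \<in> L2 L"
  shows "vcoef L g k = vcoef L h k"
proof -
  have "g \<in> L2 L" by (rule ae_eq_L2[OF assms])
  then show ?thesis unfolding vcoef_def vec_eq_iff
    using assms by (auto intro!: fcoef_AE_cong sq_intD(1)[OF L2_component] simp: ae_eq_def)
qed

lemma ae_eq_L2_inner:
  assumes "ae_eq L g h" "h \<in> L2 L" "\<phi> \<in> L2 L"
  shows "L2_inner L g \<phi> = L2_inner L h \<phi>"
proof -
  have "g \<in> L2 L" by (rule ae_eq_L2[OF assms(1,2)])
  then show ?thesis unfolding L2_inner_def
    using assms by (intro integral_cong_AE borel_measurable_integrable[OF L2_prod_integrable]) (auto simp: ae_eq_def)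
qed

lemma vcoef_add: "g \<in> L2 L \<Longrightarrow> h \<in> L2 L \<Longrightarrow> vcoef L (\<lambda>x. g x + h x) k = vcoef L g k + vcoef L h k"
  by (simp add: vcoef_def vec_eq_iff fcoef_add L2_component)

lemma vcoef_diff: "g \<in> L2 L \<Longrightarrow> h \<in> L2 L \<Longrightarrow> vcoef L (\<lambda>x. g x - h x) k = vcoef L g k - vcoef L h k"
  by (simp add: vcoef_def vec_eq_iff fcoef_diff L2_component)

lemma vcoef_scaleR: "vcoef L (\<lambda>x. c *\<^sub>R g x) k = c *\<^sub>R vcoef L g k"
  unfolding vec_eq_iff vector_scaleR_component
  by (simp add: vcoef_def fcoef_cmult scaleR_conv_of_real[where 'a=complex])

lemma vcoef_uminus: "vcoef L (\<lambda>x. - g x) k = - vcoef L g k"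
  using vcoef_scaleR[of L "-1" g k] by simp

lemma vcoef_zero [simp]: "vcoef L (\<lambda>x. 0) k = 0"
  by (simp add: vcoef_def vec_eq_iff fcoef_def)

lemma vcoef_sum:
  "(\<And>i. i \<in> I \<Longrightarrow> f i \<in> L2 L) \<Longrightarrow> vcoef L (\<lambda>x. \<Sum>i\<in>I. f i x) k = (\<Sum>i\<in>I. vcoef L (f i) k)"
  by (induction I rule: infinite_finite_induct) (auto simp: vcoef_add L2_sum)

lemma vcoef_neg: "vcoef L g (- k) $ i = cnj (vcoef L g k $ i)"
  using fcoef_cnj[of L "\<lambda>x. complex_of_real (g x $ i)" k] by (simp add: vcoef_def)

lemma has_sum_finite_sum:
  fixes f :: "'i \<Rightarrow> 'a \<Rightarrow> 'b::topological_comm_monoid_add"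
  assumes "\<And>i. i \<in> I \<Longrightarrow> (f i has_sum s i) A"
  shows "((\<lambda>k. \<Sum>i\<in>I. f i k) has_sum (\<Sum>i\<in>I. s i)) A"
  using assms by (induction I rule: infinite_finite_induct) (auto intro: has_sum_add)

theorem parseval_vec:
  assumes L: "L > 0" and g: "g \<in> L2 L" and h: "h \<in> L2 L"
  shows "((\<lambda>k. vcoef L g k \<bullet> vcoef L h k) has_sum L2_inner L g h / L ^ 3) UNIV"
proof -
  have c: "((\<lambda>k. vcoef L g k $ i \<bullet> vcoef L h k $ i) has_sum (LINT x|cell L. g x $ i * h x $ i) / L ^ 3) UNIV" for i
  proof -
    have "((\<lambda>k. Re (vcoef L g k $ i * cnj (vcoef L h k $ i))) has_sum
       Re ((LINT x|cell L. complex_of_real (g x $ i) * cnj (complex_of_real (h x $ i))) / of_real (L ^ 3))) UNIV"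
      unfolding vcoef_def vec_lambda_beta
      by (intro has_sum_Re parseval L L2_component g h)
    moreover have "(LINT x|cell L. complex_of_real (g x $ i) * cnj (complex_of_real (h x $ i)))
        = of_real (LINT x|cell L. g x $ i * h x $ i)"
      by (simp flip: of_real_mult)
    moreover have "Re (complex_of_real a / of_real b) = a / b" for a b
      by (simp flip: of_real_divide)
    ultimately show ?thesis by (simp add: inner_complex_def)
  qed
  have i: "integrable (cell L) (\<lambda>x. g x $ i * h x $ i)" for i
  proof -
    have "integrable (cell L) (\<lambda>x. complex_of_real (g x $ i) * complex_of_real (h x $ i))"
      by (intro sq_int_prod_integrable L2_component g h)
    then show ?thesis by (simp only: of_real_mult[symmetric] complex_of_real_integrable_eq)
  qed
  have "L2_inner L g h / L ^ 3 = (\<Sum>i\<in>UNIV. (LINT x|cell L. g x $ i * h x $ i) / L ^ 3)"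
    unfolding L2_inner_def inner_vec_def by (subst Bochner_Integration.integral_sum) (auto simp: i sum_divide_distrib)
  then show ?thesis unfolding inner_vec_def using has_sum_finite_sum[where I=UNIV, OF c] by simp
qed

lemma parseval_vec_norm:
  assumes L: "L > 0" and g: "g \<in> L2 L"
  shows "((\<lambda>k. (norm (vcoef L g k))\<^sup>2) has_sum (L2_norm L g)\<^sup>2 / L ^ 3) UNIV"
  using parseval_vec[OF L g g] by (simp add: L2_norm_sq dot_square_norm)

lemma vec_unique:
  assumes L: "L > 0" and g: "g \<in> L2 L" and h: "h \<in> L2 L" and e: "\<And>k. vcoef L g k = vcoef L h k"
  shows "ae_eq L g h"
proof -
  have "vcoef L (\<lambda>x. g x - h x) k = 0" for k by (simp add: vcoef_diff g h e)
  then have "((\<lambda>k. 0::real) has_sum (L2_norm L (\<lambda>x. g x - h x))\<^sup>2 / L ^ 3) (UNIV :: (int^3) set)"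
    using parseval_vec_norm[OF L L2_diff[OF g h]] by simp
  then have "(L2_norm L (\<lambda>x. g x - h x))\<^sup>2 / L ^ 3 = 0" using has_sum_unique has_sum_0_simp by blast
  then have "L2_norm L (\<lambda>x. g x - h x) = 0" using L by simp
  then have "AE x in cell L. g x - h x = 0"
    using l2_eq_0[of "cell L" "\<lambda>x. g x - h x"] L2_diff[OF g h] by (simp add: L2_norm_eq L2_iff)
  then show ?thesis by (simp add: ae_eq_def)
qed

lemma L2_vec_lambda:
  assumes "\<And>i. sq_int (cell L) (\<lambda>x. h i x :: real)"
  shows "(\<lambda>x. \<chi> i. h i x) \<in> L2 L"
proof -
  have "sq_int (cell L) (\<lambda>x. h i x *\<^sub>R axis i 1 :: real^3)" for i
  proof -
    note [measurable] = sq_intD(1)[OF assms[of i]]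
    show ?thesis by (rule sq_int_bound[where C=1, OF assms[of i]]) (auto simp: norm_axis_1)
  qed
  then have "sq_int (cell L) (\<lambda>x. \<Sum>i\<in>UNIV. h i x *\<^sub>R axis i 1 :: real^3)" by (intro sq_int_sum)
  moreover have "(\<Sum>i\<in>UNIV. h i x *\<^sub>R axis i 1 :: real^3) = (\<chi> i. h i x)" for x
    by (simp add: vec_eq_iff axis_def if_distrib cong: if_cong)
  ultimately show ?thesis by (simp add: L2_iff)
qed

lemma summable_component:
  fixes c :: "int^3 \<Rightarrow> complex^3"
  assumes "(\<lambda>k. (norm (c k))\<^sup>2) summable_on UNIV"
  shows "(\<lambda>k. (cmod (c k $ i))\<^sup>2) summable_on UNIV"
  by (rule summable_on_comparison_test[OF assms]) (auto intro: power_mono Finite_Cartesian_Product.norm_nth_le)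

text \<open>Each component is synthesized as a complex function. Its real part has the coefficients
  (c_k + cnj c_(-k)) / 2, which the Hermitian symmetry \<open>neg\<close> identifies with
  c_k.\<close>

lemma vec_synthesis:
  assumes L: "L > 0" and c: "(\<lambda>k. (norm (c k))\<^sup>2) summable_on UNIV"
    and neg: "\<And>k i. c (- k) $ i = cnj (c k $ i)"
  obtains g where "g \<in> L2 L" "\<And>k. vcoef L g k = c k"
proof -
  have "\<exists>f. sq_int (cell L) f \<and> (\<forall>k. fcoef L f k = c k $ i)" for i
    using fourier_synthesis[OF L summable_component[OF c, of i]] by metis
  then obtain f where f: "\<And>i. sq_int (cell L) (f i)" "\<And>i k. fcoef L (f i) k = c k $ i" by metis
  define g where "g x = (\<chi> i. Re (f i x))" for x
  have reim: "complex_of_real (Re z) = (1/2) * (z + cnj z)" for z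
    by (simp add: complex_eq_iff)
  have "sq_int (cell L) (\<lambda>x. Re (f i x))" for i
  proof -
    note [measurable] = sq_intD(1)[OF f(1)[of i]]
    show ?thesis by (rule sq_int_bound[where C=1, OF f(1)[of i]]) (auto simp: abs_Re_le_cmod)
  qed
  then have "g \<in> L2 L" unfolding g_def by (rule L2_vec_lambda)
  moreover have "vcoef L g k = c k" for k
  proof -
    have "fcoef L (\<lambda>x. complex_of_real (Re (f i x))) k = c k $ i" for i
      unfolding reim fcoef_cmult
      by (subst fcoef_add[OF f(1) sq_int_cnj[OF f(1)]]) (simp add: fcoef_cnj f(2) neg)
    then show ?thesis by (simp add: vcoef_def g_def vec_eq_iff)
  qed
  ultimately show thesis by (rule that)
qed

section \<open>Weak derivatives and Sobolev spaces as Fourier multipliers\<close>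

definition symb :: "real \<Rightarrow> 3 list \<Rightarrow> int^3 \<Rightarrow> complex" where
  "symb L \<alpha> k = (\<Prod>i\<leftarrow>\<alpha>. \<i> * of_real (2 * pi / L * of_int (k $ i)))"

lemma symb_simps [simp]: "symb L [] k = 1"
  "symb L (i # \<alpha>) k = \<i> * of_real (2 * pi / L * of_int (k $ i)) * symb L \<alpha> k"
  by (simp_all add: symb_def)

lemma symb_neg: "symb L \<alpha> (- k) = (-1) ^ length \<alpha> * symb L \<alpha> k"
  by (induction \<alpha>) auto

lemma symb_cnj: "cnj (symb L \<alpha> k) = (-1) ^ length \<alpha> * symb L \<alpha> k"
  by (induction \<alpha>) auto

lemma pderivs_simps [simp]: "pderivs [] g = g" "pderivs (i # \<alpha>) g = pderivative i (pderivs \<alpha> g)"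
  by (simp_all add: pderivs_def)

lemma pderivs_pderivative: "pderivs \<alpha> (pderivative i g) = pderivs (\<alpha> @ [i]) g"
  by (simp add: pderivs_def)

lemma smooth_pderivative: "smooth g \<Longrightarrow> smooth (pderivative i g)"
  by (simp add: smooth_def pderivs_pderivative)

lemma smooth_differentiable: "smooth g \<Longrightarrow> g differentiable (at x)"
  unfolding smooth_def using pderivs_simps(1)[of g] by metis

lemma smooth_continuous: "smooth g \<Longrightarrow> continuous_on S g"
  using smooth_differentiable differentiable_imp_continuous_within
  by (metis continuous_at_imp_continuous_on)

lemma pderivative_eq: "(g has_derivative g') (at x) \<Longrightarrow> pderivative i g x = g' (axis i 1)"
  unfolding pderivative_def by (metis frechet_derivative_at)

lemma periodic_pderivative:
  assumes g: "periodic L g" and d: "\<And>x. g differentiable (at x)"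
  shows "periodic L (pderivative i g)"
  unfolding periodic_def
proof (intro allI)
  fix x j
  let ?a = "axis j L :: real^3"
  from d obtain D where D: "(g has_derivative D) (at (x + ?a))" unfolding differentiable_def by blast
  have "((\<lambda>y. y + ?a) has_derivative (\<lambda>h. h)) (at x)" by (auto intro!: derivative_eq_intros)
  from has_derivative_compose[OF this D] have "((\<lambda>y. g (y + ?a)) has_derivative D) (at x)" .
  moreover have "(\<lambda>y. g (y + ?a)) = g" using g by (simp add: periodic_def)
  ultimately have "(g has_derivative D) (at x)" by simp
  then show "pderivative i g (x + ?a) = pderivative i g x"
    using D by (simp add: pderivative_eq)
qed

lemma smooth_periodic_pderivs:
  assumes "smooth g" "periodic L g"
  shows "smooth (pderivs \<alpha> g) \<and> periodic L (pderivs \<alpha> g)"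
  by (induction \<alpha>) (use assms in \<open>auto intro: smooth_pderivative periodic_pderivative smooth_differentiable\<close>)

text \<open>Integration by parts without boundary terms: the product of \<open>\<phi>\<close> with a
  mode is periodic, so its derivative has integral zero over the cell.\<close>

lemma fcoef_pderivative:
  fixes \<phi> :: "real^3 \<Rightarrow> real"
  assumes L: "L > 0" and s: "smooth \<phi>" and p: "periodic L \<phi>"
  shows "fcoef L (\<lambda>x. complex_of_real (pderivative i \<phi> x)) k
    = \<i> * of_real (2 * pi / L * of_int (k $ i)) * fcoef L (\<lambda>x. complex_of_real (\<phi> x)) k"
proof -
  define c where "c = \<i> * complex_of_real (2 * pi / L * of_int (k $ i))"
  let ?d = "\<lambda>x. complex_of_real (pderivative i \<phi> x)"
  let ?p = "\<lambda>x. complex_of_real (\<phi> x)"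
  let ?D = "\<lambda>x. ?d x * fmode L (- k) x + ?p x * (- c * fmode L (- k) x)"
  have cp: "continuous_on UNIV ?p" by (intro continuous_intros smooth_continuous s)
  have cd: "continuous_on UNIV ?d" by (intro continuous_intros smooth_continuous smooth_pderivative s)
  have "integral\<^sup>L (cell L) ?D = 0"
  proof (rule integral_cell_derivative[OF L, where g="\<lambda>x. ?p x * fmode L (- k) x"])
    fix x
    obtain d where d: "(\<phi> has_derivative d) (at x)"
      using smooth_differentiable[OF s] unfolding differentiable_def by blast
    then have "((\<lambda>x. ?p x * fmode L (- k) x) has_derivative
       (\<lambda>h. ?p x * ((\<i> * of_real (2 * pi / L * (rvec (- k) \<bullet> h))) * fmode L (- k) x) + of_real (d h) * fmode L (- k) x)) (at x)"
      by (intro has_derivative_mult fmode_has_derivative has_derivative_of_real)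
    from axis_derivative[OF this, of i]
    show "((\<lambda>s. ?p (x + axis i s) * fmode L (- k) (x + axis i s)) has_vector_derivative ?D x) (at 0)"
      by (simp add: c_def inner_axis pderivative_eq[OF d] algebra_simps)
  next
    show "continuous_on UNIV ?D" by (intro continuous_intros cp cd)
    fix x
    show "?p (x + axis i L) * fmode L (- k) (x + axis i L) = ?p x * fmode L (- k) x"
      using p by (simp add: fmode_periodic[OF L] periodic_def)
    show "?D (x + axis i L) = ?D x"
      using p periodic_pderivative[OF p smooth_differentiable[OF s]] by (simp add: fmode_periodic[OF L] periodic_def)
  qed
  moreover have "integral\<^sup>L (cell L) ?D = (LINT x|cell L. ?d x * fmode L (- k) x) + (LINT x|cell L. - c * (?p x * fmode L (- k) x))"
    by (subst Bochner_Integration.integral_add[symmetric])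
      (auto intro!: continuous_integrable_cell continuous_intros cp cd simp: mult_ac)
  ultimately have "(LINT x|cell L. ?d x * fmode L (- k) x) = c * (LINT x|cell L. ?p x * fmode L (- k) x)"
    by (simp del: mult_minus_left)
  then show ?thesis by (simp add: fcoef_def cnj_fmode c_def)
qed

lemma fcoef_pderivs:
  fixes \<phi> :: "real^3 \<Rightarrow> real"
  assumes L: "L > 0" and s: "smooth \<phi>" and p: "periodic L \<phi>"
  shows "fcoef L (\<lambda>x. complex_of_real (pderivs \<alpha> \<phi> x)) k = symb L \<alpha> k * fcoef L (\<lambda>x. complex_of_real (\<phi> x)) k"
proof (induction \<alpha>)
  case (Cons i \<alpha>)
  have "smooth (pderivs \<alpha> \<phi>)" "periodic L (pderivs \<alpha> \<phi>)" using smooth_periodic_pderivs[OF s p] by auto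
  from fcoef_pderivative[OF L this] Cons show ?case by (simp add: mult_ac)
qed simp

text \<open>Weak derivatives are tested against real functions only. These are the real test modes;
  the free complex factor \<open>c\<close> gives access to real and imaginary parts of a
  coefficient.\<close>

definition re_mode :: "real \<Rightarrow> complex \<Rightarrow> int^3 \<Rightarrow> real^3 \<Rightarrow> real" where
  "re_mode L c k x = Re (c * fmode L k x)"

lemma re_mode_has_derivative:
  "(re_mode L c k has_derivative (\<lambda>h. Re (c * ((\<i> * of_real (2 * pi / L * (rvec k \<bullet> h))) * fmode L k x)))) (at x)"
  unfolding re_mode_def[abs_def]
  by (intro has_derivative_Re has_derivative_mult_right fmode_has_derivative)

lemma pderivative_re_mode:
  "pderivative i (re_mode L c k) = re_mode L (\<i> * of_real (2 * pi / L * of_int (k $ i)) * c) k"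
  unfolding pderivative_eq[OF re_mode_has_derivative] fun_eq_iff
  by (simp add: re_mode_def inner_axis mult_ac)

lemma pderivs_re_mode: "pderivs \<alpha> (re_mode L c k) = re_mode L (symb L \<alpha> k * c) k"
  by (induction \<alpha>) (auto simp: pderivative_re_mode mult_ac)

lemma smooth_re_mode: "smooth (re_mode L c k)"
  unfolding smooth_def pderivs_re_mode differentiable_def using re_mode_has_derivative by blast

lemma periodic_re_mode: "L > 0 \<Longrightarrow> periodic L (re_mode L c k)"
  by (simp add: periodic_def re_mode_def fmode_periodic)

lemma integral_component:
  assumes \<phi>: "sq_int (cell L) \<phi>" and g: "g \<in> L2 L"
  shows "(LINT x|cell L. \<phi> x *\<^sub>R g x) $ i = (LINT x|cell L. \<phi> x * g x $ i)"
proof -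
  have g': "sq_int (cell L) g" using g by (simp add: L2_iff)
  note [measurable] = sq_intD(1)[OF g'] sq_intD(1)[OF \<phi>]
  have "integrable (cell L) (\<lambda>x. \<phi> x *\<^sub>R g x)"
    by (rule Bochner_Integration.integrable_bound[OF sq_int_norm_mult[OF \<phi> g']]) auto
  from integral_bounded_linear[OF bounded_linear_vec_nth this, of i] show ?thesis by simp
qed

lemma integral_re_mode:
  assumes L: "L > 0" and g: "g \<in> L2 L"
  shows "(LINT x|cell L. re_mode L c k x * g x $ i) = L ^ 3 * Re (c * vcoef L g (- k) $ i)"
proof -
  have int: "integrable (cell L) (\<lambda>x. c * (complex_of_real (g x $ i) * fmode L k x))"
    using sq_int_prod_integrable[OF L2_component[OF g] sq_int_fmode] by simp
  have "(LINT x|cell L. re_mode L c k x * g x $ i) = (LINT x|cell L. Re (c * (complex_of_real (g x $ i) * fmode L k x)))"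
    by (simp add: re_mode_def algebra_simps)
  also have "\<dots> = Re (LINT x|cell L. c * (complex_of_real (g x $ i) * fmode L k x))"
    by (rule integral_Re[OF int])
  also have "\<dots> = Re (c * (of_real (L ^ 3) * vcoef L g (- k) $ i))"
    using L by (simp add: vcoef_def fcoef_def cnj_fmode)
  also have "\<dots> = L ^ 3 * Re (c * vcoef L g (- k) $ i)"
    by (simp add: algebra_simps flip: of_real_power)
  finally show ?thesis .
qed

lemma weak_deriv_vcoef:
  assumes L: "L > 0" and g: "g \<in> L2 L" and w: "is_weak_deriv L \<alpha> g h"
  shows "vcoef L h k $ i = symb L \<alpha> k * vcoef L g k $ i"
proof -
  have h: "h \<in> L2 L" using w by (simp add: is_weak_deriv_def)
  have "Re (c * (symb L \<alpha> (- k) * vcoef L g k $ i)) = Re (c * ((-1) ^ length \<alpha> * vcoef L h k $ i))" for c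
  proof -
    let ?\<phi> = "re_mode L c (- k)"
    have "(LINT x|cell L. pderivs \<alpha> ?\<phi> x *\<^sub>R g x) = (-1) ^ length \<alpha> *\<^sub>R (LINT x|cell L. ?\<phi> x *\<^sub>R h x)"
      using w smooth_re_mode periodic_re_mode[OF L] unfolding is_weak_deriv_def by blast
    then have "(LINT x|cell L. pderivs \<alpha> ?\<phi> x *\<^sub>R g x) $ i = (-1) ^ length \<alpha> * (LINT x|cell L. ?\<phi> x *\<^sub>R h x) $ i"
      by simp
    moreover have sq: "sq_int (cell L) (re_mode L c k)" for c k
      by (intro sq_int_cell_continuous smooth_continuous smooth_re_mode)
    ultimately have "(LINT x|cell L. re_mode L (symb L \<alpha> (- k) * c) (- k) x * g x $ i)
        = (-1) ^ length \<alpha> * (LINT x|cell L. ?\<phi> x * h x $ i)"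
      by (simp add: pderivs_re_mode integral_component g h)
    then have "Re (symb L \<alpha> (- k) * c * vcoef L g k $ i) = (-1) ^ length \<alpha> * Re (c * vcoef L h k $ i)"
      using L by (simp add: integral_re_mode[OF L] g h)
    moreover have "(-1) ^ length \<alpha> * Re z = Re ((-1) ^ length \<alpha> * z)" for z :: complex
      by (cases "even (length \<alpha>)") auto
    ultimately show ?thesis by (simp only: mult_ac)
  qed
  \<comment> \<open>The choice c = 1 compares real parts and c = -\<i> compares imaginary
    parts.\<close>
  from this[of 1] this[of "-\<i>"] have "symb L \<alpha> (- k) * vcoef L g k $ i = (-1) ^ length \<alpha> * vcoef L h k $ i"
    by (simp add: complex_eq_iff)
  then show ?thesis by (cases "even (length \<alpha>)") (auto simp: symb_neg)
qed

text \<open>Parseval turns both sides of the defining identity into lattice sums that agree term by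
  term; the sign arises from conjugating the purely imaginary factors of the symbol.\<close>

lemma is_weak_derivI:
  assumes L: "L > 0" and g: "g \<in> L2 L" and h: "h \<in> L2 L"
    and e: "\<And>k i. vcoef L h k $ i = symb L \<alpha> k * vcoef L g k $ i"
  shows "is_weak_deriv L \<alpha> g h"
  unfolding is_weak_deriv_def
proof (intro conjI allI impI h)
  fix \<phi> :: "real^3 \<Rightarrow> real" assume "smooth \<phi> \<and> periodic L \<phi>"
  then have s: "smooth \<phi>" and p: "periodic L \<phi>" by auto
  have s': "smooth (pderivs \<alpha> \<phi>)" using smooth_periodic_pderivs[OF s p] by blast
  have sq: "sq_int (cell L) \<psi>" "sq_int (cell L) (\<lambda>x. complex_of_real (\<psi> x))" if "smooth \<psi>" for \<psi> :: "real^3 \<Rightarrow> real"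
    by (intro sq_int_cell_continuous continuous_intros smooth_continuous that)+
  have P: "((\<lambda>k. fcoef L (\<lambda>x. complex_of_real (\<psi> x)) k * cnj (vcoef L f k $ i)) has_sum
      of_real ((LINT x|cell L. \<psi> x * f x $ i) / L ^ 3)) UNIV" if "smooth \<psi>" "f \<in> L2 L" for \<psi> f i
  proof -
    have "(LINT x|cell L. complex_of_real (\<psi> x) * cnj (complex_of_real (f x $ i)))
       = of_real (LINT x|cell L. \<psi> x * f x $ i)"
      by (simp flip: of_real_mult)
    then show ?thesis
      using parseval[OF L sq(2)[OF that(1)] L2_component[OF that(2), of i]] by (simp add: vcoef_def)
  qed
  have "(LINT x|cell L. pderivs \<alpha> \<phi> x * g x $ i) = (-1) ^ length \<alpha> * (LINT x|cell L. \<phi> x * h x $ i)" for i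
  proof -
    have t: "fcoef L (\<lambda>x. complex_of_real (pderivs \<alpha> \<phi> x)) k * cnj (vcoef L g k $ i)
        = (-1) ^ length \<alpha> * (fcoef L (\<lambda>x. complex_of_real (\<phi> x)) k * cnj (vcoef L h k $ i))" for k
      by (cases "even (length \<alpha>)") (auto simp: fcoef_pderivs[OF L s p] e symb_cnj mult_ac)
    have "((\<lambda>k. (-1) ^ length \<alpha> * (fcoef L (\<lambda>x. complex_of_real (\<phi> x)) k * cnj (vcoef L h k $ i))) has_sum
      (-1) ^ length \<alpha> * of_real ((LINT x|cell L. \<phi> x * h x $ i) / L ^ 3)) UNIV"
      by (intro has_sum_cmult_right P s h)
    then have "complex_of_real ((LINT x|cell L. pderivs \<alpha> \<phi> x * g x $ i) / L ^ 3)
        = (-1) ^ length \<alpha> * of_real ((LINT x|cell L. \<phi> x * h x $ i) / L ^ 3)"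
      using P[OF s' g, of i] has_sum_unique unfolding t by blast
    then have "complex_of_real ((LINT x|cell L. pderivs \<alpha> \<phi> x * g x $ i) / L ^ 3)
        = complex_of_real ((-1) ^ length \<alpha> * ((LINT x|cell L. \<phi> x * h x $ i) / L ^ 3))"
      by simp
    then show ?thesis using L unfolding of_real_eq_iff by simp
  qed
  then show "(LINT x|cell L. pderivs \<alpha> \<phi> x *\<^sub>R g x) = (- 1) ^ length \<alpha> *\<^sub>R (LINT x|cell L. \<phi> x *\<^sub>R h x)"
    by (simp add: vec_eq_iff integral_component sq s s' g h)
qed

definition eig :: "real \<Rightarrow> int^3 \<Rightarrow> real" where
  "eig L k = (2 * pi / L)\<^sup>2 * (norm (rvec k))\<^sup>2"

lemma eig_nonneg [simp]: "0 \<le> eig L k"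
  by (simp add: eig_def)

lemma eig_sum: "eig L k = (\<Sum>i\<in>UNIV. (2 * pi / L * of_int (k $ i))\<^sup>2)"
proof -
  have "(norm (rvec k))\<^sup>2 = (\<Sum>i\<in>UNIV. (of_int (k $ i))\<^sup>2)"
    unfolding dot_square_norm[symmetric] inner_vec_def by (simp add: power2_eq_square)
  then show ?thesis unfolding eig_def sum_distrib_left power_mult_distrib by (simp only: sum_distrib_left)
qed

lemma norm_symb_Cons: "(cmod (symb L (i # \<alpha>) k))\<^sup>2 = (2 * pi / L * of_int (k $ i))\<^sup>2 * (cmod (symb L \<alpha> k))\<^sup>2"
  unfolding symb_simps norm_mult norm_ii norm_of_real power_mult_distrib power2_abs by (simp only: mult_1 power_one)

lemma norm_symb_sq: "(cmod (symb L [i] k))\<^sup>2 = (2 * pi / L * of_int (k $ i))\<^sup>2"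
  unfolding norm_symb_Cons by simp

lemma component_le_eig: "(2 * pi / L * of_int (k $ i))\<^sup>2 \<le> eig L k"
  unfolding eig_sum by (rule member_le_sum) auto

lemma norm_symb_single: "cmod (symb L [i] k) \<le> sqrt (eig L k)"
  by (rule real_le_rsqrt) (unfold norm_symb_sq, rule component_le_eig)

lemma norm_symb_le: "(cmod (symb L \<alpha> k))\<^sup>2 \<le> eig L k ^ length \<alpha>"
proof (induction \<alpha>)
  case (Cons i \<alpha>)
  have "(cmod (symb L (i # \<alpha>) k))\<^sup>2 \<le> eig L k * eig L k ^ length \<alpha>"
    unfolding norm_symb_Cons by (intro mult_mono Cons component_le_eig) auto
  then show ?case by simp
qed simp

lemma norm_symb_replicate: "(cmod (symb L (replicate m i) k))\<^sup>2 = ((2 * pi / L * of_int (k $ i))\<^sup>2) ^ m"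
proof (induction m)
  case (Suc m)
  then show ?case unfolding replicate_Suc norm_symb_Cons power_Suc by (simp only:)
qed simp

text \<open>The largest of the three summands of \<open>eig\<close> is at least a third of it. Hence
  pure derivatives in single directions control the full weight of order \<open>m\<close>.\<close>

lemma eig_power_le: "eig L k ^ m \<le> 3 ^ m * (\<Sum>i\<in>UNIV. (cmod (symb L (replicate m i) k))\<^sup>2)"
proof -
  let ?a = "\<lambda>i. (2 * pi / L * of_int (k $ i))\<^sup>2"
  obtain j where j: "\<And>i. ?a i \<le> ?a j"
  proof -
    have "Max (range ?a) \<in> range ?a" by (rule Max_in) auto
    then obtain j where j: "Max (range ?a) = ?a j" by (rule imageE)
    have "?a i \<le> ?a j" for i unfolding j[symmetric] by (rule Max_ge) auto
    then show thesis by (rule that)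
  qed
  have "eig L k \<le> 3 * ?a j"
    unfolding eig_sum using sum_bounded_above[of UNIV ?a "?a j"] j by simp
  then have "eig L k ^ m \<le> (3 * ?a j) ^ m" by (rule power_mono) simp
  also have "\<dots> = 3 ^ m * ?a j ^ m" by (simp add: power_mult_distrib)
  also have "\<dots> \<le> 3 ^ m * (\<Sum>i\<in>UNIV. ?a i ^ m)"
    by (intro mult_left_mono member_le_sum) auto
  finally show ?thesis by (simp only: norm_symb_replicate)
qed

definition sob_summable :: "real \<Rightarrow> nat \<Rightarrow> vfield \<Rightarrow> bool" where
  "sob_summable L m g \<longleftrightarrow> (\<lambda>k. (1 + eig L k) ^ m * (norm (vcoef L g k))\<^sup>2) summable_on UNIV"

lemma norm_smult: "norm (c *s v) = cmod c * norm v" for v :: "complex^3"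
  by (simp add: norm_vec_def L2_set_def norm_mult power_mult_distrib sum_distrib_left[symmetric] real_sqrt_mult)

lemma weak_deriv_exists:
  assumes L: "L > 0" and g: "g \<in> L2 L" and s: "sob_summable L m g" and m: "length \<alpha> \<le> m"
  shows "\<exists>h. is_weak_deriv L \<alpha> g h"
proof -
  let ?c = "\<lambda>k. symb L \<alpha> k *s vcoef L g k"
  have "(\<lambda>k. (norm (?c k))\<^sup>2) summable_on UNIV"
  proof (rule summable_on_comparison_test[OF s[unfolded sob_summable_def]])
    fix k
    have "(cmod (symb L \<alpha> k))\<^sup>2 \<le> eig L k ^ length \<alpha>" by (rule norm_symb_le)
    also have "\<dots> \<le> (1 + eig L k) ^ length \<alpha>" by (rule power_mono) auto
    also have "\<dots> \<le> (1 + eig L k) ^ m" by (rule power_increasing[OF m]) simp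
    finally show "(norm (?c k))\<^sup>2 \<le> (1 + eig L k) ^ m * (norm (vcoef L g k))\<^sup>2"
      by (simp add: norm_smult power_mult_distrib mult_right_mono)
  qed simp
  moreover have "?c (- k) $ i = cnj (?c k $ i)" for k i
    by (simp add: vcoef_neg symb_neg symb_cnj)
  ultimately obtain h where "h \<in> L2 L" "\<And>k. vcoef L h k = ?c k"
    using vec_synthesis[OF L, of ?c] by blast
  then have "is_weak_deriv L \<alpha> g h" by (intro is_weak_derivI L g) auto
  then show ?thesis by blast
qed

lemma summable_on_finite_sum:
  fixes f :: "'i \<Rightarrow> 'a \<Rightarrow> real"
  assumes "\<And>i. i \<in> I \<Longrightarrow> f i summable_on A"
  shows "(\<lambda>k. \<Sum>i\<in>I. f i k) summable_on A"
  using assms by (induction I rule: infinite_finite_induct) (auto intro: summable_on_add)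

text \<open>Membership yields weak derivatives of order \<open>m\<close> in each coordinate
  direction, which by \<open>eig_power_le\<close> dominate the weight; the factor
  \<open>2 ^ m\<close> comes from 1 + e \<le> 2 max(1, e). Conversely each symbol of length at most
  \<open>m\<close> is bounded by the weight, so the derivative can be synthesized.\<close>

lemma sobolev_iff:
  assumes L: "L > 0"
  shows "g \<in> sobolev L m \<longleftrightarrow> g \<in> L2 L \<and> sob_summable L m g"
proof
  assume a: "g \<in> sobolev L m"
  then have g: "g \<in> L2 L" by (simp add: sobolev_def)
  have s: "(\<lambda>k. (cmod (symb L (replicate m i) k))\<^sup>2 * (norm (vcoef L g k))\<^sup>2) summable_on UNIV" for i
  proof -
    obtain h where w: "is_weak_deriv L (replicate m i) g h"
    proof -
      have "length (replicate m i) \<le> m" by simp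
      with a have "\<exists>h. is_weak_deriv L (replicate m i) g h" unfolding sobolev_def by blast
      then show thesis using that by blast
    qed
    then have h: "h \<in> L2 L" by (simp add: is_weak_deriv_def)
    have "vcoef L h k = symb L (replicate m i) k *s vcoef L g k" for k
      by (simp add: vec_eq_iff weak_deriv_vcoef[OF L g w])
    then show ?thesis
      using has_sum_imp_summable[OF parseval_vec_norm[OF L h]] by (simp add: norm_smult power_mult_distrib)
  qed
  have "sob_summable L m g" unfolding sob_summable_def
  proof (rule summable_on_comparison_test)
    show "(\<lambda>k. 2 ^ m * (norm (vcoef L g k))\<^sup>2
        + 2 ^ m * 3 ^ m * (\<Sum>i\<in>UNIV. (cmod (symb L (replicate m i) k))\<^sup>2 * (norm (vcoef L g k))\<^sup>2)) summable_on UNIV"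
      by (intro summable_on_add summable_on_cmult_right summable_on_finite_sum s
          has_sum_imp_summable[OF parseval_vec_norm[OF L g]])
    fix k
    have "(1 + eig L k) ^ m \<le> (2 * max 1 (eig L k)) ^ m" by (rule power_mono) auto
    also have "\<dots> = 2 ^ m * max 1 (eig L k) ^ m" by (simp add: power_mult_distrib)
    also have "\<dots> \<le> 2 ^ m * (1 + eig L k ^ m)"
      by (rule mult_left_mono) (auto simp: max_def)
    also have "\<dots> \<le> 2 ^ m * (1 + 3 ^ m * (\<Sum>i\<in>UNIV. (cmod (symb L (replicate m i) k))\<^sup>2))"
      by (intro mult_left_mono add_left_mono eig_power_le) simp
    finally have "(1 + eig L k) ^ m * (norm (vcoef L g k))\<^sup>2
       \<le> 2 ^ m * (1 + 3 ^ m * (\<Sum>i\<in>UNIV. (cmod (symb L (replicate m i) k))\<^sup>2)) * (norm (vcoef L g k))\<^sup>2"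
      by (rule mult_right_mono) simp
    then show "(1 + eig L k) ^ m * (norm (vcoef L g k))\<^sup>2 \<le> 2 ^ m * (norm (vcoef L g k))\<^sup>2
        + 2 ^ m * 3 ^ m * (\<Sum>i\<in>UNIV. (cmod (symb L (replicate m i) k))\<^sup>2 * (norm (vcoef L g k))\<^sup>2)"
      unfolding sum_distrib_right[symmetric] by (simp add: algebra_simps)
  qed simp
  with g show "g \<in> L2 L \<and> sob_summable L m g" ..
next
  assume "g \<in> L2 L \<and> sob_summable L m g"
  then show "g \<in> sobolev L m" unfolding sobolev_def using weak_deriv_exists[OF L] by blast
qed

lemma weak_deriv_correct:
  assumes L: "L > 0" and g: "g \<in> sobolev L m" and m: "length \<alpha> \<le> m"
  shows "weak_deriv L \<alpha> g \<in> L2 L" "vcoef L (weak_deriv L \<alpha> g) k = symb L \<alpha> k *s vcoef L g k"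
proof -
  have "\<exists>h. is_weak_deriv L \<alpha> g h" using g m by (auto simp: sobolev_def)
  then have w: "is_weak_deriv L \<alpha> g (weak_deriv L \<alpha> g)" unfolding weak_deriv_def by (rule someI_ex)
  then show "weak_deriv L \<alpha> g \<in> L2 L" by (simp add: is_weak_deriv_def)
  have "g \<in> L2 L" using g by (simp add: sobolev_def)
  then show "vcoef L (weak_deriv L \<alpha> g) k = symb L \<alpha> k *s vcoef L g k"
    by (simp add: vec_eq_iff weak_deriv_vcoef[OF L _ w])
qed

section \<open>Solenoidal spaces, Leray projection and Stokes operator\<close>

text \<open>Bilinear, without conjugation: applied to the coefficient of a field it is, up to the
  factor 2 pi \<i> / L, the coefficient of the divergence.\<close>

definition rdot :: "int^3 \<Rightarrow> complex^3 \<Rightarrow> complex" where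
  "rdot k c = (\<Sum>i\<in>UNIV. of_int (k $ i) * c $ i)"

definition sol_coef :: "real \<Rightarrow> vfield \<Rightarrow> bool" where
  "sol_coef L g \<longleftrightarrow> vcoef L g 0 = 0 \<and> (\<forall>k. rdot k (vcoef L g k) = 0)"

lemma rdot_linear: "rdot k (a + b) = rdot k a + rdot k b" "rdot k (a - b) = rdot k a - rdot k b"
  "rdot k (c *s a) = c * rdot k a" "rdot k (r *\<^sub>R a) = of_real r * rdot k a" "rdot k 0 = 0"
  "rdot k (- a) = - rdot k a"
  by (simp_all add: rdot_def distrib_left right_diff_distrib sum.distrib sum_subtractf sum_negf sum_distrib_left mult_ac
      scaleR_conv_of_real[where 'a=complex])

lemma norm_rdot_le: "cmod (rdot k c) \<le> norm (rvec k) * norm c"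
proof -
  have "cmod (rdot k c) \<le> (\<Sum>i\<in>UNIV. \<bar>of_int (k $ i)\<bar> * cmod (c $ i))"
    unfolding rdot_def by (rule sum_norm_le) (simp add: norm_mult)
  also have "\<dots> \<le> L2_set (\<lambda>i. of_int (k $ i)) UNIV * L2_set (\<lambda>i. cmod (c $ i)) UNIV"
    using L2_set_mult_ineq[of "\<lambda>i. of_int (k $ i)" "\<lambda>i. cmod (c $ i)" UNIV] by simp
  also have "\<dots> = norm (rvec k) * norm c" by (simp add: norm_vec_def L2_set_def)
  finally show ?thesis .
qed

lemma vcoef_norm_le:
  assumes L: "L > 0" and g: "g \<in> L2 L"
  shows "norm (vcoef L g k) \<le> L2_norm L g / sqrt (L ^ 3)"
proof (rule power2_le_imp_le)
  have "sum (\<lambda>k. (norm (vcoef L g k))\<^sup>2) {k} \<le> (L2_norm L g)\<^sup>2 / L ^ 3"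
    by (rule finite_sum_le_has_sum[OF parseval_vec_norm[OF L g]]) auto
  then show "(norm (vcoef L g k))\<^sup>2 \<le> (L2_norm L g / sqrt (L ^ 3))\<^sup>2"
    using L by (simp add: power_divide)
  show "0 \<le> L2_norm L g / sqrt (L ^ 3)" using L by (simp add: L2_norm_eq)
qed

lemma vcoef_tendsto:
  assumes L: "L > 0" and g: "g \<in> L2 L" and h: "\<And>n::nat. h n \<in> L2 L"
    and lim: "(\<lambda>n. L2_norm L (\<lambda>x. h n x - g x)) \<longlonglongrightarrow> 0"
  shows "(\<lambda>n. vcoef L (h n) k) \<longlonglongrightarrow> vcoef L g k"
proof -
  have "(\<lambda>n. vcoef L (h n) k - vcoef L g k) \<longlonglongrightarrow> 0"
  proof (rule Lim_null_comparison)
    show "\<forall>\<^sub>F n in sequentially. norm (vcoef L (h n) k - vcoef L g k)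
        \<le> L2_norm L (\<lambda>x. h n x - g x) * (1 / sqrt (L ^ 3))"
      using vcoef_norm_le[OF L L2_diff[OF h g]] by (simp add: vcoef_diff h g)
    show "(\<lambda>n. L2_norm L (\<lambda>x. h n x - g x) * (1 / sqrt (L ^ 3))) \<longlonglongrightarrow> 0"
      using tendsto_mult_right[OF lim, of "1 / sqrt (L ^ 3)"] by (simp only: mult_zero_left)
  qed
  then show ?thesis by (rule LIM_zero_cancel)
qed

text \<open>Both conditions are linear in single coefficients, and each coefficient is continuous
  with respect to the L^2 norm.\<close>

lemma sol_coef_closed:
  assumes L: "L > 0" and g: "g \<in> L2 L" and h: "\<And>n::nat. h n \<in> L2 L" "\<And>n. sol_coef L (h n)"
    and lim: "(\<lambda>n. L2_norm L (\<lambda>x. h n x - g x)) \<longlonglongrightarrow> 0"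
  shows "sol_coef L g"
proof -
  note t = vcoef_tendsto[OF L g h(1) lim]
  have "(\<lambda>n. rdot k (vcoef L (h n) k)) \<longlonglongrightarrow> rdot k (vcoef L g k)" for k
    unfolding rdot_def by (intro tendsto_intros t)
  then have "(\<lambda>n::nat. 0) \<longlonglongrightarrow> rdot k (vcoef L g k)" for k using h(2) by (simp add: sol_coef_def)
  moreover have "(\<lambda>n::nat. 0) \<longlonglongrightarrow> vcoef L g 0" using t[of 0] h(2) by (simp add: sol_coef_def)
  ultimately show ?thesis unfolding sol_coef_def by (metis LIMSEQ_unique tendsto_const)
qed

lemma pderivative_component:
  fixes g :: vfield
  assumes "g differentiable (at x)"
  shows "pderivative i (\<lambda>x. g x $ j) x = pderivative i g x $ j" "(\<lambda>x. g x $ j) differentiable (at x)"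
proof -
  obtain D where D: "(g has_derivative D) (at x)" using assms unfolding differentiable_def by blast
  have d: "((\<lambda>x. g x $ j) has_derivative (\<lambda>h. D h $ j)) (at x)"
    using bounded_linear.has_derivative[OF bounded_linear_vec_nth D] .
  then show "pderivative i (\<lambda>x. g x $ j) x = pderivative i g x $ j"
    using pderivative_eq[OF d] pderivative_eq[OF D] by simp
  show "(\<lambda>x. g x $ j) differentiable (at x)" using d unfolding differentiable_def by blast
qed

lemma smooth_component:
  fixes g :: vfield
  assumes s: "smooth g"
  shows "smooth (\<lambda>x. g x $ j)"
proof -
  have "pderivs \<alpha> (\<lambda>x. g x $ j) = (\<lambda>x. pderivs \<alpha> g x $ j)" for \<alpha>
  proof (induction \<alpha>)
    case (Cons i \<alpha>)
    have "pderivs (i # \<alpha>) (\<lambda>x. g x $ j) = pderivative i (\<lambda>x. pderivs \<alpha> g x $ j)" by (simp add: Cons)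
    then show ?case using s by (simp add: fun_eq_iff smooth_def pderivative_component)
  qed simp
  then show ?thesis using s by (auto simp: smooth_def intro: pderivative_component)
qed

lemma sq_int_one [simp]: "sq_int (cell L) (\<lambda>x. 1::real)"
  by (intro sq_int_cell_continuous continuous_intros)

lemma smooth_L2: "smooth g \<Longrightarrow> g \<in> L2 L" for g :: vfield
  unfolding L2_iff by (intro sq_int_cell_continuous smooth_continuous)

lemma smooth_solenoidal_sol_coef:
  assumes L: "L > 0" and g: "g \<in> smooth_solenoidal L"
  shows "sol_coef L g"
  unfolding sol_coef_def
proof (intro conjI allI)
  have s: "smooth g" and p: "periodic L g" and d: "\<And>x. divergence g x = 0" and m: "integral\<^sup>L (cell L) g = 0"
    using g by (auto simp: smooth_solenoidal_def)
  have gL: "g \<in> L2 L" by (rule smooth_L2[OF s])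
  have "(LINT x|cell L. g x $ i) = 0" for i
    using integral_component[of L "\<lambda>x. 1" g i] m gL by simp
  then show "vcoef L g 0 = 0" by (simp add: vcoef_def fcoef_def vec_eq_iff)
  fix k
  have sc: "smooth (\<lambda>x. g x $ i)" "periodic L (\<lambda>x. g x $ i)" for i
    using smooth_component[OF s] p by (auto simp: periodic_def)
  have sq: "sq_int (cell L) (\<lambda>x. complex_of_real (pderivative i (\<lambda>x. g x $ i) x))" for i
    by (intro sq_int_cell_continuous continuous_intros smooth_continuous smooth_pderivative sc)
  have "\<i> * of_real (2 * pi / L) * rdot k (vcoef L g k)
      = (\<Sum>i\<in>UNIV. \<i> * of_real (2 * pi / L * of_int (k $ i)) * fcoef L (\<lambda>x. complex_of_real (g x $ i)) k)"
    by (simp add: rdot_def vcoef_def sum_distrib_left mult_ac)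
  also have "\<dots> = (\<Sum>i\<in>UNIV. fcoef L (\<lambda>x. complex_of_real (pderivative i (\<lambda>x. g x $ i) x)) k)"
    by (simp only: fcoef_pderivative[OF L sc])
  also have "\<dots> = fcoef L (\<lambda>x. \<Sum>i\<in>UNIV. complex_of_real (pderivative i (\<lambda>x. g x $ i) x)) k"
    by (rule fcoef_sum[symmetric]) (rule sq)
  also have "(\<lambda>x. \<Sum>i\<in>UNIV. complex_of_real (pderivative i (\<lambda>x. g x $ i) x)) = (\<lambda>x. complex_of_real (divergence g x))"
    by (simp add: divergence_def pderivative_component smooth_differentiable[OF s])
  also have "fcoef L \<dots> k = 0" by (simp add: d fcoef_def)
  finally show "rdot k (vcoef L g k) = 0" using L by simp
qed

section \<open>Truncated Fourier series and the characterization of H and V\<close>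

definition vtrig :: "real \<Rightarrow> (int^3 \<Rightarrow> complex^3) \<Rightarrow> (int^3) set \<Rightarrow> vfield" where
  "vtrig L c F x = (\<Sum>k\<in>F. \<Sum>i\<in>UNIV. re_mode L (c k $ i) k x *\<^sub>R axis i 1)"

lemma vtrig_component: "vtrig L c F x $ j = (\<Sum>k\<in>F. re_mode L (c k $ j) k x)"
  by (simp add: vtrig_def axis_def if_distrib cong: if_cong)

lemma vtrig_derivative:
  "vtrig L c F differentiable (at x)" "pderivative i (vtrig L c F) = vtrig L (\<lambda>k. symb L [i] k *s c k) F"
proof -
  have d: "(vtrig L c F has_derivative (\<lambda>h. \<Sum>k\<in>F. \<Sum>j\<in>UNIV.
      Re (c k $ j * ((\<i> * of_real (2 * pi / L * (rvec k \<bullet> h))) * fmode L k x)) *\<^sub>R axis j 1)) (at x)" for x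
    unfolding vtrig_def[abs_def]
    by (intro has_derivative_sum has_derivative_scaleR_left re_mode_has_derivative)
  then show "vtrig L c F differentiable (at x)" unfolding differentiable_def by blast
  show "pderivative i (vtrig L c F) = vtrig L (\<lambda>k. symb L [i] k *s c k) F"
    by (rule ext, subst pderivative_eq[OF d]) (simp add: vtrig_def re_mode_def inner_axis mult_ac)
qed

lemma pderivs_vtrig: "\<exists>c'. pderivs \<alpha> (vtrig L c F) = vtrig L c' F"
  by (induction \<alpha>) (auto simp: vtrig_derivative(2))

lemma smooth_vtrig: "smooth (vtrig L c F)"
  unfolding smooth_def using pderivs_vtrig vtrig_derivative(1) by metis

text \<open>Taking real parts averages c_k with the conjugate of c_(-k). Under \<open>neg\<close>
  these agree, and the symmetric cube contains both frequencies or neither.\<close>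

lemma vcoef_vtrig:
  assumes L: "L > 0" and neg: "\<And>k i. c (- k) $ i = cnj (c k $ i)"
  shows "vcoef L (vtrig L c (cube N)) k = (if k \<in> cube N then c k else 0)"
proof -
  have "fcoef L (\<lambda>x. complex_of_real (vtrig L c (cube N) x $ j)) k = (if k \<in> cube N then c k $ j else 0)" for j
  proof -
    let ?S = "trig_sum L (\<lambda>k. c k $ j) (cube N)"
    have "complex_of_real (vtrig L c (cube N) x $ j) = (1/2) * (?S x + cnj (?S x))" for x
    proof -
      have "vtrig L c (cube N) x $ j = Re (?S x)" by (simp add: vtrig_component re_mode_def trig_sum_def)
      then show ?thesis by (simp add: complex_eq_iff)
    qed
    then have "fcoef L (\<lambda>x. complex_of_real (vtrig L c (cube N) x $ j)) k = fcoef L (\<lambda>x. (1/2) * (?S x + cnj (?S x))) k"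
      by (simp only:)
    also have "\<dots> = (1/2) * (fcoef L ?S k + cnj (fcoef L ?S (- k)))"
      unfolding fcoef_cmult by (subst fcoef_add[OF sq_int_trig_sum sq_int_cnj[OF sq_int_trig_sum]]) (simp add: fcoef_cnj)
    also have "\<dots> = (if k \<in> cube N then c k $ j else 0)"
      by (simp add: fcoef_trig_sum[OF L] neg)
    finally show ?thesis .
  qed
  then show ?thesis by (auto simp: vcoef_def vec_eq_iff)
qed

lemma vtrig_smooth_solenoidal:
  assumes L: "L > 0" and neg: "\<And>k i. c (- k) $ i = cnj (c k $ i)"
    and c0: "c 0 = 0" and sol: "\<And>k. rdot k (c k) = 0"
  shows "vtrig L c (cube N) \<in> smooth_solenoidal L"
  unfolding smooth_solenoidal_def
proof (intro CollectI conjI allI smooth_vtrig)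
  let ?g = "vtrig L c (cube N)"
  show "periodic L ?g"
    using periodic_re_mode[OF L] by (simp add: periodic_def vtrig_def)
  show "divergence ?g x = 0" for x
  proof -
    have "divergence ?g x = (\<Sum>k\<in>cube N. \<Sum>i\<in>UNIV. Re (\<i> * of_real (2 * pi / L * of_int (k $ i)) * c k $ i * fmode L k x))"
      unfolding divergence_def vtrig_derivative(2) vtrig_component by (subst sum.swap) (simp add: re_mode_def)
    also have "\<dots> = (\<Sum>k\<in>cube N. Re (\<i> * of_real (2 * pi / L) * rdot k (c k) * fmode L k x))"
      by (simp only: Re_sum[symmetric] rdot_def sum_distrib_left sum_distrib_right of_real_mult of_real_of_int_eq mult_ac)
    finally show ?thesis by (simp add: sol)
  qed
  have gL: "?g \<in> L2 L" by (rule smooth_L2[OF smooth_vtrig])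
  have "(LINT x|cell L. ?g x $ i) = 0" for i
  proof -
    have "vcoef L ?g 0 $ i = 0" using vcoef_vtrig[where c=c, OF L neg, of N 0] c0 by simp
    then have "complex_of_real (LINT x|cell L. ?g x $ i) = 0"
      using L by (simp add: vcoef_def fcoef_def)
    then show ?thesis by (simp only: of_real_eq_0_iff)
  qed
  then have "(LINT x|cell L. ?g x) $ i = 0" for i
    using integral_component[of L "\<lambda>x. 1" ?g i] gL by simp
  then show "integral\<^sup>L (cell L) ?g = 0" by (simp add: vec_eq_iff)
qed

lemma infsum_cube_tail:
  fixes a :: "int^3 \<Rightarrow> real"
  assumes a: "a summable_on UNIV"
  shows "(\<lambda>k. if k \<in> cube N then 0 else a k) summable_on UNIV"
    "(\<lambda>N. infsum (\<lambda>k. if k \<in> cube N then 0 else a k) UNIV) \<longlonglongrightarrow> 0"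
proof -
  have h: "((\<lambda>k. if k \<in> cube N then 0 else a k) has_sum (infsum a UNIV - sum a (cube N))) UNIV" for N
  proof -
    have "((\<lambda>k. if k \<in> cube N then a k else 0) has_sum sum a (cube N)) UNIV"
      by (rule has_sum_finite_neutralI[of "cube N"]) auto
    from has_sum_add[OF has_sum_infsum[OF a] has_sum_uminusI[OF this]]
    moreover have "(\<lambda>k. a k + - (if k \<in> cube N then a k else 0)) = (\<lambda>k. if k \<in> cube N then 0 else a k)"
      by auto
    ultimately show ?thesis by simp
  qed
  then show "(\<lambda>k. if k \<in> cube N then 0 else a k) summable_on UNIV" by (auto simp: summable_on_def)
  have "(\<lambda>N. infsum a UNIV - sum a (cube N)) \<longlonglongrightarrow> infsum a UNIV - infsum a UNIV"
    by (intro tendsto_intros has_sum_cube has_sum_infsum a)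
  then show "(\<lambda>N. infsum (\<lambda>k. if k \<in> cube N then 0 else a k) UNIV) \<longlonglongrightarrow> 0"
    using infsumI[OF h] by simp
qed

lemma vtrig_approx_vcoef:
  assumes L: "L > 0" and g: "g \<in> L2 L"
  shows "vcoef L (\<lambda>x. vtrig L (vcoef L g) (cube N) x - g x) k = (if k \<in> cube N then 0 else - vcoef L g k)"
  by (subst vcoef_diff[OF smooth_L2[OF smooth_vtrig] g]) (simp add: vcoef_vtrig[where c="vcoef L g", OF L vcoef_neg])

text \<open>The truncated Fourier series of a field with solenoidal coefficients is itself smooth
  and solenoidal, and by Parseval its distance to the field is a tail of a convergent sum. The other
  direction is closedness of the coefficient conditions.\<close>

theorem H_space_iff:
  assumes L: "L > 0"
  shows "g \<in> H_space L \<longleftrightarrow> g \<in> L2 L \<and> sol_coef L g"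
proof
  assume a: "g \<in> H_space L"
  then obtain h where g: "g \<in> L2 L" and h: "\<And>k::nat. h k \<in> smooth_solenoidal L"
    and lim: "(\<lambda>k. L2_norm L (\<lambda>x. h k x - g x)) \<longlonglongrightarrow> 0" by (auto simp: H_space_def)
  have "h k \<in> L2 L" for k using h[of k] by (intro smooth_L2) (simp add: smooth_solenoidal_def)
  then show "g \<in> L2 L \<and> sol_coef L g"
    using sol_coef_closed[OF L g _ smooth_solenoidal_sol_coef[OF L h] lim] g by blast
next
  assume a: "g \<in> L2 L \<and> sol_coef L g"
  then have g: "g \<in> L2 L" by simp
  let ?h = "\<lambda>N. vtrig L (vcoef L g) (cube N)"
  have sol: "?h N \<in> smooth_solenoidal L" for N
    using a by (intro vtrig_smooth_solenoidal L vcoef_neg) (auto simp: sol_coef_def)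
  have "L2_norm L (\<lambda>x. ?h N x - g x)
      = sqrt (L ^ 3 * infsum (\<lambda>k. if k \<in> cube N then 0 else (norm (vcoef L g k))\<^sup>2) UNIV)" for N
  proof -
    have d: "(\<lambda>x. ?h N x - g x) \<in> L2 L" by (intro L2_diff smooth_L2 smooth_vtrig g)
    have "infsum (\<lambda>k. (norm (vcoef L (\<lambda>x. ?h N x - g x) k))\<^sup>2) UNIV = (L2_norm L (\<lambda>x. ?h N x - g x))\<^sup>2 / L ^ 3"
      using parseval_vec_norm[OF L d] by (rule infsumI)
    moreover have "(norm (vcoef L (\<lambda>x. ?h N x - g x) k))\<^sup>2 = (if k \<in> cube N then 0 else (norm (vcoef L g k))\<^sup>2)" for k
      by (simp add: vtrig_approx_vcoef[OF L g])
    ultimately have "L ^ 3 * infsum (\<lambda>k. if k \<in> cube N then 0 else (norm (vcoef L g k))\<^sup>2) UNIV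
        = (L2_norm L (\<lambda>x. ?h N x - g x))\<^sup>2" using L by simp
    then show ?thesis by (simp add: L2_norm_eq)
  qed
  moreover have "(\<lambda>N. sqrt (L ^ 3 * infsum (\<lambda>k. if k \<in> cube N then 0 else (norm (vcoef L g k))\<^sup>2) UNIV)) \<longlonglongrightarrow> sqrt (L ^ 3 * 0)"
    by (intro tendsto_intros infsum_cube_tail(2) has_sum_imp_summable[OF parseval_vec_norm[OF L g]])
  ultimately have "(\<lambda>N. L2_norm L (\<lambda>x. ?h N x - g x)) \<longlonglongrightarrow> 0" by simp
  with g sol show "g \<in> H_space L" unfolding H_space_def by (intro CollectI conjI exI[of _ ?h]) auto
qed

lemma H1_norm_has_sum:
  assumes L: "L > 0" and g: "g \<in> sobolev L 1"
  shows "((\<lambda>k. (1 + eig L k) * (norm (vcoef L g k))\<^sup>2) has_sum (H1_norm L g)\<^sup>2 / L ^ 3) UNIV"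
proof -
  have gL: "g \<in> L2 L" using g by (simp add: sobolev_def)
  have "((\<lambda>k. (norm (vcoef L (weak_deriv L [i] g) k))\<^sup>2) has_sum (L2_norm L (weak_deriv L [i] g))\<^sup>2 / L ^ 3) UNIV" for i
    by (intro parseval_vec_norm L weak_deriv_correct(1)[OF L g]) simp
  then have "((\<lambda>k. (norm (vcoef L g k))\<^sup>2 + (\<Sum>i\<in>UNIV. (norm (vcoef L (weak_deriv L [i] g) k))\<^sup>2)) has_sum
     (L2_norm L g)\<^sup>2 / L ^ 3 + (\<Sum>i\<in>UNIV. (L2_norm L (weak_deriv L [i] g))\<^sup>2 / L ^ 3)) UNIV"
    by (intro has_sum_add has_sum_finite_sum parseval_vec_norm[OF L gL])
  moreover have "(norm (vcoef L g k))\<^sup>2 + (\<Sum>i\<in>UNIV. (norm (vcoef L (weak_deriv L [i] g) k))\<^sup>2)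
      = (1 + eig L k) * (norm (vcoef L g k))\<^sup>2" for k
  proof -
    have "(norm (vcoef L (weak_deriv L [i] g) k))\<^sup>2 = (2 * pi / L * of_int (k $ i))\<^sup>2 * (norm (vcoef L g k))\<^sup>2" for i
      by (subst weak_deriv_correct(2)[OF L g]) (simp, simp only: norm_smult power_mult_distrib norm_symb_sq)
    then show ?thesis unfolding eig_sum by (simp only: sum_distrib_right distrib_right mult_1)
  qed
  moreover have "(L2_norm L g)\<^sup>2 / L ^ 3 + (\<Sum>i\<in>UNIV. (L2_norm L (weak_deriv L [i] g))\<^sup>2 / L ^ 3) = (H1_norm L g)\<^sup>2 / L ^ 3"
    by (simp add: H1_norm_def sum_nonneg add_divide_distrib sum_divide_distrib)
  ultimately show ?thesis by simp
qed

lemma sob_summable_mono: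
  assumes "sob_summable L m g" "n \<le> m"
  shows "sob_summable L n g"
  unfolding sob_summable_def
  by (rule summable_on_comparison_test[OF assms(1)[unfolded sob_summable_def]])
    (auto intro!: mult_right_mono power_increasing assms(2))

lemma L2_norm_le_H1_norm: "L2_norm L g \<le> H1_norm L g"
  unfolding H1_norm_def by (rule real_le_rsqrt) (simp add: sum_nonneg)

text \<open>The approximating sequence is the same as for H; \<open>sob_summable L 1\<close> makes
  the tail weighted with \<open>1 + eig\<close> vanish.\<close>

theorem V_space_iff:
  assumes L: "L > 0"
  shows "g \<in> V_space L \<longleftrightarrow> g \<in> L2 L \<and> sol_coef L g \<and> sob_summable L 1 g"
proof
  assume a: "g \<in> V_space L"
  then obtain h where g: "g \<in> sobolev L 1" and h: "\<And>k::nat. h k \<in> smooth_solenoidal L"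
    and lim: "(\<lambda>k. H1_norm L (\<lambda>x. h k x - g x)) \<longlonglongrightarrow> 0" by (auto simp: V_space_def)
  have "(\<lambda>k. L2_norm L (\<lambda>x. h k x - g x)) \<longlonglongrightarrow> 0"
    by (rule Lim_null_comparison[OF _ lim]) (simp add: L2_norm_le_H1_norm, simp add: L2_norm_eq L2_norm_le_H1_norm[unfolded L2_norm_eq])
  then have "g \<in> H_space L" using g h unfolding H_space_def sobolev_def by blast
  then show "g \<in> L2 L \<and> sol_coef L g \<and> sob_summable L 1 g"
    using g H_space_iff[OF L] sobolev_iff[OF L] by blast
next
  assume a: "g \<in> L2 L \<and> sol_coef L g \<and> sob_summable L 1 g"
  then have g: "g \<in> L2 L" and s: "sob_summable L 1 g" by auto
  have sum: "(\<lambda>k. (1 + eig L k) * (norm (vcoef L g k))\<^sup>2) summable_on UNIV" using s by (simp add: sob_summable_def)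
  let ?h = "\<lambda>N. vtrig L (vcoef L g) (cube N)"
  have sol: "?h N \<in> smooth_solenoidal L" for N
    using a by (intro vtrig_smooth_solenoidal L vcoef_neg) (auto simp: sol_coef_def)
  have "H1_norm L (\<lambda>x. ?h N x - g x)
      = sqrt (L ^ 3 * infsum (\<lambda>k. if k \<in> cube N then 0 else (1 + eig L k) * (norm (vcoef L g k))\<^sup>2) UNIV)" for N
  proof -
    have d: "(\<lambda>x. ?h N x - g x) \<in> L2 L" by (intro L2_diff smooth_L2 smooth_vtrig g)
    have e: "(1 + eig L k) * (norm (vcoef L (\<lambda>x. ?h N x - g x) k))\<^sup>2
        = (if k \<in> cube N then 0 else (1 + eig L k) * (norm (vcoef L g k))\<^sup>2)" for k
      by (simp add: vtrig_approx_vcoef[OF L g])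
    have "sob_summable L 1 (\<lambda>x. ?h N x - g x)"
      unfolding sob_summable_def power_one_right e by (rule infsum_cube_tail(1)[OF sum])
    then have "(\<lambda>x. ?h N x - g x) \<in> sobolev L 1" using d sobolev_iff[OF L] by blast
    from infsumI[OF H1_norm_has_sum[OF L this]]
    have "L ^ 3 * infsum (\<lambda>k. if k \<in> cube N then 0 else (1 + eig L k) * (norm (vcoef L g k))\<^sup>2) UNIV
        = (H1_norm L (\<lambda>x. ?h N x - g x))\<^sup>2" using L unfolding e by simp
    then show ?thesis by (simp add: H1_norm_def sum_nonneg)
  qed
  moreover have "(\<lambda>N. sqrt (L ^ 3 * infsum (\<lambda>k. if k \<in> cube N then 0 else (1 + eig L k) * (norm (vcoef L g k))\<^sup>2) UNIV)) \<longlonglongrightarrow> sqrt (L ^ 3 * 0)"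
    by (intro tendsto_intros infsum_cube_tail(2) sum)
  ultimately have "(\<lambda>N. H1_norm L (\<lambda>x. ?h N x - g x)) \<longlonglongrightarrow> 0" by simp
  moreover have "g \<in> sobolev L 1" using g s sobolev_iff[OF L] by blast
  ultimately show "g \<in> V_space L" using sol unfolding V_space_def by (intro CollectI conjI exI[of _ ?h]) auto
qed

lemma Vm_iff:
  assumes L: "L > 0" and m: "1 \<le> m"
  shows "g \<in> Vm L m \<longleftrightarrow> g \<in> L2 L \<and> sol_coef L g \<and> sob_summable L m g"
  unfolding Vm_def using sobolev_iff[OF L] V_space_iff[OF L] sob_summable_mono[OF _ m] by auto

lemma vcoef_eq_imp:
  assumes "\<And>k. vcoef L g k = vcoef L h k"
  shows "sol_coef L g = sol_coef L h" "sob_summable L m g = sob_summable L m h"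
  using assms by (simp_all add: sol_coef_def sob_summable_def)

text \<open>The Fourier symbol of the Leray projection. The zero mode is removed because H consists
  of fields with zero average.\<close>

definition leray_coef :: "int^3 \<Rightarrow> complex^3 \<Rightarrow> complex^3" where
  "leray_coef k v = (if k = 0 then 0 else v - (rdot k v / of_real ((norm (rvec k))\<^sup>2)) *s (\<chi> i. complex_of_int (k $ i)))"

lemma norm_leray_coef: "norm (leray_coef k v) \<le> 2 * norm v"
proof (cases "k = 0")
  case False
  then have n: "norm (rvec k) > 0" by simp
  have e: "norm (\<chi> i. complex_of_int (k $ i)) = norm (rvec k)"
    by (simp add: norm_vec_def)
  have "norm ((rdot k v / of_real ((norm (rvec k))\<^sup>2)) *s (\<chi> i. complex_of_int (k $ i)))
      = cmod (rdot k v) / norm (rvec k)"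
    using n unfolding norm_smult e norm_divide norm_of_real by (simp add: power2_eq_square)
  also have "\<dots> \<le> norm v" using norm_rdot_le[of k v] n by (simp add: field_simps)
  finally show ?thesis using False norm_triangle_ineq4[of v "(rdot k v / of_real ((norm (rvec k))\<^sup>2)) *s (\<chi> i. complex_of_int (k $ i))"]
    by (simp add: leray_coef_def)
qed (simp add: leray_coef_def)

lemma rdot_self: "rdot k (\<chi> i. of_int (k $ i)) = of_real ((norm (rvec k))\<^sup>2)"
  unfolding dot_square_norm[symmetric] inner_vec_def rdot_def by simp

lemma inner_leray_coef:
  assumes "\<phi> = 0 \<or> k \<noteq> 0" "rdot k \<phi> = 0"
  shows "(v - leray_coef k v) \<bullet> \<phi> = 0"
proof (cases "k = 0")
  case False
  let ?z = "rdot k v / of_real ((norm (rvec k))\<^sup>2)"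
  have ic: "a \<bullet> b = Re (a * cnj b)" for a b :: complex by (simp add: inner_complex_def)
  have "v - leray_coef k v = ?z *s (\<chi> i. complex_of_int (k $ i))"
    using False by (simp add: leray_coef_def)
  then have "(v - leray_coef k v) \<bullet> \<phi> = (\<Sum>i\<in>UNIV. Re (?z * of_int (k $ i) * cnj (\<phi> $ i)))"
    by (simp only: inner_vec_def ic vector_smult_component vec_lambda_beta)
  also have "\<dots> = Re (?z * cnj (rdot k \<phi>))"
    by (simp only: Re_sum[symmetric] rdot_def cnj_sum complex_cnj_mult complex_cnj_of_int sum_distrib_left mult.assoc)
  finally show ?thesis using assms by simp
qed (use assms in auto)

text \<open>Since \<open>leray\<close> is defined by choice, a witness is required. It is
  synthesized mode by mode, and orthogonality to H holds for each mode, hence for the sum given by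
  Parseval.\<close>

lemma leray_exists:
  assumes L: "L > 0" and g: "g \<in> L2 L"
  shows "\<exists>h. h \<in> H_space L \<and> (\<forall>\<phi>\<in>H_space L. L2_inner L (\<lambda>x. g x - h x) \<phi> = 0)"
proof -
  let ?c = "\<lambda>k. leray_coef k (vcoef L g k)"
  have "(\<lambda>k. (norm (?c k))\<^sup>2) summable_on UNIV"
  proof (rule summable_on_comparison_test)
    show "(\<lambda>k. 4 * (norm (vcoef L g k))\<^sup>2) summable_on UNIV"
      by (intro summable_on_cmult_right has_sum_imp_summable[OF parseval_vec_norm[OF L g]])
    show "(norm (?c k))\<^sup>2 \<le> 4 * (norm (vcoef L g k))\<^sup>2" for k
      using power_mono[OF norm_leray_coef norm_ge_zero, of k "vcoef L g k" 2] by (simp add: power_mult_distrib)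
  qed simp
  moreover have rn: "rdot (- k) (vcoef L g (- k)) = - cnj (rdot k (vcoef L g k))" for k
    by (simp add: rdot_def vcoef_neg sum_negf)
  have "?c (- k) $ i = cnj (?c k $ i)" for k i
    by (simp add: leray_coef_def rn vcoef_neg)
  ultimately obtain h where h: "h \<in> L2 L" "\<And>k. vcoef L h k = ?c k"
    using vec_synthesis[OF L, of ?c] by blast
  have "rdot k (?c k) = 0" for k
    by (cases "k = 0") (auto simp: leray_coef_def rdot_linear rdot_self)
  then have hH: "h \<in> H_space L" using h by (simp add: H_space_iff[OF L] sol_coef_def leray_coef_def)
  moreover have "L2_inner L (\<lambda>x. g x - h x) \<phi> = 0" if "\<phi> \<in> H_space L" for \<phi>
  proof -
    have \<phi>: "\<phi> \<in> L2 L" "sol_coef L \<phi>" using that H_space_iff[OF L] by auto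
    have z: "vcoef L (\<lambda>x. g x - h x) k \<bullet> vcoef L \<phi> k = 0" for k
      unfolding vcoef_diff[OF g h(1)] h(2) using \<phi>(2) by (intro inner_leray_coef) (auto simp: sol_coef_def)
    have "((\<lambda>k. 0) has_sum L2_inner L (\<lambda>x. g x - h x) \<phi> / L ^ 3) (UNIV :: (int^3) set)"
      using parseval_vec[OF L L2_diff[OF g h(1)] \<phi>(1)] unfolding z .
    then have "L2_inner L (\<lambda>x. g x - h x) \<phi> / L ^ 3 = 0" using has_sum_unique has_sum_0_simp by blast
    then show ?thesis using L by simp
  qed
  ultimately show ?thesis by blast
qed

lemma leray_correct:
  assumes L: "L > 0" and g: "g \<in> L2 L"
  shows "leray L g \<in> H_space L" "\<phi> \<in> H_space L \<Longrightarrow> L2_inner L (leray L g) \<phi> = L2_inner L g \<phi>"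
proof -
  have e: "leray L g \<in> H_space L \<and> (\<forall>\<phi>\<in>H_space L. L2_inner L (\<lambda>x. g x - leray L g x) \<phi> = 0)"
    using someI_ex[OF leray_exists[OF L g]] by (simp add: leray_def orth_proj_def)
  then show h: "leray L g \<in> H_space L" by blast
  assume "\<phi> \<in> H_space L"
  then show "L2_inner L (leray L g) \<phi> = L2_inner L g \<phi>"
    using e h L2_inner_diff_left[OF g, of "leray L g" \<phi>] H_space_iff[OF L] by auto
qed

text \<open>The difference lies in H, so it is orthogonal to itself; the choice in
  \<open>leray\<close> leaves only equality almost everywhere.\<close>

lemma leray_id:
  assumes L: "L > 0" and g: "g \<in> H_space L"
  shows "ae_eq L (leray L g) g"
proof -
  have gL: "g \<in> L2 L" using g H_space_iff[OF L] by blast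
  note h = leray_correct[OF L gL]
  have hL: "leray L g \<in> L2 L" using h(1) H_space_iff[OF L] by blast
  let ?d = "\<lambda>x. leray L g x - g x"
  have d: "?d \<in> H_space L" using h(1) g unfolding H_space_iff[OF L] sol_coef_def
    by (auto simp: L2_diff vcoef_diff rdot_linear)
  have dL: "?d \<in> L2 L" by (rule L2_diff[OF hL gL])
  have "L2_inner L ?d ?d = 0" using h(2)[OF d] L2_inner_diff_left[OF hL gL dL] by simp
  then have "l2 (cell L) ?d = 0" using L2_norm_sq[of L ?d] by (simp add: L2_norm_eq)
  then have "AE x in cell L. ?d x = 0" using l2_eq_0 dL L2_iff by blast
  then show ?thesis by (simp add: ae_eq_def)
qed

lemma laplacian_vcoef:
  assumes L: "L > 0" and u: "u \<in> sobolev L 2"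
  shows "laplacian L u \<in> L2 L" "vcoef L (laplacian L u) k = (- eig L k) *\<^sub>R vcoef L u k"
proof -
  have w: "weak_deriv L [i, i] u \<in> L2 L" for i by (rule weak_deriv_correct(1)[OF L u]) simp
  have e: "laplacian L u = (\<lambda>x. \<Sum>i\<in>UNIV. weak_deriv L [i, i] u x)" by (simp add: laplacian_def fun_eq_iff)
  show "laplacian L u \<in> L2 L" unfolding e by (intro L2_sum w)
  have s: "symb L [i, i] k = - complex_of_real ((2 * pi / L * of_int (k $ i))\<^sup>2)" for i
    by (simp add: power2_eq_square algebra_simps)
  have "vcoef L (laplacian L u) k = (\<Sum>i\<in>UNIV. symb L [i, i] k *s vcoef L u k)"
    unfolding e by (subst vcoef_sum) (auto simp: w weak_deriv_correct(2)[OF L u])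
  then show "vcoef L (laplacian L u) k = (- eig L k) *\<^sub>R vcoef L u k"
    unfolding s eig_sum
    by (simp only: vec_eq_iff sum_component vector_smult_component vector_scaleR_component scaleR_conv_of_real[where 'a=complex]
        of_real_minus of_real_sum sum_distrib_right mult_minus_left sum_negf simp_thms)
qed

text \<open>The Laplacian acts as a scalar on each mode and so preserves the solenoidal condition.
  On the torus the Leray projection therefore acts as the identity on it, and the Stokes operator is
  a plain multiplier.\<close>

lemma stokes_vcoef:
  assumes L: "L > 0" and u: "u \<in> Vm L 2"
  shows "stokes L u \<in> H_space L" "vcoef L (stokes L u) k = eig L k *\<^sub>R vcoef L u k"
proof -
  have uu: "u \<in> sobolev L 2" "sol_coef L u" using u Vm_iff[OF L, of 2 u] by (auto simp: Vm_def)
  note lap = laplacian_vcoef[OF L uu(1)]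
  have H: "laplacian L u \<in> H_space L"
    using lap uu(2) by (simp add: H_space_iff[OF L] sol_coef_def rdot_linear)
  have c: "vcoef L (leray L (laplacian L u)) k = (- eig L k) *\<^sub>R vcoef L u k" for k
    using ae_eq_vcoef[OF leray_id[OF L H] lap(1)] lap(2) by simp
  have l: "leray L (laplacian L u) \<in> L2 L" using leray_correct(1)[OF L lap(1)] H_space_iff[OF L] by blast
  have e: "stokes L u = (\<lambda>x. - leray L (laplacian L u) x)" by (simp add: stokes_def fun_eq_iff)
  show v: "vcoef L (stokes L u) k = eig L k *\<^sub>R vcoef L u k" for k
    unfolding e vcoef_uminus c by simp
  show "stokes L u \<in> H_space L"
    unfolding H_space_iff[OF L] sol_coef_def v using uu(2) l
    by (auto simp: e L2_uminus rdot_linear sol_coef_def)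
qed

section \<open>Eigenfunction expansions\<close>

lemma sob_summable_add:
  assumes g: "g \<in> L2 L" "sob_summable L m g" and h: "h \<in> L2 L" "sob_summable L m h"
  shows "sob_summable L m (\<lambda>x. g x + h x)"
  unfolding sob_summable_def
proof (rule summable_on_comparison_test)
  show "(\<lambda>k. 2 * ((1 + eig L k) ^ m * (norm (vcoef L g k))\<^sup>2) + 2 * ((1 + eig L k) ^ m * (norm (vcoef L h k))\<^sup>2)) summable_on UNIV"
    using g h unfolding sob_summable_def by (intro summable_on_add summable_on_cmult_right)
  fix k
  have "(norm (vcoef L g k + vcoef L h k))\<^sup>2 \<le> (norm (vcoef L g k) + norm (vcoef L h k))\<^sup>2"
    by (intro power_mono norm_triangle_ineq) auto
  also have "\<dots> \<le> 2 * (norm (vcoef L g k))\<^sup>2 + 2 * (norm (vcoef L h k))\<^sup>2"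
    using sum_squares_ge_zero[of "norm (vcoef L g k) - norm (vcoef L h k)" 0] by (simp add: power2_eq_square algebra_simps)
  finally have "(1 + eig L k) ^ m * (norm (vcoef L g k + vcoef L h k))\<^sup>2
    \<le> (1 + eig L k) ^ m * (2 * (norm (vcoef L g k))\<^sup>2 + 2 * (norm (vcoef L h k))\<^sup>2)"
    by (rule mult_left_mono) simp
  then show "(1 + eig L k) ^ m * (norm (vcoef L (\<lambda>x. g x + h x) k))\<^sup>2
     \<le> 2 * ((1 + eig L k) ^ m * (norm (vcoef L g k))\<^sup>2) + 2 * ((1 + eig L k) ^ m * (norm (vcoef L h k))\<^sup>2)"
    by (simp add: vcoef_add g h algebra_simps)
qed simp

lemma sob_summable_scaleR:
  assumes "sob_summable L m g"
  shows "sob_summable L m (\<lambda>x. c *\<^sub>R g x)"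
proof -
  have "(\<lambda>k. c\<^sup>2 * ((1 + eig L k) ^ m * (norm (vcoef L g k))\<^sup>2)) summable_on UNIV"
    using assms unfolding sob_summable_def by (rule summable_on_cmult_right)
  then show ?thesis by (simp add: sob_summable_def vcoef_scaleR power_mult_distrib mult_ac)
qed

locale stokes_basis =
  fixes L :: real and w :: "nat \<Rightarrow> vfield" and lam :: "nat \<Rightarrow> real"
  assumes L: "L > 0" and basis: "stokes_eigenbasis L w lam"
begin

abbreviation cf :: "vfield \<Rightarrow> nat \<Rightarrow> real" where
  "cf g j \<equiv> L2_inner L g (w j)"

lemma H_L2: "g \<in> H_space L \<Longrightarrow> g \<in> L2 L"
  using H_space_iff[OF L] by blast

lemma Vm_H: "1 \<le> m \<Longrightarrow> g \<in> Vm L m \<Longrightarrow> g \<in> H_space L"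
  using H_space_iff[OF L] Vm_iff[OF L] by blast

lemma Vm_L2: "1 \<le> m \<Longrightarrow> g \<in> Vm L m \<Longrightarrow> g \<in> L2 L"
  using Vm_iff[OF L] by blast

lemma H_add: "g \<in> H_space L \<Longrightarrow> h \<in> H_space L \<Longrightarrow> (\<lambda>x. g x + h x) \<in> H_space L"
  and H_scaleR: "g \<in> H_space L \<Longrightarrow> (\<lambda>x. c *\<^sub>R g x) \<in> H_space L"
  unfolding H_space_iff[OF L] sol_coef_def by (auto simp: L2_add L2_scaleR vcoef_add vcoef_scaleR rdot_linear)

lemma Vm_add: "1 \<le> m \<Longrightarrow> g \<in> Vm L m \<Longrightarrow> h \<in> Vm L m \<Longrightarrow> (\<lambda>x. g x + h x) \<in> Vm L m"
  using Vm_iff[OF L] sob_summable_add H_add H_space_iff[OF L] by blast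

lemma Vm_scaleR: "1 \<le> m \<Longrightarrow> g \<in> Vm L m \<Longrightarrow> (\<lambda>x. c *\<^sub>R g x) \<in> Vm L m"
  using Vm_iff[OF L] sob_summable_scaleR H_scaleR H_space_iff[OF L] by blast

lemma Vm_diff: "1 \<le> m \<Longrightarrow> g \<in> Vm L m \<Longrightarrow> h \<in> Vm L m \<Longrightarrow> (\<lambda>x. g x - h x) \<in> Vm L m"
  using Vm_add[of m g "\<lambda>x. (-1) *\<^sub>R h x"] Vm_scaleR[of m h "-1"] by simp

lemma zero_Vm: "1 \<le> m \<Longrightarrow> (\<lambda>x. 0) \<in> Vm L m"
  unfolding Vm_iff[OF L] by (simp add: sol_coef_def sob_summable_def rdot_linear)

lemma Vm_sum: "1 \<le> m \<Longrightarrow> (\<And>i. i \<in> I \<Longrightarrow> f i \<in> Vm L m) \<Longrightarrow> (\<lambda>x. \<Sum>i\<in>I. f i x) \<in> Vm L m"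
  by (induction I rule: infinite_finite_induct) (auto intro: Vm_add zero_Vm)

lemma Vm_ae: "1 \<le> m \<Longrightarrow> ae_eq L g h \<Longrightarrow> h \<in> Vm L m \<Longrightarrow> g \<in> Vm L m"
  unfolding Vm_iff[OF L] using ae_eq_L2 vcoef_eq_imp[OF ae_eq_vcoef] by blast

lemma w_V2: "w j \<in> Vm L 2"
  and w_stokes: "ae_eq L (stokes L (w j)) (\<lambda>x. lam j *\<^sub>R w j x)"
  and w_orth: "L2_inner L (w i) (w j) = (if i = j then 1 else 0)"
  and w_complete: "g \<in> H_space L \<Longrightarrow> (\<lambda>N. L2_norm L (\<lambda>x. g x - (\<Sum>j<N. cf g j *\<^sub>R w j x))) \<longlonglongrightarrow> 0"
  and lam_mono: "mono lam"
  using basis unfolding stokes_eigenbasis_def by blast+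

lemma lam_pos: "0 < lam j"
proof -
  have "0 < lam 0" using basis unfolding stokes_eigenbasis_def by blast
  also have "\<dots> \<le> lam j" using lam_mono by (simp add: monoD)
  finally show ?thesis .
qed

lemma w_H: "w j \<in> H_space L"
  by (rule Vm_H[OF _ w_V2]) simp

lemma w_L2 [simp]: "w j \<in> L2 L"
  by (rule H_L2[OF w_H])

lemma w_eig: "vcoef L (w j) k = 0 \<or> eig L k = lam j"
proof -
  have "eig L k *\<^sub>R vcoef L (w j) k = lam j *\<^sub>R vcoef L (w j) k"
    using ae_eq_vcoef[OF w_stokes L2_scaleR[OF w_L2], of j k] stokes_vcoef(2)[OF L w_V2, of j k]
    by (simp add: vcoef_scaleR)
  then show ?thesis by auto
qed

text \<open>On the frequencies carried by \<open>w j\<close> the Sobolev weight is constant, so an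
  eigenfunction has every order of regularity.\<close>

lemma w_Vm: "1 \<le> m \<Longrightarrow> w j \<in> Vm L m"
proof -
  assume m: "1 \<le> m"
  have e: "(1 + eig L k) ^ m * (norm (vcoef L (w j) k))\<^sup>2 = (1 + lam j) ^ m * (norm (vcoef L (w j) k))\<^sup>2" for k
    using w_eig[of j k] by auto
  have "sob_summable L m (w j)"
    unfolding sob_summable_def e
    by (rule summable_on_cmult_right[OF has_sum_imp_summable[OF parseval_vec_norm[OF L w_L2]]])
  then show ?thesis using m w_V2[of j] Vm_iff[OF L] by auto
qed

text \<open>In Parseval's sum for the product with \<open>w j\<close> only frequencies with
  \<open>eig L k = lam j\<close> contribute, and there the multiplier is constant. This is the
  bridge between Fourier and eigenfunction coefficients.\<close>

lemma cf_multiplier: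
  assumes g: "g \<in> L2 L" and h: "h \<in> L2 L" and e: "\<And>k. vcoef L h k = F (eig L k) *\<^sub>R vcoef L g k"
  shows "cf h j = F (lam j) * cf g j"
proof -
  have t: "vcoef L h k \<bullet> vcoef L (w j) k = F (lam j) * (vcoef L g k \<bullet> vcoef L (w j) k)" for k
    using w_eig[of j k] by (auto simp: e)
  have "((\<lambda>k. F (lam j) * (vcoef L g k \<bullet> vcoef L (w j) k)) has_sum cf h j / L ^ 3) UNIV"
    using parseval_vec[OF L h w_L2[of j]] unfolding t .
  moreover have "((\<lambda>k. F (lam j) * (vcoef L g k \<bullet> vcoef L (w j) k)) has_sum F (lam j) * (cf g j / L ^ 3)) UNIV"
    by (rule has_sum_cmult_right[OF parseval_vec[OF L g w_L2]])
  ultimately have "cf h j / L ^ 3 = F (lam j) * (cf g j / L ^ 3)" by (rule has_sum_unique)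
  then show ?thesis using L by (simp add: field_simps)
qed

lemma cf_sum:
  assumes "finite J"
  shows "cf (\<lambda>x. \<Sum>j\<in>J. c j *\<^sub>R w j x) i = (if i \<in> J then c i else 0)"
  using assms by (subst L2_inner_sum_left) (auto simp: L2_scaleR L2_inner_scaleR_left w_orth if_distrib cong: if_cong)

lemma L2_inner_partial:
  assumes g: "g \<in> L2 L" and J: "finite J"
  shows "L2_inner L g (\<lambda>x. \<Sum>j\<in>J. c j *\<^sub>R w j x) = (\<Sum>j\<in>J. c j * cf g j)"
  by (subst L2_inner_sum_right) (auto simp: L2_scaleR L2_inner_scaleR_right g)

text \<open>For an orthonormal system the squared distance to the partial expansion is the Bessel
  defect, which completeness sends to zero.\<close>

lemma w_sums:
  assumes g: "g \<in> H_space L"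
  shows "(\<lambda>j. (cf g j)\<^sup>2) sums (L2_norm L g)\<^sup>2"
proof -
  have gL: "g \<in> L2 L" by (rule H_L2[OF g])
  have "(L2_norm L (\<lambda>x. g x - (\<Sum>j<N. cf g j *\<^sub>R w j x)))\<^sup>2 = (L2_norm L g)\<^sup>2 - (\<Sum>j<N. (cf g j)\<^sup>2)" for N
  proof -
    let ?S = "\<lambda>x. \<Sum>j<N. cf g j *\<^sub>R w j x"
    have S: "?S \<in> L2 L" by (intro L2_sum L2_scaleR w_L2)
    have gS: "L2_inner L g ?S = (\<Sum>j<N. (cf g j)\<^sup>2)"
      using L2_inner_partial[OF gL] by (simp add: power2_eq_square)
    have SS: "L2_inner L ?S ?S = (\<Sum>j<N. (cf g j)\<^sup>2)"
      by (subst L2_inner_partial[OF S]) (auto simp: cf_sum power2_eq_square)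
    have "L2_inner L (\<lambda>x. g x - ?S x) (\<lambda>x. g x - ?S x) = L2_inner L g g - L2_inner L g ?S - (L2_inner L g ?S - L2_inner L ?S ?S)"
      using L2_inner_diff_left[OF gL S L2_diff[OF gL S]] L2_inner_diff_left[OF gL S gL] L2_inner_diff_left[OF gL S S]
      by (simp add: L2_inner_commute)
    then show ?thesis unfolding L2_norm_sq gS SS by simp
  qed
  then have "(\<lambda>N. (L2_norm L g)\<^sup>2 - (\<Sum>j<N. (cf g j)\<^sup>2)) \<longlonglongrightarrow> 0"
    using tendsto_power[OF w_complete[OF g], of 2] by simp
  from tendsto_diff[OF tendsto_const[of "(L2_norm L g)\<^sup>2"] this] show ?thesis by (simp add: sums_def)
qed

lemma L2_norm_triangle:
  "f \<in> L2 L \<Longrightarrow> g \<in> L2 L \<Longrightarrow> L2_norm L f \<le> L2_norm L g + L2_norm L (\<lambda>x. f x - g x)"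
  using l2_triangle[of "cell L" g "\<lambda>x. f x - g x"] sq_int_diff[of "cell L" f g] by (simp add: L2_iff L2_norm_eq)

text \<open>Limits in the seminorm are unique only up to null sets, but their norm is determined.
  This suffices to evaluate norms of fields picked by choice.\<close>

lemma L2_norm_limit_unique:
  assumes g: "g \<in> L2 L" and h: "h \<in> L2 L" and s: "\<And>N::nat. s N \<in> L2 L"
    and lg: "(\<lambda>N. L2_norm L (\<lambda>x. g x - s N x)) \<longlonglongrightarrow> 0"
    and lh: "(\<lambda>N. L2_norm L (\<lambda>x. h x - s N x)) \<longlonglongrightarrow> 0"
  shows "L2_norm L g = L2_norm L h"
proof -
  have sub: "L2_norm L a \<le> L2_norm L b"
    if a: "a \<in> L2 L" and b: "b \<in> L2 L"
      and la: "(\<lambda>N. L2_norm L (\<lambda>x. a x - s N x)) \<longlonglongrightarrow> 0"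
      and lb: "(\<lambda>N. L2_norm L (\<lambda>x. b x - s N x)) \<longlonglongrightarrow> 0" for a b
  proof (rule tendsto_lowerbound)
    show "(\<lambda>N. L2_norm L b + (L2_norm L (\<lambda>x. b x - s N x) + L2_norm L (\<lambda>x. a x - s N x))) \<longlonglongrightarrow> L2_norm L b"
      using tendsto_add[OF tendsto_const[of "L2_norm L b"] tendsto_add[OF lb la]] by simp
    have "L2_norm L a \<le> L2_norm L b + (L2_norm L (\<lambda>x. b x - s N x) + L2_norm L (\<lambda>x. a x - s N x))" for N
      using L2_norm_triangle[OF a s, of N] L2_norm_triangle[OF s b, of N]
        l2_minus_commute[of "cell L" "s N" b] by (simp add: L2_norm_eq)
    then show "\<forall>\<^sub>F N in sequentially. L2_norm L a \<le> L2_norm L b + (L2_norm L (\<lambda>x. b x - s N x) + L2_norm L (\<lambda>x. a x - s N x))"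
      by simp
  qed simp
  show ?thesis by (intro antisym sub g h lg lh)
qed

text \<open>A field \<open>h\<close> with coefficients \<open>sqrt (eig L k) ^ m\<close> times those
  of \<open>g\<close> satisfies the property by which \<open>stokes_power\<close> is chosen, so both
  have the same norm. Parseval for \<open>h\<close> gives the norm in Fourier form, and
  \<open>w_sums\<close> for \<open>h\<close> gives it in eigenfunction form.\<close>

lemma Vm_norm_facts:
  assumes m: "1 \<le> m" and g: "g \<in> Vm L m"
  shows Vm_norm_eig: "((\<lambda>k. eig L k ^ m * (norm (vcoef L g k))\<^sup>2) has_sum (Vm_norm L w lam m g)\<^sup>2 / L ^ 3) UNIV"
    and Vm_norm_sums: "(\<lambda>j. lam j ^ m * (cf g j)\<^sup>2) sums (Vm_norm L w lam m g)\<^sup>2"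
proof -
  have gL: "g \<in> L2 L" and sol: "sol_coef L g" and sm: "sob_summable L m g"
    using g Vm_iff[OF L m] by auto
  let ?c = "\<lambda>k. sqrt (eig L k) ^ m *\<^sub>R vcoef L g k"
  have nc: "(norm (?c k))\<^sup>2 = eig L k ^ m * (norm (vcoef L g k))\<^sup>2" for k
    by (simp add: power_mult_distrib) (simp flip: power_mult add: mult.commute[of m 2] power_mult)
  have "(\<lambda>k. (norm (?c k))\<^sup>2) summable_on UNIV"
    unfolding nc
    by (rule summable_on_comparison_test[OF sm[unfolded sob_summable_def]])
      (auto intro!: mult_right_mono power_mono)
  moreover have "?c (- k) $ i = cnj (?c k $ i)" for k i
    by (simp add: vcoef_neg eig_def)
  ultimately obtain h where hL: "h \<in> L2 L" and hc: "\<And>k. vcoef L h k = ?c k"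
    using vec_synthesis[OF L, of ?c] by blast
  have hH: "h \<in> H_space L"
    using sol by (simp add: H_space_iff[OF L] hL sol_coef_def hc rdot_linear)
  have cfh: "cf h j = lam j powr (real m / 2) * cf g j" for j
  proof -
    have "cf h j = sqrt (lam j) ^ m * cf g j"
      by (rule cf_multiplier[OF gL hL, where F="\<lambda>e. sqrt e ^ m"]) (rule hc)
    moreover have "sqrt (lam j) ^ m = lam j powr (real m / 2)"
      using lam_pos[of j] by (simp add: powr_half_sqrt[symmetric] powr_realpow[symmetric] powr_powr)
    ultimately show ?thesis by simp
  qed
  let ?P = "\<lambda>h. h \<in> H_space L \<and>
     (\<lambda>N. L2_norm L (\<lambda>x. h x - (\<Sum>j<N. (lam j powr (real m / 2) * cf g j) *\<^sub>R w j x))) \<longlonglongrightarrow> 0"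
  have Ph: "?P h" using hH w_complete[OF hH] unfolding cfh by blast
  have Ps: "?P (stokes_power L w lam (real m / 2) g)"
    unfolding stokes_power_def by (rule someI[where P="?P", OF Ph])
  have "L2_norm L (stokes_power L w lam (real m / 2) g) = L2_norm L h"
    by (rule L2_norm_limit_unique[where s="\<lambda>N x. \<Sum>j<N. (lam j powr (real m / 2) * cf g j) *\<^sub>R w j x"])
      (use Ph Ps H_L2 in \<open>auto intro!: L2_sum L2_scaleR\<close>)
  then have n: "Vm_norm L w lam m g = L2_norm L h" by (simp add: Vm_norm_def)
  show "((\<lambda>k. eig L k ^ m * (norm (vcoef L g k))\<^sup>2) has_sum (Vm_norm L w lam m g)\<^sup>2 / L ^ 3) UNIV"
    using parseval_vec_norm[OF L hL] unfolding hc nc n .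
  have "(cf h j)\<^sup>2 = lam j ^ m * (cf g j)\<^sup>2" for j
  proof -
    have "(lam j powr (real m / 2))\<^sup>2 = lam j ^ m"
      using lam_pos[of j] by (simp add: power2_eq_square powr_add[symmetric] powr_realpow)
    then show ?thesis by (simp add: cfh power_mult_distrib)
  qed
  then show "(\<lambda>j. lam j ^ m * (cf g j)\<^sup>2) sums (Vm_norm L w lam m g)\<^sup>2"
    using w_sums[OF hH] unfolding n by simp
qed

lemma Vm_norm_nonneg [simp]: "0 \<le> Vm_norm L w lam m g"
  by (simp add: Vm_norm_def L2_norm_eq)

lemma Vm_norm_partial:
  assumes "1 \<le> m" "g \<in> Vm L m" "finite J"
  shows "(\<Sum>j\<in>J. lam j ^ m * (cf g j)\<^sup>2) \<le> (Vm_norm L w lam m g)\<^sup>2"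
  using sum_le_suminf[OF sums_summable[OF Vm_norm_sums[OF assms(1,2)]] assms(3)]
    sums_unique[OF Vm_norm_sums[OF assms(1,2)]] lam_pos by (simp add: less_imp_le)

lemma stokes_cf: "u \<in> Vm L 2 \<Longrightarrow> cf (stokes L u) j = lam j * cf u j"
  by (rule cf_multiplier[where F="\<lambda>e. e"])
    (auto simp: stokes_vcoef(2)[OF L] intro: Vm_L2[of 2] H_L2[OF stokes_vcoef(1)[OF L]])

section \<open>The Galerkin spaces and their orthogonal projections\<close>

lemma PnH_E:
  assumes "v \<in> PnH L w n"
  shows "v \<in> L2 L" "1 \<le> m \<Longrightarrow> v \<in> Vm L m" "ae_eq L v (\<lambda>x. \<Sum>j<n. cf v j *\<^sub>R w j x)" "n \<le> j \<Longrightarrow> cf v j = 0"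
proof -
  obtain c :: "nat \<Rightarrow> real" where c: "ae_eq L v (\<lambda>x. \<Sum>j<n. c j *\<^sub>R w j x)" using assms by (auto simp: PnH_def)
  have S: "(\<lambda>x. \<Sum>j<n. c j *\<^sub>R w j x) \<in> L2 L" by (intro L2_sum L2_scaleR w_L2)
  show "v \<in> L2 L" by (rule ae_eq_L2[OF c S])
  show "v \<in> Vm L m" if "1 \<le> m"
    by (rule Vm_ae[OF that c]) (intro Vm_sum Vm_scaleR w_Vm that)
  have cv: "cf v j = (if j < n then c j else 0)" for j
    using ae_eq_L2_inner[OF c S w_L2, of j] cf_sum[of "{..<n}" c j] by simp
  show "ae_eq L v (\<lambda>x. \<Sum>j<n. cf v j *\<^sub>R w j x)" using c by (simp add: cv cong: sum.cong_simp)
  show "n \<le> j \<Longrightarrow> cf v j = 0" by (simp add: cv)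
qed

lemma PnH_I: "(\<lambda>x. \<Sum>j<n. c j *\<^sub>R w j x) \<in> PnH L w n"
  unfolding PnH_def by (intro CollectI exI[of _ c] ae_eq_refl)

lemma Pn_correct:
  assumes g: "g \<in> L2 L"
  shows "Pn L w n g \<in> PnH L w n" "j < n \<Longrightarrow> cf (Pn L w n g) j = cf g j"
proof -
  let ?S = "\<lambda>x. \<Sum>j<n. cf g j *\<^sub>R w j x"
  have S: "?S \<in> L2 L" by (intro L2_sum L2_scaleR w_L2)
  have "?S \<in> PnH L w n" by (rule PnH_I)
  moreover have "L2_inner L (\<lambda>x. g x - ?S x) \<phi> = 0" if "\<phi> \<in> PnH L w n" for \<phi>
  proof -
    have d: "(\<lambda>x. g x - ?S x) \<in> L2 L" by (rule L2_diff[OF g S])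
    have "L2_inner L (\<lambda>x. g x - ?S x) \<phi> = L2_inner L (\<lambda>x. \<Sum>j<n. cf \<phi> j *\<^sub>R w j x) (\<lambda>x. g x - ?S x)"
      using ae_eq_L2_inner[OF PnH_E(3)[OF that] _ d] by (simp add: L2_inner_commute L2_sum L2_scaleR)
    also have "\<dots> = (\<Sum>j<n. cf \<phi> j * cf (\<lambda>x. g x - ?S x) j)"
      using L2_inner_partial[OF d, of "{..<n}" "cf \<phi>"] by (simp add: L2_inner_commute)
    also have "\<dots> = 0"
      by (intro sum.neutral ballI) (simp add: L2_inner_diff_left[OF g S] cf_sum)
    finally show ?thesis .
  qed
  ultimately have "\<exists>h. h \<in> PnH L w n \<and> (\<forall>\<phi>\<in>PnH L w n. L2_inner L (\<lambda>x. g x - h x) \<phi> = 0)" by blast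
  from someI_ex[OF this] have P: "Pn L w n g \<in> PnH L w n"
    and o: "\<And>\<phi>. \<phi> \<in> PnH L w n \<Longrightarrow> L2_inner L (\<lambda>x. g x - Pn L w n g x) \<phi> = 0"
    by (auto simp: Pn_def orth_proj_def)
  show "Pn L w n g \<in> PnH L w n" by (rule P)
  assume j: "j < n"
  have "w j = (\<lambda>x. \<Sum>i<n. (if i = j then 1 else 0) *\<^sub>R w i x)"
    using j by (simp add: fun_eq_iff if_distrib[of "\<lambda>c. c *\<^sub>R _"] cong: if_cong)
  then have "w j \<in> PnH L w n" using PnH_I[of "\<lambda>i. if i = j then 1 else 0" n] by simp
  from o[OF this] show "cf (Pn L w n g) j = cf g j"
    using L2_inner_diff_left[OF g PnH_E(1)[OF P] w_L2] by simp
qed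

end

section \<open>The nonlinear term\<close>

text \<open>Passing to integrals over counting measure in \<open>ennreal\<close> allows products and
  exchanges of sums without first proving that the sum of the norms is finite.\<close>

lemma has_sum_norm_nn_integral:
  fixes f :: "'a \<Rightarrow> 'b::banach"
  assumes "(f has_sum s) UNIV"
  shows "ennreal (norm s) \<le> (\<integral>\<^sup>+l. ennreal (norm (f l)) \<partial>count_space UNIV)"
proof (rule tendsto_upperbound)
  show "((\<lambda>F. ennreal (norm (sum f F))) \<longlongrightarrow> ennreal (norm s)) (finite_subsets_at_top UNIV)"
    using assms unfolding has_sum_def by (intro tendsto_ennrealI tendsto_norm)
  have "ennreal (norm (sum f F)) \<le> (\<integral>\<^sup>+l. ennreal (norm (f l)) \<partial>count_space UNIV)" if F: "finite F" for F
  proof -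
    have "ennreal (norm (sum f F)) \<le> ennreal (\<Sum>l\<in>F. norm (f l))" by (intro ennreal_leI norm_sum)
    also have "\<dots> = (\<Sum>l\<in>F. ennreal (norm (f l)))" by (simp add: sum_ennreal)
    also have "\<dots> = (\<integral>\<^sup>+l. ennreal (norm (f l)) \<partial>count_space F)" using F by (simp add: nn_integral_count_space_finite)
    also have "\<dots> \<le> (\<integral>\<^sup>+l. ennreal (norm (f l)) \<partial>count_space UNIV)"
      by (subst nn_integral_count_space_indicator) (auto intro!: nn_integral_mono simp: indicator_def)
    finally show ?thesis .
  qed
  then show "\<forall>\<^sub>F F in finite_subsets_at_top UNIV. ennreal (norm (sum f F)) \<le> (\<integral>\<^sup>+l. ennreal (norm (f l)) \<partial>count_space UNIV)"
    by (intro eventually_finite_subsets_at_top_weakI)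
qed simp

text \<open>Monotone convergence along the exhausting cubes reduces the integral to finite sums,
  each bounded by the unordered sum.\<close>

lemma has_sum_nn_integral:
  fixes f :: "int^3 \<Rightarrow> real"
  assumes s: "(f has_sum s) UNIV" and nn: "\<And>l. 0 \<le> f l"
  shows "(\<integral>\<^sup>+l. ennreal (f l) \<partial>count_space UNIV) = ennreal s"
proof (rule antisym)
  show "ennreal s \<le> (\<integral>\<^sup>+l. ennreal (f l) \<partial>count_space UNIV)"
    using has_sum_norm_nn_integral[OF s] has_sum_nonneg[OF s] nn by simp
  have "(\<integral>\<^sup>+l. ennreal (f l) \<partial>count_space UNIV)
      = (\<integral>\<^sup>+l. (SUP N. ennreal (f l) * indicator (cube N) l) \<partial>count_space UNIV)"
  proof (rule nn_integral_cong)
    fix l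
    show "ennreal (f l) = (SUP N. ennreal (f l) * indicator (cube N) l)"
    proof (rule antisym)
      obtain N where "l \<in> cube N" using in_cube_ex by blast
      then show "ennreal (f l) \<le> (SUP N. ennreal (f l) * indicator (cube N) l)"
        by (intro SUP_upper2[of N]) auto
      show "(SUP N. ennreal (f l) * indicator (cube N) l) \<le> ennreal (f l)"
        by (rule SUP_least) (auto simp: indicator_def)
    qed
  qed
  also have "\<dots> = (SUP N. \<integral>\<^sup>+l. ennreal (f l) * indicator (cube N) l \<partial>count_space UNIV)"
  proof (rule nn_integral_monotone_convergence_SUP)
    show "incseq (\<lambda>N l. ennreal (f l) * indicator (cube N) l)"
      using cube_mono by (auto simp: incseq_def le_fun_def indicator_def)
  qed auto
  also have "\<dots> \<le> ennreal s"
  proof (rule SUP_least)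
    fix N
    have "(\<integral>\<^sup>+l. ennreal (f l) * indicator (cube N) l \<partial>count_space UNIV) = (\<Sum>l\<in>cube N. ennreal (f l))"
      by (subst nn_integral_count_space_indicator[symmetric]) (auto simp: nn_integral_count_space_finite)
    also have "\<dots> = ennreal (\<Sum>l\<in>cube N. f l)" using nn by (simp add: sum_ennreal)
    also have "\<dots> \<le> ennreal s" by (intro ennreal_leI finite_sum_le_has_sum[OF s]) (auto simp: nn)
    finally show "(\<integral>\<^sup>+l. ennreal (f l) * indicator (cube N) l \<partial>count_space UNIV) \<le> ennreal s" .
  qed
  finally show "(\<integral>\<^sup>+l. ennreal (f l) \<partial>count_space UNIV) \<le> ennreal s" .
qed

lemma nn_integral_Cauchy_Schwarz_le:
  assumes "(\<integral>\<^sup>+k. (f k)\<^sup>2 \<partial>count_space UNIV) \<le> ennreal (b\<^sup>2)" "(\<integral>\<^sup>+k. (g k)\<^sup>2 \<partial>count_space UNIV) \<le> ennreal (c\<^sup>2)"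
    and "0 \<le> b" "0 \<le> c"
  shows "(\<integral>\<^sup>+k. f k * g k \<partial>count_space UNIV) \<le> ennreal (b * c)"
proof -
  have "(\<integral>\<^sup>+k. f k * g k \<partial>count_space UNIV)\<^sup>2
      \<le> (\<integral>\<^sup>+k. (f k)\<^sup>2 \<partial>count_space UNIV) * (\<integral>\<^sup>+k. (g k)\<^sup>2 \<partial>count_space UNIV)"
    by (rule Cauchy_Schwarz_nn_integral) auto
  also have "\<dots> \<le> ennreal (b\<^sup>2) * ennreal (c\<^sup>2)"
    by (intro mult_mono assms) auto
  also have "\<dots> = (ennreal (b * c))\<^sup>2"
    using assms(3,4) by (simp add: ennreal_power ennreal_mult power_mult_distrib)
  finally have X: "(\<integral>\<^sup>+k. f k * g k \<partial>count_space UNIV)\<^sup>2 \<le> (ennreal (b * c))\<^sup>2" .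
  show ?thesis
  proof (cases "\<integral>\<^sup>+k. f k * g k \<partial>count_space UNIV")
    case (real r)
    then have "ennreal (r\<^sup>2) \<le> ennreal ((b * c)\<^sup>2)" using X assms(3,4) by (simp add: ennreal_power)
    then have "r\<^sup>2 \<le> (b * c)\<^sup>2" by (subst (asm) ennreal_le_iff) auto
    then have "r \<le> b * c" by (rule power2_le_imp_le) (use assms in simp)
    then show ?thesis using real by (simp add: ennreal_leI)
  next
    case top
    then show ?thesis using X assms(3,4) by (simp add: ennreal_power top_unique)
  qed
qed

text \<open>Young's inequality \<open>\<ell>\<^sup>1 * \<ell>\<^sup>2 \<subseteq> \<ell>\<^sup>2\<close> in its dual, trilinear form.\<close>

lemma convolution_bound:
  fixes \<alpha> \<beta> \<gamma> :: "int^3 \<Rightarrow> ennreal"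
  assumes a: "(\<integral>\<^sup>+k. \<alpha> k \<partial>count_space UNIV) \<le> ennreal a"
    and b: "(\<integral>\<^sup>+k. (\<beta> k)\<^sup>2 \<partial>count_space UNIV) \<le> ennreal (b\<^sup>2)"
    and c: "(\<integral>\<^sup>+k. (\<gamma> k)\<^sup>2 \<partial>count_space UNIV) \<le> ennreal (c\<^sup>2)"
    and nn: "0 \<le> a" "0 \<le> b" "0 \<le> c"
  shows "(\<integral>\<^sup>+k. (\<integral>\<^sup>+l. \<alpha> l * \<beta> (k - l) * \<gamma> k \<partial>count_space UNIV) \<partial>count_space UNIV) \<le> ennreal (a * b * c)"
proof -
  let ?M = "count_space (UNIV :: (int^3) set)"
  interpret pair_sigma_finite ?M ?M
    by (intro pair_sigma_finite.intro sigma_finite_measure_count_space_countable) auto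
  have "(\<integral>\<^sup>+k. (\<integral>\<^sup>+l. \<alpha> l * \<beta> (k - l) * \<gamma> k \<partial>?M) \<partial>?M) = (\<integral>\<^sup>+l. (\<integral>\<^sup>+k. \<alpha> l * \<beta> (k - l) * \<gamma> k \<partial>?M) \<partial>?M)"
    by (rule Fubini') (simp add: pair_measure_countable)
  also have "\<dots> \<le> (\<integral>\<^sup>+l. \<alpha> l * ennreal (b * c) \<partial>?M)"
  proof (rule nn_integral_mono)
    fix l
    have "(\<integral>\<^sup>+k. (\<beta> (k - l))\<^sup>2 \<partial>?M) = (\<integral>\<^sup>+k. (\<beta> k)\<^sup>2 \<partial>?M)"
    proof (rule nn_integral_bij_count_space[where g="\<lambda>k. k - l" and f="\<lambda>k. (\<beta> k)\<^sup>2"])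
      show "bij_betw (\<lambda>k. k - l) UNIV UNIV"
        by (rule bij_betw_byWitness[where f'="\<lambda>k. k + l"]) auto
    qed
    then have "(\<integral>\<^sup>+k. \<beta> (k - l) * \<gamma> k \<partial>?M) \<le> ennreal (b * c)"
      using b c nn by (intro nn_integral_Cauchy_Schwarz_le) auto
    then have "\<alpha> l * (\<integral>\<^sup>+k. \<beta> (k - l) * \<gamma> k \<partial>?M) \<le> \<alpha> l * ennreal (b * c)" by (rule mult_left_mono) simp
    then show "(\<integral>\<^sup>+k. \<alpha> l * \<beta> (k - l) * \<gamma> k \<partial>?M) \<le> \<alpha> l * ennreal (b * c)"
      by (simp add: mult.assoc nn_integral_cmult)
  qed
  also have "\<dots> = (\<integral>\<^sup>+l. \<alpha> l \<partial>?M) * ennreal (b * c)" by (rule nn_integral_multc) simp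
  also have "\<dots> \<le> ennreal a * ennreal (b * c)" by (rule mult_right_mono[OF a]) simp
  also have "\<dots> = ennreal (a * b * c)" using nn by (simp add: ennreal_mult mult.assoc)
  finally show ?thesis .
qed

text \<open>The exponent 2 is shared equally among the three coordinates, 2 = 3 (2/3). This splits a
  lattice sum in dimension three into a product of one-dimensional sums.\<close>

lemma one_add_eig_lower: "(\<Prod>i\<in>UNIV. (1 + (2 * pi / L)\<^sup>2 * (of_int (k $ i))\<^sup>2) powr (2/3)) \<le> (1 + eig L k)\<^sup>2"
proof -
  have "(1 + (2 * pi / L)\<^sup>2 * (of_int (k $ i))\<^sup>2) powr (2/3) \<le> (1 + eig L k) powr (2/3)" for i
  proof (rule powr_mono2)
    show "1 + (2 * pi / L)\<^sup>2 * (of_int (k $ i))\<^sup>2 \<le> 1 + eig L k"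
      using component_le_eig[of L k i] by (simp only: power_mult_distrib add_le_cancel_left)
  qed auto
  then have "(\<Prod>i\<in>UNIV. (1 + (2 * pi / L)\<^sup>2 * (of_int (k $ i))\<^sup>2) powr (2/3)) \<le> (\<Prod>i\<in>(UNIV :: 3 set). (1 + eig L k) powr (2/3))"
    by (intro prod_mono) auto
  also have "\<dots> = ((1 + eig L k) powr (2/3)) powr 3"
    using eig_nonneg[of L k] by (simp add: powr_numeral)
  also have "\<dots> = (1 + eig L k)\<^sup>2"
    using eig_nonneg[of L k] by (simp add: powr_powr powr_numeral)
  finally show ?thesis .
qed

text \<open>The terms decay like |n|^(-4/3), an exponent above 1.\<close>

lemma sum_nat_powr_bounded:
  fixes c :: real
  assumes c: "c > 0"
  shows "(\<lambda>n::int. 1 / (1 + c * (of_int n)\<^sup>2) powr (2/3)) summable_on UNIV"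
proof -
  let ?h = "\<lambda>n::int. 1 / (1 + c * (of_int n)\<^sup>2) powr (2/3)"
  have "summable (\<lambda>n::nat. (1 / c powr (2/3)) * (of_nat n powr (- 4/3) :: real))"
    by (intro summable_mult) (simp add: summable_real_powr_iff)
  then have "summable (\<lambda>n::nat. ?h (int n))"
  proof (rule summable_comparison_test'[where N=1])
    fix n :: nat assume n: "1 \<le> n"
    have "c powr (2/3) * (of_nat n powr (4/3)) = (c * (of_nat n)\<^sup>2) powr (2/3)"
      using c n by (simp add: powr_mult powr_powr flip: powr_numeral)
    also have "\<dots> \<le> (1 + c * (of_nat n)\<^sup>2) powr (2/3)"
      using c by (intro powr_mono2) auto
    finally have "1 / (1 + c * (of_nat n)\<^sup>2) powr (2/3) \<le> 1 / (c powr (2/3) * (of_nat n powr (4/3)))"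
      using c n by (intro frac_le) auto
    also have "\<dots> = (1 / c powr (2/3)) * (of_nat n powr (- 4/3) :: real)"
      by (simp add: powr_minus_divide)
    finally show "norm (?h (int n)) \<le> (1 / c powr (2/3)) * (of_nat n powr (- 4/3) :: real)" by simp
  qed
  then have s: "(\<lambda>n::nat. ?h (int n)) summable_on UNIV"
    by (subst summable_on_UNIV_nonneg_real_iff) auto
  have "?h summable_on (range int)"
    by (subst summable_on_reindex) (use s in \<open>auto simp: o_def\<close>)
  moreover have "?h summable_on (range (\<lambda>n. - int n))"
    by (subst summable_on_reindex) (use s in \<open>auto simp: o_def inj_on_def\<close>)
  ultimately have "?h summable_on (range int \<union> range (\<lambda>n. - int n))" by (rule summable_on_union)
  moreover have "range int \<union> range (\<lambda>n. - int n) = UNIV"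
  proof -
    have "n \<in> range int \<union> range (\<lambda>n. - int n)" for n :: int
      by (cases "0 \<le> n") (auto intro: range_eqI[of n int "nat n"] range_eqI[of n "\<lambda>n. - int n" "nat (- n)"])
    then show ?thesis by blast
  qed
  ultimately show ?thesis by simp
qed

text \<open>The terms decay like |k|^(-4) in dimension three. This is the place where two
  derivatives are seen to suffice for absolutely summable Fourier coefficients.\<close>

lemma summable_inverse_eig:
  assumes L: "L > 0"
  shows "(\<lambda>k. 1 / (1 + eig L k)\<^sup>2) summable_on UNIV"
proof (rule nonneg_bdd_above_summable_on)
  let ?h = "\<lambda>n::int. 1 / (1 + (2 * pi / L)\<^sup>2 * (of_int n)\<^sup>2) powr (2/3)"
  have hs: "?h summable_on UNIV" by (rule sum_nat_powr_bounded) (use L in simp)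
  show "bdd_above (sum (\<lambda>k. 1 / (1 + eig L k)\<^sup>2) ` {F. F \<subseteq> UNIV \<and> finite F})"
  proof (rule bdd_aboveI2)
    fix F :: "(int^3) set" assume "F \<in> {F. F \<subseteq> UNIV \<and> finite F}"
    then have "finite F" by simp
    \<comment> \<open>All coordinates occurring in \<open>F\<close>: a product grid over
      \<open>I\<close> contains \<open>F\<close>, and on a grid the sum of products
      factorizes.\<close>
    define I where "I = (\<Union>k\<in>F. range (vec_nth k))"
    have I: "finite I" using \<open>finite F\<close> by (auto simp: I_def)
    have sub: "vec_nth ` F \<subseteq> PiE UNIV (\<lambda>_. I)" by (auto simp: I_def)
    have "1 / (1 + eig L k)\<^sup>2 \<le> (\<Prod>i\<in>UNIV. ?h (k $ i))" for k
    proof -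
      have "1 / (1 + eig L k)\<^sup>2 \<le> 1 / (\<Prod>i\<in>UNIV. (1 + (2 * pi / L)\<^sup>2 * (of_int (k $ i))\<^sup>2) powr (2/3))"
        using one_add_eig_lower[of L k] eig_nonneg[of L k]
        by (intro divide_left_mono) (auto intro!: mult_pos_pos prod_pos simp: add_pos_nonneg zero_less_power2 add_nonneg_eq_0_iff)
      then show ?thesis by (simp add: prod_dividef)
    qed
    then have "(\<Sum>k\<in>F. 1 / (1 + eig L k)\<^sup>2) \<le> (\<Sum>k\<in>F. \<Prod>i\<in>UNIV. ?h (k $ i))" by (rule sum_mono)
    also have "\<dots> = (\<Sum>g\<in>vec_nth ` F. \<Prod>i\<in>UNIV. ?h (g i))"
      by (subst sum.reindex) (auto simp: inj_on_def vec_nth_inject)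
    also have "\<dots> \<le> (\<Sum>g\<in>PiE UNIV (\<lambda>_::3. I). \<Prod>i\<in>UNIV. ?h (g i))"
      by (rule sum_mono2) (use I sub in \<open>auto intro!: finite_PiE prod_nonneg\<close>)
    also have "\<dots> = (\<Prod>i\<in>(UNIV :: 3 set). \<Sum>n\<in>I. ?h n)"
      by (rule prod_sum_PiE[symmetric]) (use I in auto)
    also have "\<dots> \<le> (\<Prod>i\<in>(UNIV :: 3 set). infsum ?h UNIV)"
      by (intro prod_mono conjI sum_nonneg finite_sum_le_infsum hs I) auto
    finally show "(\<Sum>k\<in>F. 1 / (1 + eig L k)\<^sup>2) \<le> (\<Prod>i\<in>(UNIV :: 3 set). infsum ?h UNIV)" .
  qed
qed simp


text \<open>The cubic partial sums are bounded everywhere by the sum of the moduli, and they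
  converge in L^2, hence in L^1, hence almost everywhere along a subsequence.\<close>

lemma fourier_bounded:
  assumes L: "L > 0" and f: "sq_int (cell L) f" and s: "(\<lambda>k. cmod (fcoef L f k)) summable_on UNIV"
  shows "AE x in cell L. cmod (f x) \<le> infsum (\<lambda>k. cmod (fcoef L f k)) UNIV"
proof -
  let ?S = "\<lambda>N. trig_sum L (fcoef L f) (cube N)"
  let ?m = "sqrt (measure (cell L) (space (cell L)))"
  have d: "sq_int (cell L) (\<lambda>x. f x - ?S N x)" for N by (intro sq_int_diff f sq_int_trig_sum)
  have "(\<lambda>N. sqrt ((l2 (cell L) f)\<^sup>2 - L ^ 3 * (\<Sum>k\<in>cube N. (cmod (fcoef L f k))\<^sup>2)))
      \<longlonglongrightarrow> sqrt ((l2 (cell L) f)\<^sup>2 - L ^ 3 * ((l2 (cell L) f)\<^sup>2 / L ^ 3))"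
    by (intro tendsto_intros has_sum_cube parseval_norm L f)
  moreover have "sqrt ((l2 (cell L) f)\<^sup>2 - L ^ 3 * (\<Sum>k\<in>cube N. (cmod (fcoef L f k))\<^sup>2)) = l2 (cell L) (\<lambda>x. f x - ?S N x)" for N
    unfolding l2_diff_trig_sum[OF L finite_cube f, symmetric] by simp
  ultimately have lim: "(\<lambda>N. l2 (cell L) (\<lambda>x. f x - ?S N x)) \<longlonglongrightarrow> 0" using L by simp
  have "(\<lambda>N. LINT x|cell L. norm (f x - ?S N x)) \<longlonglongrightarrow> 0"
  proof (rule Lim_null_comparison)
    show "\<forall>\<^sub>F N in sequentially. norm (LINT x|cell L. norm (f x - ?S N x)) \<le> l2 (cell L) (\<lambda>x. f x - ?S N x) * ?m"
      using finite_measure.sq_int_integrable(2)[OF finite_measure_cell d] by (intro always_eventually) simp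
    show "(\<lambda>N. l2 (cell L) (\<lambda>x. f x - ?S N x) * ?m) \<longlonglongrightarrow> 0"
      using tendsto_mult_right[OF lim, of ?m] by (simp only: mult_zero_left)
  qed
  from tendsto_L1_AE_subseq[OF sq_int_cell_integrable[OF d] this]
  obtain r :: "nat \<Rightarrow> nat" where "AE x in cell L. (\<lambda>n. f x - ?S (r n) x) \<longlonglongrightarrow> 0" by blast
  then show ?thesis
  proof eventually_elim
    case (elim x)
    then have "(\<lambda>n. f x - (f x - ?S (r n) x)) \<longlonglongrightarrow> f x - 0" by (intro tendsto_intros)
    then have "(\<lambda>n. cmod (?S (r n) x)) \<longlonglongrightarrow> cmod (f x)" by (intro tendsto_norm) simp
    then show ?case
    proof (rule tendsto_upperbound)
      have "cmod (?S N x) \<le> infsum (\<lambda>k. cmod (fcoef L f k)) UNIV" for N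
      proof -
        have "cmod (?S N x) \<le> (\<Sum>k\<in>cube N. cmod (fcoef L f k))"
          unfolding trig_sum_def by (rule sum_norm_le) (simp add: norm_mult)
        also have "\<dots> \<le> infsum (\<lambda>k. cmod (fcoef L f k)) UNIV"
          by (rule finite_sum_le_infsum[OF s]) auto
        finally show ?thesis .
      qed
      then show "\<forall>\<^sub>F n in sequentially. cmod (?S (r n) x) \<le> infsum (\<lambda>k. cmod (fcoef L f k)) UNIV" by simp
    qed simp
  qed
qed

text \<open>The convolution formula is Parseval for \<open>h\<close> against \<open>a\<close> times
  the mode \<open>k\<close>: as \<open>a\<close> is real, the conjugated coefficient of that product
  at \<open>l\<close> is the coefficient of \<open>a\<close> at \<open>k - l\<close>.\<close>

lemma fcoef_product:
  fixes a :: "real^3 \<Rightarrow> real" and h :: "real^3 \<Rightarrow> complex"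
  assumes L: "L > 0" and a: "sq_int (cell L) (\<lambda>x. complex_of_real (a x))" and h: "sq_int (cell L) h"
  shows "((\<lambda>l. fcoef L h l * fcoef L (\<lambda>x. complex_of_real (a x)) (k - l)) has_sum
     fcoef L (\<lambda>x. complex_of_real (a x) * h x) k) UNIV"
proof -
  let ?g = "\<lambda>x. complex_of_real (a x) * fmode L k x"
  note [measurable] = sq_intD(1)[OF a]
  have g: "sq_int (cell L) ?g"
    by (rule sq_int_bound[where C=1, OF a]) (auto simp: norm_mult)
  have "((\<lambda>l. fcoef L h l * cnj (fcoef L ?g l)) has_sum (LINT x|cell L. h x * cnj (?g x)) / of_real (L ^ 3)) UNIV"
    by (rule parseval[OF L h g])
  moreover have "cnj (fcoef L ?g l) = fcoef L (\<lambda>x. complex_of_real (a x)) (k - l)" for l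
    using fcoef_cnj[of L "\<lambda>x. complex_of_real (a x)" "k - l"] by (simp add: fcoef_shift)
  moreover have "(LINT x|cell L. h x * cnj (?g x)) / of_real (L ^ 3) = fcoef L (\<lambda>x. complex_of_real (a x) * h x) k"
    by (simp add: fcoef_def mult_ac)
  ultimately show ?thesis by simp
qed

section \<open>Frequency weights, the Wiener algebra bound and the trilinear estimate\<close>

lemma eig_pos_lower: "k \<noteq> 0 \<Longrightarrow> L > 0 \<Longrightarrow> (2 * pi / L)\<^sup>2 \<le> eig L k"
proof -
  assume "k \<noteq> 0" and L: "L > 0"
  then obtain i where "k $ i \<noteq> 0" by (auto simp: vec_eq_iff)
  then have "1 \<le> \<bar>k $ i\<bar>" by simp
  then have "(1::real) \<le> (of_int (k $ i))\<^sup>2"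
    by (metis abs_ge_zero of_int_1_le_iff of_int_abs one_le_power power2_abs)
  then have "(2 * pi / L)\<^sup>2 * 1 \<le> (2 * pi / L)\<^sup>2 * (of_int (k $ i))\<^sup>2" by (rule mult_left_mono) simp
  also have "\<dots> \<le> eig L k" using component_le_eig[of L k i] by (simp only: power_mult_distrib)
  finally show ?thesis by simp
qed

definition sfreq :: "real \<Rightarrow> int^3 \<Rightarrow> real" where
  "sfreq L k = 2 * pi / L * norm (rvec k)"

lemma sfreq_sq: "(sfreq L k)\<^sup>2 = eig L k"
  by (simp add: sfreq_def eig_def power_mult_distrib power_divide)

lemma sfreq_nonneg: "L > 0 \<Longrightarrow> 0 \<le> sfreq L k"
  by (simp add: sfreq_def)

lemma sfreq_product_le:
  assumes L: "L > 0"
  shows "sfreq L k * sfreq L l \<le> 2 * (eig L (k - l) + eig L l)"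
proof -
  have "norm (rvec k) \<le> norm (rvec (k - l)) + norm (rvec l)"
    using norm_triangle_ineq[of "rvec (k - l)" "rvec l"] by (simp del: rvec_simps(3) add: rvec_simps(3)[of k l])
  then have "2 * pi / L * norm (rvec k) \<le> 2 * pi / L * (norm (rvec (k - l)) + norm (rvec l))"
    by (rule mult_left_mono) (use L in simp)
  then have "sfreq L k \<le> sfreq L (k - l) + sfreq L l"
    unfolding sfreq_def distrib_left .
  then have "sfreq L k * sfreq L l \<le> (sfreq L (k - l) + sfreq L l) * sfreq L l"
    by (rule mult_right_mono) (rule sfreq_nonneg[OF L])
  also have "\<dots> \<le> 2 * ((sfreq L (k - l))\<^sup>2 + (sfreq L l)\<^sup>2)"
  proof -
    have "(x + y) * y \<le> 2 * (x\<^sup>2 + y\<^sup>2)" for x y :: real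
    proof -
      have "2 * (x\<^sup>2 + y\<^sup>2) - (x + y) * y = (x - y)\<^sup>2 / 2 + 3 / 2 * x\<^sup>2 + y\<^sup>2 / 2"
        by (simp add: power2_eq_square field_simps)
      moreover have "0 \<le> (x - y)\<^sup>2 / 2 + 3 / 2 * x\<^sup>2 + y\<^sup>2 / 2" by simp
      ultimately show ?thesis by linarith
    qed
    then show ?thesis .
  qed
  finally show ?thesis by (simp add: sfreq_sq)
qed

context stokes_basis
begin

lemma norm_symb_sfreq: "cmod (symb L [i] k) \<le> sfreq L k"
  using norm_symb_single[of L i k] sfreq_sq[of L k] sfreq_nonneg[OF L, of k] by (metis real_sqrt_unique)

text \<open>The constant of the embedding of V^2 into the Wiener algebra, from Cauchy-Schwarz with
  the weight \<open>1 + eig\<close>. The first factor replaces \<open>1 + eig\<close> by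
  \<open>eig\<close>, using the spectral gap (2 pi / L)^2 on nonzero modes; the last one is the
  normalization in Parseval's identity.\<close>

definition wiener_const :: real where
  "wiener_const = (1 + 1 / (2 * pi / L)\<^sup>2) * sqrt (infsum (\<lambda>k. 1 / (1 + eig L k)\<^sup>2) UNIV) / sqrt (L ^ 3)"

lemma wiener_const_nonneg: "0 \<le> wiener_const"
  using L by (simp add: wiener_const_def infsum_nonneg)

lemma wiener_bound:
  assumes a: "a \<in> Vm L 2"
  shows "(\<integral>\<^sup>+k. ennreal (norm (vcoef L a k)) \<partial>count_space UNIV) \<le> ennreal (wiener_const * Vm_norm L w lam 2 a)"
proof -
  let ?\<kappa> = "(2 * pi / L)\<^sup>2"
  let ?N = "Vm_norm L w lam 2 a"
  let ?s = "infsum (\<lambda>k. 1 / (1 + eig L k)\<^sup>2) UNIV"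
  have \<kappa>: "0 < ?\<kappa>" using L by simp
  have a0: "vcoef L a 0 = 0" using a Vm_iff[OF L, of 2 a] by (simp add: sol_coef_def)
  have le: "(1 + eig L k) * norm (vcoef L a k) \<le> (1 + 1 / ?\<kappa>) * (eig L k * norm (vcoef L a k))" for k
  proof (cases "k = 0")
    case False
    have "1 \<le> eig L k / ?\<kappa>" using eig_pos_lower[OF False L] \<kappa> by (simp add: le_divide_eq)
    then have "1 + eig L k \<le> (1 + 1 / ?\<kappa>) * eig L k" by (simp add: distrib_right)
    from mult_right_mono[OF this, of "norm (vcoef L a k)"] show ?thesis by (simp add: mult.assoc)
  qed (simp add: a0)
  have "(\<integral>\<^sup>+k. ennreal (norm (vcoef L a k)) \<partial>count_space UNIV)
      = (\<integral>\<^sup>+k. ennreal (1 / (1 + eig L k)) * ennreal ((1 + eig L k) * norm (vcoef L a k)) \<partial>count_space UNIV)"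
  proof (rule nn_integral_cong)
    fix k
    have "1 + eig L k \<noteq> 0" using eig_nonneg[of L k] by linarith
    then show "ennreal (norm (vcoef L a k)) = ennreal (1 / (1 + eig L k)) * ennreal ((1 + eig L k) * norm (vcoef L a k))"
      by (subst ennreal_mult[symmetric]) auto
  qed
  also have "\<dots> \<le> ennreal (sqrt ?s * ((1 + 1 / ?\<kappa>) * (?N / sqrt (L ^ 3))))"
  proof (rule nn_integral_Cauchy_Schwarz_le)
    have "(\<integral>\<^sup>+k. (ennreal (1 / (1 + eig L k)))\<^sup>2 \<partial>count_space UNIV) = (\<integral>\<^sup>+k. ennreal (1 / (1 + eig L k)\<^sup>2) \<partial>count_space UNIV)"
      by (rule nn_integral_cong) (simp add: ennreal_power power_divide)
    also have "\<dots> = ennreal ?s"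
      by (rule has_sum_nn_integral[OF has_sum_infsum[OF summable_inverse_eig[OF L]]]) simp
    finally show "(\<integral>\<^sup>+k. (ennreal (1 / (1 + eig L k)))\<^sup>2 \<partial>count_space UNIV) \<le> ennreal ((sqrt ?s)\<^sup>2)"
      by (simp add: infsum_nonneg)
    have "(\<integral>\<^sup>+k. (ennreal ((1 + eig L k) * norm (vcoef L a k)))\<^sup>2 \<partial>count_space UNIV)
        \<le> (\<integral>\<^sup>+k. ennreal ((1 + 1 / ?\<kappa>)\<^sup>2 * (eig L k ^ 2 * (norm (vcoef L a k))\<^sup>2)) \<partial>count_space UNIV)"
    proof (rule nn_integral_mono)
      fix k
      have "((1 + eig L k) * norm (vcoef L a k))\<^sup>2 \<le> ((1 + 1 / ?\<kappa>) * (eig L k * norm (vcoef L a k)))\<^sup>2"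
        by (rule power_mono[OF le]) simp
      then show "(ennreal ((1 + eig L k) * norm (vcoef L a k)))\<^sup>2
          \<le> ennreal ((1 + 1 / ?\<kappa>)\<^sup>2 * (eig L k ^ 2 * (norm (vcoef L a k))\<^sup>2))"
        by (subst ennreal_power) (simp, intro ennreal_leI, simp only: power_mult_distrib)
    qed
    also have "\<dots> = ennreal ((1 + 1 / ?\<kappa>)\<^sup>2 * (?N\<^sup>2 / L ^ 3))"
      by (rule has_sum_nn_integral[OF has_sum_cmult_right[OF Vm_norm_eig[OF _ a]]]) auto
    also have "(1 + 1 / ?\<kappa>)\<^sup>2 * (?N\<^sup>2 / L ^ 3) = ((1 + 1 / ?\<kappa>) * (?N / sqrt (L ^ 3)))\<^sup>2"
      unfolding power_mult_distrib power_divide using L by simp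
    finally show "(\<integral>\<^sup>+k. (ennreal ((1 + eig L k) * norm (vcoef L a k)))\<^sup>2 \<partial>count_space UNIV)
       \<le> ennreal (((1 + 1 / ?\<kappa>) * (?N / sqrt (L ^ 3)))\<^sup>2)" .
  qed (use L in \<open>auto simp: infsum_nonneg\<close>)
  finally show ?thesis by (simp add: wiener_const_def mult_ac)
qed

lemma norm_vcoef_component: "cmod (fcoef L (\<lambda>x. complex_of_real (a x $ i)) k) \<le> norm (vcoef L a k)"
  using Finite_Cartesian_Product.norm_nth_le[of "vcoef L a k" i] by (simp add: vcoef_def)

text \<open>Essential boundedness of the advecting field ensures that \<open>advect\<close> lies in
  L^2, so that the Leray projection may be applied to it.\<close>

lemma Vm2_bounded:
  assumes a: "a \<in> Vm L 2"
  obtains B where "\<And>i. AE x in cell L. \<bar>a x $ i\<bar> \<le> B"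
proof -
  have aL: "a \<in> L2 L" by (rule Vm_L2[OF _ a]) simp
  let ?M = "wiener_const * Vm_norm L w lam 2 a"
  have M: "0 \<le> ?M" by (simp add: wiener_const_nonneg)
  have fin: "(\<Sum>k\<in>F. norm (vcoef L a k)) \<le> ?M" if F: "finite F" for F
  proof -
    have "ennreal (\<Sum>k\<in>F. norm (vcoef L a k)) = (\<integral>\<^sup>+k. ennreal (norm (vcoef L a k)) \<partial>count_space F)"
      using F by (simp add: nn_integral_count_space_finite sum_ennreal)
    also have "\<dots> \<le> (\<integral>\<^sup>+k. ennreal (norm (vcoef L a k)) \<partial>count_space UNIV)"
      by (subst nn_integral_count_space_indicator) (auto intro!: nn_integral_mono simp: indicator_def)
    also have "\<dots> \<le> ennreal ?M" by (rule wiener_bound[OF a])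
    finally show ?thesis using M by simp
  qed
  have s: "(\<lambda>k. norm (vcoef L a k)) summable_on UNIV"
    by (rule nonneg_bdd_above_summable_on) (use fin in \<open>auto intro!: bdd_aboveI\<close>)
  have sc: "(\<lambda>k. cmod (fcoef L (\<lambda>x. complex_of_real (a x $ i)) k)) summable_on UNIV" for i
    by (rule summable_on_comparison_test[OF s]) (auto simp: norm_vcoef_component)
  show thesis
  proof (rule that)
    fix i
    have "infsum (\<lambda>k. cmod (fcoef L (\<lambda>x. complex_of_real (a x $ i)) k)) UNIV \<le> infsum (\<lambda>k. norm (vcoef L a k)) UNIV"
      by (rule infsum_mono[OF sc s norm_vcoef_component])
    then show "AE x in cell L. \<bar>a x $ i\<bar> \<le> infsum (\<lambda>k. norm (vcoef L a k)) UNIV"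
      using fourier_bounded[OF L L2_component[OF aL] sc[of i]] by (auto elim: eventually_mono)
  qed
qed

lemma advect_L2:
  assumes a: "a \<in> Vm L 2" and b: "b \<in> Vm L 2"
  shows "(\<lambda>x. a x $ i *\<^sub>R weak_deriv L [i] b x) \<in> L2 L" "advect L a b \<in> L2 L"
proof -
  obtain B where B: "\<And>i. AE x in cell L. \<bar>a x $ i\<bar> \<le> B" using Vm2_bounded[OF a] by blast
  have aL: "a \<in> L2 L" by (rule Vm_L2[OF _ a]) simp
  have am: "a \<in> borel_measurable (cell L)" using aL L2_iff sq_intD(1) by blast
  have bs: "b \<in> sobolev L 2" using b by (simp add: Vm_def)
  have d: "sq_int (cell L) (weak_deriv L [i] b)" for i
    using weak_deriv_correct(1)[OF L bs, of "[i]"] by (simp add: L2_iff)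
  have p: "sq_int (cell L) (\<lambda>x. a x $ i *\<^sub>R weak_deriv L [i] b x)" for i
  proof -
    note [measurable] = am sq_intD(1)[OF d[of i]]
    show ?thesis
      by (rule sq_int_bound[where C=B, OF d[of i]]) (use B[of i] in \<open>auto elim!: eventually_mono intro!: mult_right_mono\<close>)
  qed
  then show "(\<lambda>x. a x $ i *\<^sub>R weak_deriv L [i] b x) \<in> L2 L" by (simp add: L2_iff)
  have "advect L a b = (\<lambda>x. \<Sum>i\<in>UNIV. a x $ i *\<^sub>R weak_deriv L [i] b x)" by (simp add: advect_def fun_eq_iff)
  then show "advect L a b \<in> L2 L" using sq_int_sum[of UNIV "cell L", OF p] by (simp add: L2_iff)
qed

text \<open>Each product of a component of \<open>a\<close> with a derivative of a component of
  \<open>b\<close> is a convolution on the Fourier side. The factor 9 counts three directions and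
  three components, all with the same bound.\<close>

lemma advect_vcoef_bound:
  assumes a: "a \<in> Vm L 2" and b: "b \<in> Vm L 2"
  shows "ennreal (norm (vcoef L (advect L a b) k))
    \<le> 9 * (\<integral>\<^sup>+l. ennreal (norm (vcoef L a (k - l)) * (sfreq L l * norm (vcoef L b l))) \<partial>count_space UNIV)"
proof -
  let ?T = "\<integral>\<^sup>+l. ennreal (norm (vcoef L a (k - l)) * (sfreq L l * norm (vcoef L b l))) \<partial>count_space UNIV"
  let ?p = "\<lambda>i x. a x $ i *\<^sub>R weak_deriv L [i] b x"
  have aL: "a \<in> L2 L" and bs: "b \<in> sobolev L 2" using a b Vm_L2[of 2] by (auto simp: Vm_def)
  have c: "ennreal (cmod (vcoef L (?p i) k $ j)) \<le> ?T" for i j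
  proof -
    have dL: "weak_deriv L [i] b \<in> L2 L" by (rule weak_deriv_correct(1)[OF L bs]) simp
    have wd: "vcoef L (weak_deriv L [i] b) l = symb L [i] l *s vcoef L b l" for l
      by (rule weak_deriv_correct(2)[OF L bs]) simp
    have "((\<lambda>l. fcoef L (\<lambda>x. complex_of_real (weak_deriv L [i] b x $ j)) l * fcoef L (\<lambda>x. complex_of_real (a x $ i)) (k - l))
        has_sum fcoef L (\<lambda>x. complex_of_real (a x $ i) * complex_of_real (weak_deriv L [i] b x $ j)) k) UNIV"
      by (intro fcoef_product L L2_component aL dL)
    then have "((\<lambda>l. vcoef L (weak_deriv L [i] b) l $ j * vcoef L a (k - l) $ i) has_sum vcoef L (?p i) k $ j) UNIV"
      by (simp add: vcoef_def)
    from has_sum_norm_nn_integral[OF this]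
    have "ennreal (cmod (vcoef L (?p i) k $ j))
        \<le> (\<integral>\<^sup>+l. ennreal (cmod (vcoef L (weak_deriv L [i] b) l $ j * vcoef L a (k - l) $ i)) \<partial>count_space UNIV)" .
    also have "\<dots> \<le> ?T"
    proof (intro nn_integral_mono ennreal_leI)
      fix l
      have "cmod (vcoef L (weak_deriv L [i] b) l $ j) \<le> sfreq L l * norm (vcoef L b l)"
        unfolding wd vector_smult_component norm_mult
        by (intro mult_mono norm_symb_sfreq Finite_Cartesian_Product.norm_nth_le sfreq_nonneg L) auto
      then have "cmod (vcoef L (weak_deriv L [i] b) l $ j) * cmod (vcoef L a (k - l) $ i)
          \<le> (sfreq L l * norm (vcoef L b l)) * norm (vcoef L a (k - l))"
        by (intro mult_mono Finite_Cartesian_Product.norm_nth_le) (auto intro!: mult_nonneg_nonneg sfreq_nonneg L)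
      then show "cmod (vcoef L (weak_deriv L [i] b) l $ j * vcoef L a (k - l) $ i)
          \<le> norm (vcoef L a (k - l)) * (sfreq L l * norm (vcoef L b l))"
        by (simp add: norm_mult mult_ac)
    qed
    finally show ?thesis .
  qed
  have e: "vcoef L (advect L a b) k = (\<Sum>i\<in>UNIV. vcoef L (?p i) k)"
  proof -
    have "advect L a b = (\<lambda>x. \<Sum>i\<in>UNIV. ?p i x)" by (simp add: advect_def fun_eq_iff)
    then show ?thesis by (simp add: vcoef_sum advect_L2(1)[OF a b])
  qed
  have "norm (vcoef L (advect L a b) k) \<le> (\<Sum>j\<in>UNIV. \<Sum>i\<in>UNIV. cmod (vcoef L (?p i) k $ j))"
  proof -
    have "norm (vcoef L (advect L a b) k) \<le> (\<Sum>j\<in>UNIV. cmod (vcoef L (advect L a b) k $ j))"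
      unfolding norm_vec_def by (rule L2_set_le_sum) simp
    also have "\<dots> \<le> (\<Sum>j\<in>UNIV. \<Sum>i\<in>UNIV. cmod (vcoef L (?p i) k $ j))"
      unfolding e sum_component by (intro sum_mono norm_sum)
    finally show ?thesis .
  qed
  then have "ennreal (norm (vcoef L (advect L a b) k)) \<le> ennreal (\<Sum>j\<in>UNIV. \<Sum>i\<in>UNIV. cmod (vcoef L (?p i) k $ j))"
    by (rule ennreal_leI)
  also have "\<dots> = (\<Sum>j\<in>UNIV. \<Sum>i\<in>UNIV. ennreal (cmod (vcoef L (?p i) k $ j)))"
    by (simp add: sum_ennreal sum_nonneg)
  also have "\<dots> \<le> (\<Sum>j\<in>(UNIV :: 3 set). \<Sum>i\<in>(UNIV :: 3 set). ?T)" by (intro sum_mono c)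
  also have "\<dots> = 9 * ?T" by simp
  finally show ?thesis .
qed


text \<open>\<open>Z\<close> is A^2 z. On a finite span of eigenfunctions it is also the Fourier
  multiplier \<open>(eig L k)\<^sup>2\<close>, so the test field is accessible to convolution
  estimates.\<close>

lemma eigenspan:
  fixes c :: "nat \<Rightarrow> real"
  assumes J: "finite J"
  defines "z \<equiv> \<lambda>x. \<Sum>j\<in>J. c j *\<^sub>R w j x" and "Z \<equiv> \<lambda>x. \<Sum>j\<in>J. ((lam j)\<^sup>2 * c j) *\<^sub>R w j x"
  shows "z \<in> Vm L 3" "Z \<in> L2 L" "vcoef L Z k = (eig L k)\<^sup>2 *\<^sub>R vcoef L z k"
    "(Vm_norm L w lam 3 z)\<^sup>2 = (\<Sum>j\<in>J. lam j ^ 3 * (c j)\<^sup>2)"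
proof -
  show z: "z \<in> Vm L 3" unfolding z_def by (intro Vm_sum Vm_scaleR w_Vm) auto
  show "Z \<in> L2 L" unfolding Z_def by (intro L2_sum L2_scaleR w_L2)
  have t: "((lam j)\<^sup>2 * c j) *\<^sub>R vcoef L (w j) k = (eig L k)\<^sup>2 *\<^sub>R c j *\<^sub>R vcoef L (w j) k" for j
    using w_eig[of j k] by auto
  show "vcoef L Z k = (eig L k)\<^sup>2 *\<^sub>R vcoef L z k"
    unfolding Z_def z_def by (simp add: vcoef_sum L2_scaleR vcoef_scaleR scaleR_sum_right t)
  have "lam j ^ 3 * (cf z j)\<^sup>2 = (if j \<in> J then lam j ^ 3 * (c j)\<^sup>2 else 0)" for j
    unfolding z_def by (simp add: cf_sum[OF J])
  then have "(\<lambda>j. if j \<in> J then lam j ^ 3 * (c j)\<^sup>2 else 0) sums (Vm_norm L w lam 3 z)\<^sup>2"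
    using Vm_norm_sums[OF _ z] by simp
  then show "(Vm_norm L w lam 3 z)\<^sup>2 = (\<Sum>j\<in>J. lam j ^ 3 * (c j)\<^sup>2)"
    using sums_If_finite_set[OF J, of "\<lambda>j. lam j ^ 3 * (c j)\<^sup>2"] sums_unique2 by blast
qed

text \<open>On the Fourier side one derivative is moved from \<open>A\<^sup>2 z\<close> to the product by
  \<open>|k| |l| \<le> 2 (|k - l|\<^sup>2 + |l|\<^sup>2)\<close>, which leaves two \<open>\<ell>\<^sup>1 * \<ell>\<^sup>2\<close> convolutions.\<close>

theorem advect_estimate:
  assumes a: "a \<in> Vm L 2" and b: "b \<in> Vm L 2" and J: "finite J"
  shows "\<bar>L2_inner L (advect L a b) (\<lambda>x. \<Sum>j\<in>J. ((lam j)\<^sup>2 * c j) *\<^sub>R w j x)\<bar>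
    \<le> 36 * wiener_const * Vm_norm L w lam 2 a * Vm_norm L w lam 2 b * sqrt (\<Sum>j\<in>J. lam j ^ 3 * (c j)\<^sup>2)"
proof -
  define z where "z = (\<lambda>x. \<Sum>j\<in>J. c j *\<^sub>R w j x)"
  define Z where "Z = (\<lambda>x. \<Sum>j\<in>J. ((lam j)\<^sup>2 * c j) *\<^sub>R w j x)"
  note zZ = eigenspan[OF J, of c, folded z_def Z_def]
  let ?M = "count_space (UNIV :: (int^3) set)"
  let ?A = "\<lambda>k. norm (vcoef L a k)" and ?B = "\<lambda>k. norm (vcoef L b k)"
  let ?Na = "Vm_norm L w lam 2 a" and ?Nb = "Vm_norm L w lam 2 b" and ?Nz = "Vm_norm L w lam 3 z"
  let ?s = "sqrt (L ^ 3)"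
  have s: "0 < ?s" "?s\<^sup>2 = L ^ 3" using L by auto
  define \<gamma> where "\<gamma> k = ennreal (sfreq L k ^ 3 * norm (vcoef L z k))" for k
  note sf = sfreq_nonneg[OF L]
  have l2eig: "(\<integral>\<^sup>+k. (ennreal (eig L k * norm (vcoef L g k)))\<^sup>2 \<partial>?M) \<le> ennreal ((Vm_norm L w lam 2 g / ?s)\<^sup>2)"
    if g: "g \<in> Vm L 2" for g
  proof -
    have "(\<integral>\<^sup>+k. (ennreal (eig L k * norm (vcoef L g k)))\<^sup>2 \<partial>?M) = (\<integral>\<^sup>+k. ennreal (eig L k ^ 2 * (norm (vcoef L g k))\<^sup>2) \<partial>?M)"
      by (rule nn_integral_cong) (simp add: ennreal_power power_mult_distrib)
    also have "\<dots> = ennreal ((Vm_norm L w lam 2 g)\<^sup>2 / L ^ 3)"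
      by (rule has_sum_nn_integral[OF Vm_norm_eig[OF _ g]]) auto
    finally show ?thesis by (simp only: power_divide s(2) order_refl)
  qed
  have l2z: "(\<integral>\<^sup>+k. (\<gamma> k)\<^sup>2 \<partial>?M) \<le> ennreal ((?Nz / ?s)\<^sup>2)"
  proof -
    have "(sfreq L k ^ 3)\<^sup>2 = eig L k ^ 3" for k
      unfolding sfreq_sq[symmetric] by (simp flip: power_mult)
    then have "(\<integral>\<^sup>+k. (\<gamma> k)\<^sup>2 \<partial>?M) = (\<integral>\<^sup>+k. ennreal (eig L k ^ 3 * (norm (vcoef L z k))\<^sup>2) \<partial>?M)"
      unfolding \<gamma>_def by (intro nn_integral_cong) (simp add: ennreal_power power_mult_distrib sf)
    also have "\<dots> = ennreal (?Nz\<^sup>2 / L ^ 3)"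
      by (rule has_sum_nn_integral[OF Vm_norm_eig[OF _ zZ(1)]]) auto
    finally show ?thesis by (simp only: power_divide s(2) order_refl)
  qed
  have c1: "(\<integral>\<^sup>+k. (\<integral>\<^sup>+l. ennreal (?B l) * ennreal (eig L (k - l) * ?A (k - l)) * \<gamma> k \<partial>?M) \<partial>?M)
      \<le> ennreal (wiener_const * ?Nb * (?Na / ?s) * (?Nz / ?s))"
    using s by (intro convolution_bound wiener_bound b l2eig a l2z) (auto simp: wiener_const_nonneg)
  have c2: "(\<integral>\<^sup>+k. (\<integral>\<^sup>+l. ennreal (?A l) * ennreal (eig L (k - l) * ?B (k - l)) * \<gamma> k \<partial>?M) \<partial>?M)
      \<le> ennreal (wiener_const * ?Na * (?Nb / ?s) * (?Nz / ?s))"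
    using s by (intro convolution_bound wiener_bound a l2eig b l2z) (auto simp: wiener_const_nonneg)
  \<comment> \<open>The factor 18 is 9 from \<open>advect_vcoef_bound\<close> times 2 from
    \<open>sfreq_product_le\<close>. The two convolutions have equal bounds, which finally gives
    36.\<close>
  have pw: "ennreal (norm (vcoef L (advect L a b) k \<bullet> vcoef L Z k))
      \<le> 18 * ((\<integral>\<^sup>+l. ennreal (?B l) * ennreal (eig L (k - l) * ?A (k - l)) * \<gamma> k \<partial>?M)
          + (\<integral>\<^sup>+l. ennreal (?A l) * ennreal (eig L (k - l) * ?B (k - l)) * \<gamma> k \<partial>?M))" for k
  proof -
    have "norm (vcoef L (advect L a b) k \<bullet> vcoef L Z k) \<le> norm (vcoef L (advect L a b) k) * norm (vcoef L Z k)"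
      using Cauchy_Schwarz_ineq2 by simp
    \<comment> \<open>Of the four powers of |k| in A^2 z, three stay with z and form its V^3 norm;
      the remaining one is paired with the derivative |l| on \<open>b\<close>.\<close>
    also have "norm (vcoef L Z k) = sfreq L k * (sfreq L k ^ 3 * norm (vcoef L z k))"
      unfolding zZ(3) by (simp add: sfreq_sq[symmetric] power2_eq_square power3_eq_cube)
    finally have "ennreal (norm (vcoef L (advect L a b) k \<bullet> vcoef L Z k))
       \<le> ennreal (norm (vcoef L (advect L a b) k)) * (ennreal (sfreq L k) * \<gamma> k)"
      unfolding \<gamma>_def by (simp add: ennreal_mult[symmetric] sf ennreal_leI)
    also have "\<dots> \<le> 9 * (\<integral>\<^sup>+l. ennreal (?A (k - l) * (sfreq L l * ?B l)) \<partial>?M) * (ennreal (sfreq L k) * \<gamma> k)"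
      by (rule mult_right_mono[OF advect_vcoef_bound[OF a b]]) simp
    also have "\<dots> = 9 * (\<integral>\<^sup>+l. ennreal (?A (k - l) * (sfreq L l * ?B l)) * (ennreal (sfreq L k) * \<gamma> k) \<partial>?M)"
      by (subst nn_integral_multc) (auto simp: mult.assoc)
    also have "\<dots> \<le> 9 * (\<integral>\<^sup>+l. 2 * (ennreal (?B l) * ennreal (eig L (k - l) * ?A (k - l)) * \<gamma> k)
        + 2 * (ennreal (?A (k - l)) * ennreal (eig L l * ?B l) * \<gamma> k) \<partial>?M)"
    proof (intro mult_left_mono nn_integral_mono)
      fix l
      have "?A (k - l) * (sfreq L l * ?B l) * sfreq L k = (sfreq L k * sfreq L l) * (?A (k - l) * ?B l)"
        by (simp add: mult_ac)
      also have "\<dots> \<le> 2 * (eig L (k - l) + eig L l) * (?A (k - l) * ?B l)"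
        by (intro mult_right_mono sfreq_product_le L) simp
      also have "\<dots> = 2 * (?B l * (eig L (k - l) * ?A (k - l))) + 2 * (?A (k - l) * (eig L l * ?B l))"
        by (simp add: algebra_simps)
      finally have "ennreal (?A (k - l) * (sfreq L l * ?B l) * sfreq L k)
          \<le> ennreal (2 * (?B l * (eig L (k - l) * ?A (k - l))) + 2 * (?A (k - l) * (eig L l * ?B l)))"
        by (rule ennreal_leI)
      also have "\<dots> = 2 * (ennreal (?B l) * ennreal (eig L (k - l) * ?A (k - l)))
          + 2 * (ennreal (?A (k - l)) * ennreal (eig L l * ?B l))"
        by (simp add: ennreal_plus ennreal_mult)
      finally have le: "ennreal (?A (k - l) * (sfreq L l * ?B l) * sfreq L k) \<le>
          2 * (ennreal (?B l) * ennreal (eig L (k - l) * ?A (k - l)))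
          + 2 * (ennreal (?A (k - l)) * ennreal (eig L l * ?B l))" .
      have "ennreal (?A (k - l) * (sfreq L l * ?B l)) * (ennreal (sfreq L k) * \<gamma> k)
          = ennreal (?A (k - l) * (sfreq L l * ?B l) * sfreq L k) * \<gamma> k"
        by (simp add: ennreal_mult sf mult.assoc)
      also have "\<dots> \<le> (2 * (ennreal (?B l) * ennreal (eig L (k - l) * ?A (k - l)))
          + 2 * (ennreal (?A (k - l)) * ennreal (eig L l * ?B l))) * \<gamma> k"
        by (rule mult_right_mono[OF le]) simp
      finally show "ennreal (?A (k - l) * (sfreq L l * ?B l)) * (ennreal (sfreq L k) * \<gamma> k)
          \<le> 2 * (ennreal (?B l) * ennreal (eig L (k - l) * ?A (k - l)) * \<gamma> k)
          + 2 * (ennreal (?A (k - l)) * ennreal (eig L l * ?B l) * \<gamma> k)"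
        by (simp only: distrib_right mult.assoc)
    qed simp
    also have "\<dots> = 9 * (2 * (\<integral>\<^sup>+l. ennreal (?B l) * ennreal (eig L (k - l) * ?A (k - l)) * \<gamma> k \<partial>?M)
        + 2 * (\<integral>\<^sup>+l. ennreal (?A (k - l)) * ennreal (eig L l * ?B l) * \<gamma> k \<partial>?M))"
      by (subst nn_integral_add) (auto simp: nn_integral_cmult)
    also have "(\<integral>\<^sup>+l. ennreal (?A (k - l)) * ennreal (eig L l * ?B l) * \<gamma> k \<partial>?M)
        = (\<integral>\<^sup>+l. ennreal (?A l) * ennreal (eig L (k - l) * ?B (k - l)) * \<gamma> k \<partial>?M)"
    proof -
      have "bij_betw (\<lambda>l. k - l) UNIV UNIV" by (rule bij_betw_byWitness[where f'="\<lambda>l. k - l"]) auto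
      from nn_integral_bij_count_space[OF this, of "\<lambda>l. ennreal (?A (k - l)) * ennreal (eig L l * ?B l) * \<gamma> k"]
      show ?thesis by simp
    qed
    finally show ?thesis by (simp add: distrib_left mult.assoc[symmetric])
  qed
  have "ennreal (norm (L2_inner L (advect L a b) Z / L ^ 3))
      \<le> (\<integral>\<^sup>+k. ennreal (norm (vcoef L (advect L a b) k \<bullet> vcoef L Z k)) \<partial>?M)"
    by (rule has_sum_norm_nn_integral[OF parseval_vec[OF L advect_L2(2)[OF a b] zZ(2)]])
  also have "\<dots> \<le> (\<integral>\<^sup>+k. 18 * ((\<integral>\<^sup>+l. ennreal (?B l) * ennreal (eig L (k - l) * ?A (k - l)) * \<gamma> k \<partial>?M)
          + (\<integral>\<^sup>+l. ennreal (?A l) * ennreal (eig L (k - l) * ?B (k - l)) * \<gamma> k \<partial>?M)) \<partial>?M)"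
    by (intro nn_integral_mono pw)
  also have "\<dots> = 18 * ((\<integral>\<^sup>+k. (\<integral>\<^sup>+l. ennreal (?B l) * ennreal (eig L (k - l) * ?A (k - l)) * \<gamma> k \<partial>?M) \<partial>?M)
          + (\<integral>\<^sup>+k. (\<integral>\<^sup>+l. ennreal (?A l) * ennreal (eig L (k - l) * ?B (k - l)) * \<gamma> k \<partial>?M) \<partial>?M))"
    by (simp add: nn_integral_cmult nn_integral_add)
  also have "\<dots> \<le> 18 * (ennreal (wiener_const * ?Nb * (?Na / ?s) * (?Nz / ?s)) + ennreal (wiener_const * ?Na * (?Nb / ?s) * (?Nz / ?s)))"
    by (intro mult_left_mono add_mono c1 c2) simp
  also have "\<dots> = ennreal (18 * (wiener_const * ?Nb * (?Na / ?s) * (?Nz / ?s) + wiener_const * ?Na * (?Nb / ?s) * (?Nz / ?s)))"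
  proof -
    have "18 * (ennreal A + ennreal B) = ennreal (18 * (A + B))" if "0 \<le> A" "0 \<le> B" for A B
      using that by (simp add: ennreal_plus ennreal_mult)
    then show ?thesis using s(1) by (simp only: wiener_const_nonneg Vm_norm_nonneg mult_nonneg_nonneg divide_nonneg_pos)
  qed
  also have "18 * (wiener_const * ?Nb * (?Na / ?s) * (?Nz / ?s) + wiener_const * ?Na * (?Nb / ?s) * (?Nz / ?s))
      = 36 * wiener_const * ?Na * ?Nb * ?Nz / L ^ 3"
  proof -
    have "p * (x / ?s) * (y / ?s) = p * x * y / L ^ 3" for p x y
      using s(2) by (simp add: power2_eq_square)
    then show ?thesis by (simp add: mult_ac)
  qed
  finally have "norm (L2_inner L (advect L a b) Z / L ^ 3) \<le> 36 * wiener_const * ?Na * ?Nb * ?Nz / L ^ 3"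
    using L by (subst (asm) ennreal_le_iff) (auto simp: wiener_const_nonneg)
  then have "\<bar>L2_inner L (advect L a b) Z\<bar> \<le> 36 * wiener_const * ?Na * ?Nb * ?Nz"
    using L by (simp add: divide_le_cancel)
  moreover have "?Nz = sqrt (\<Sum>j\<in>J. lam j ^ 3 * (c j)\<^sup>2)"
    unfolding zZ(4)[symmetric] by simp
  ultimately show ?thesis by (simp add: Z_def)
qed

text \<open>With v = u - e the bilinear expansion contains only \<open>u\<close> and
  \<open>e\<close>. Because \<open>weak_deriv\<close> is a choice, its linearity holds almost
  everywhere and is obtained by comparing Fourier coefficients.\<close>

lemma advect_diff:
  assumes u: "u \<in> Vm L 2" and v: "v \<in> Vm L 2" and Z: "Z \<in> L2 L"
  defines "e \<equiv> \<lambda>x. u x - v x"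
  shows "L2_inner L (advect L u u) Z - L2_inner L (advect L v v) Z
    = L2_inner L (advect L e u) Z + L2_inner L (advect L u e) Z - L2_inner L (advect L e e) Z"
proof -
  have e: "e \<in> Vm L 2" unfolding e_def by (rule Vm_diff[OF _ u v]) simp
  have us: "u \<in> sobolev L 2" and vs: "v \<in> sobolev L 2" and es: "e \<in> sobolev L 2"
    using u v e by (auto simp: Vm_def)
  have uL: "u \<in> L2 L" and vL: "v \<in> L2 L" using u v Vm_L2[of 2] by auto
  have "ae_eq L (weak_deriv L [i] e) (\<lambda>x. weak_deriv L [i] u x - weak_deriv L [i] v x)" for i
  proof (rule vec_unique[OF L])
    have d: "weak_deriv L [i] g \<in> L2 L" "vcoef L (weak_deriv L [i] g) k = symb L [i] k *s vcoef L g k"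
      if "g \<in> sobolev L 2" for g k
      using weak_deriv_correct[OF L that, of "[i]"] by auto
    show "weak_deriv L [i] e \<in> L2 L" by (rule d(1)[OF es])
    show "(\<lambda>x. weak_deriv L [i] u x - weak_deriv L [i] v x) \<in> L2 L" by (intro L2_diff d us vs)
    fix k
    have "vcoef L e k = vcoef L u k - vcoef L v k" unfolding e_def by (rule vcoef_diff[OF uL vL])
    then show "vcoef L (weak_deriv L [i] e) k = vcoef L (\<lambda>x. weak_deriv L [i] u x - weak_deriv L [i] v x) k"
      unfolding vcoef_diff[OF d(1)[OF us] d(1)[OF vs]] d(2)[OF es] d(2)[OF us] d(2)[OF vs]
      by (simp add: vec_eq_iff right_diff_distrib)
  qed
  then have "AE x in cell L. \<forall>i. weak_deriv L [i] e x = weak_deriv L [i] u x - weak_deriv L [i] v x"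
    unfolding ae_eq_def by (simp add: AE_all_countable)
  then have ae: "ae_eq L (\<lambda>x. advect L u u x - advect L v v x) (\<lambda>x. advect L e u x + advect L u e x - advect L e e x)"
    unfolding ae_eq_def
  proof eventually_elim
    case (elim x)
    have ex: "e x $ i = u x $ i - v x $ i" for i by (simp add: e_def)
    show ?case unfolding advect_def elim[rule_format] ex sum_subtractf[symmetric] sum.distrib[symmetric]
      by (rule sum.cong) (simp_all add: algebra_simps)
  qed
  note A = advect_L2(2)
  have "L2_inner L (\<lambda>x. advect L u u x - advect L v v x) Z = L2_inner L (\<lambda>x. advect L e u x + advect L u e x - advect L e e x) Z"
    by (rule ae_eq_L2_inner[OF ae _ Z]) (intro L2_diff L2_add A u e)
  then show ?thesis
    using L2_inner_diff_left[OF A[OF u u] A[OF v v] Z] L2_inner_add_left[OF A[OF e u] A[OF u e] Z]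
      L2_inner_diff_left[OF L2_add[OF A[OF e u] A[OF u e]] A[OF e e] Z] by simp
qed

end

section \<open>Indefinite integrals in time and a quadratic Gronwall inequality\<close>

lemma AE_subinterval:
  assumes "AE s in lebesgue_on {0..T::real}. P s" "t \<le> T"
  shows "AE s in lebesgue_on {0..t}. P s"
proof -
  have "AE s in lebesgue. s \<in> {0..T} \<longrightarrow> P s"
    using assms(1) by (subst (asm) AE_restrict_space_iff) auto
  then have "AE s in lebesgue. s \<in> {0..t} \<longrightarrow> P s"
    by eventually_elim (use assms(2) in auto)
  then show ?thesis by (subst AE_restrict_space_iff) auto
qed

lemma integrable_subinterval_real:
  fixes f :: "real \<Rightarrow> real"
  assumes "integrable (lebesgue_on {0..T}) f" "0 \<le> a" "b \<le> T"
  shows "integrable (lebesgue_on {a..b}) f" "f integrable_on {a..b}"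
    "(LINT s|lebesgue_on {a..b}. f s) = integral {a..b} f"
proof -
  show i: "integrable (lebesgue_on {a..b}) f"
    by (rule integrable_subinterval[OF assms(1)]) (use assms in auto)
  show "f integrable_on {a..b}"
    using has_integral_integral_lebesgue_on[OF i] by (auto simp: integrable_on_def)
  show "(LINT s|lebesgue_on {a..b}. f s) = integral {a..b} f"
    by (rule lebesgue_integral_eq_integral[OF i]) auto
qed

text \<open>Replacing the chain rule for absolutely continuous functions: the defect \<open>D\<close> of the formula satisfies
  \<open>|D b - D a| \<le> e (W b - W a)\<close> on short intervals, \<open>W\<close> being the integral of \<open>|g|\<close>.\<close>

lemma square_of_indefinite_integral:
  fixes y g :: "real \<Rightarrow> real"
  assumes T: "0 \<le> T" and g: "integrable (lebesgue_on {0..T}) g"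
    and y: "\<And>t. t \<in> {0..T} \<Longrightarrow> y t = y 0 + (LINT s|lebesgue_on {0..t}. g s)"
  shows "continuous_on {0..T} y" "integrable (lebesgue_on {0..T}) (\<lambda>s. y s * g s)"
    "t \<in> {0..T} \<Longrightarrow> (y t)\<^sup>2 = (y 0)\<^sup>2 + 2 * (LINT s|lebesgue_on {0..t}. y s * g s)"
proof -
  note gI = integrable_subinterval_real[OF g]
  have yI: "y t = y 0 + integral {0..t} g" if "t \<in> {0..T}" for t
    using y[OF that] gI(3)[of 0 t] that by simp
  have "continuous_on {0..T} (\<lambda>t. y 0 + integral {0..t} g)"
    by (intro continuous_intros indefinite_integral_continuous_1 gI(2)) auto
  then show cont: "continuous_on {0..T} y" by (rule continuous_on_eq) (rule yI[symmetric])
  then have ym: "y \<in> borel_measurable (lebesgue_on {0..T})"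
    by (rule continuous_imp_measurable_on_sets_lebesgue) auto
  have "bounded (y ` {0..T})" using compact_continuous_image[OF cont] compact_imp_bounded by blast
  then obtain B where "\<forall>x\<in>y ` {0..T}. norm x \<le> B" unfolding bounded_iff by blast
  then have B: "\<bar>y t\<bar> \<le> B" if "t \<in> {0..T}" for t using that by auto
  show yg: "integrable (lebesgue_on {0..T}) (\<lambda>s. y s * g s)"
  proof (rule Bochner_Integration.integrable_bound)
    show "integrable (lebesgue_on {0..T}) (\<lambda>s. B * g s)" using g by simp
    show "(\<lambda>s. y s * g s) \<in> borel_measurable (lebesgue_on {0..T})"
      using ym borel_measurable_integrable[OF g] by measurable
    show "AE s in lebesgue_on {0..T}. norm (y s * g s) \<le> norm (B * g s)"
    proof (rule AE_I2)
      fix s assume "s \<in> space (lebesgue_on {0..T})"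
      then have "\<bar>y s\<bar> \<le> \<bar>B\<bar>" using B[of s] by auto
      then show "norm (y s * g s) \<le> norm (B * g s)" by (simp add: abs_mult mult_right_mono)
    qed
  qed
  note ygI = integrable_subinterval_real[OF yg]
  have ag: "integrable (lebesgue_on {0..T}) (\<lambda>s. \<bar>g s\<bar>)" using g by simp
  note agI = integrable_subinterval_real[OF ag]
  define D where "D t = (y t)\<^sup>2 - (y 0)\<^sup>2 - 2 * integral {0..t} (\<lambda>s. y s * g s)" for t
  define W where "W t = integral {0..t} (\<lambda>s. \<bar>g s\<bar>)" for t
  have step: "\<bar>D b - D a\<bar> \<le> 3 * e * (W b - W a)"
    if ab: "0 \<le> a" "a \<le> b" "b \<le> T" and osc: "\<And>s. s \<in> {a..b} \<Longrightarrow> \<bar>y b - y s\<bar> \<le> e" for a b e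
  proof -
    have cg: "integral {0..b} g - integral {0..a} g = integral {a..b} g"
      using Henstock_Kurzweil_Integration.integral_combine[OF ab(1,2) gI(2)] ab by auto
    have cyg: "integral {0..b} (\<lambda>s. y s * g s) - integral {0..a} (\<lambda>s. y s * g s) = integral {a..b} (\<lambda>s. y s * g s)"
      using Henstock_Kurzweil_Integration.integral_combine[OF ab(1,2) ygI(2)] ab by auto
    have cag: "W b - W a = integral {a..b} (\<lambda>s. \<bar>g s\<bar>)"
      unfolding W_def using Henstock_Kurzweil_Integration.integral_combine[OF ab(1,2) agI(2)] ab by auto
    have i1: "(\<lambda>s. (y b + y a) * g s) integrable_on {a..b}"
      and i2: "(\<lambda>s. 2 * (y s * g s)) integrable_on {a..b}"
      using ab gI(2)[of a b] ygI(2)[of a b] by (auto intro!: integrable_on_mult_right)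
    have "y b - y a = integral {a..b} g" using yI[of a] yI[of b] ab cg by auto
    then have "(y b)\<^sup>2 - (y a)\<^sup>2 = (y b + y a) * integral {a..b} g"
      by (metis mult.commute power2_eq_square square_diff_square_factored)
    then have "D b - D a = (y b + y a) * integral {a..b} g - 2 * integral {a..b} (\<lambda>s. y s * g s)"
      using cyg by (simp add: D_def algebra_simps)
    also have "\<dots> = integral {a..b} (\<lambda>s. (y b + y a) * g s - 2 * (y s * g s))"
      by (simp only: Henstock_Kurzweil_Integration.integral_diff[OF i1 i2] integral_mult_right)
    also have "norm \<dots> \<le> integral {a..b} (\<lambda>s. 3 * e * \<bar>g s\<bar>)"
    proof (rule integral_norm_bound_integral)
      show "(\<lambda>s. (y b + y a) * g s - 2 * (y s * g s)) integrable_on {a..b}"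
        by (rule integrable_diff[OF i1 i2])
      show "(\<lambda>s. 3 * e * \<bar>g s\<bar>) integrable_on {a..b}"
        using ab agI(2)[of a b] by (intro integrable_on_mult_right) auto
      fix s assume s: "s \<in> {a..b}"
      have "\<bar>y b - y s\<bar> \<le> e" "\<bar>y b - y a\<bar> \<le> e" using osc[OF s] osc[of a] ab by auto
      \<comment> \<open>The expression equals 2 (y b - y s) - (y b - y a), and each difference is at
        most \<open>e\<close>.\<close>
      then have "\<bar>y b + y a - 2 * y s\<bar> \<le> 3 * e" by linarith
      then have "\<bar>y b + y a - 2 * y s\<bar> * \<bar>g s\<bar> \<le> 3 * e * \<bar>g s\<bar>" by (intro mult_right_mono) auto
      then show "norm ((y b + y a) * g s - 2 * (y s * g s)) \<le> 3 * e * \<bar>g s\<bar>"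
        by (simp add: abs_mult[symmetric] algebra_simps)
    qed
    finally show ?thesis unfolding cag by simp
  qed
  assume t: "t \<in> {0..T}"
  have W0: "0 \<le> W t" unfolding W_def using agI(2)[of 0 t] t by (intro Henstock_Kurzweil_Integration.integral_nonneg) auto
  have "\<bar>D t\<bar> \<le> 0 + r" if r: "r > 0" for r
  proof -
    \<comment> \<open>The oscillation is chosen so that the telescoped bound 3 e W(t) stays below
      \<open>r\<close>; the summand 1 covers the case W(t) = 0.\<close>
    define e where "e = r / (3 * (W t + 1))"
    have e: "e > 0" using r W0 by (simp add: e_def)
    have "uniformly_continuous_on {0..T} y" by (rule compact_uniformly_continuous[OF cont]) auto
    then obtain d where d: "d > 0" "\<And>s s'. s \<in> {0..T} \<Longrightarrow> s' \<in> {0..T} \<Longrightarrow> dist s' s < d \<Longrightarrow> dist (y s') (y s) < e"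
      using e unfolding uniformly_continuous_on_def by metis
    obtain N :: nat where N: "t / d < N" using reals_Archimedean2 by blast
    have N0: "0 < real N" using N d(1) t by (smt (verit) atLeastAtMost_iff divide_nonneg_pos)
    \<comment> \<open>A uniform partition of [0,t] with mesh below the modulus of continuity
      \<open>d\<close>; on each piece \<open>step\<close> applies and the increments of
      \<open>W\<close> telescope.\<close>
    define p where "p i = t * real i / real N" for i :: nat
    have p: "0 \<le> p i" "p i \<le> p (Suc i)" for i
      using t N0 by (auto simp: p_def divide_right_mono mult_left_mono)
    have pT: "p i \<le> T" if "i \<le> N" for i
    proof -
      have "t * real i \<le> t * real N" using that t by (intro mult_left_mono) auto
      then have "p i \<le> t" using N0 by (simp add: p_def field_simps)
      then show ?thesis using t by simp
    qed
    have gap: "p (Suc i) - p i < d" for i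
    proof -
      have "p (Suc i) - p i = t / real N" by (simp add: p_def diff_divide_distrib[symmetric] algebra_simps)
      also have "\<dots> < d" using N d(1) N0 by (simp add: field_simps)
      finally show ?thesis .
    qed
    have "\<bar>D (p i)\<bar> \<le> 3 * e * W (p i)" if "i \<le> N" for i
      using that
    proof (induction i)
      case 0
      then show ?case by (simp add: p_def D_def W_def)
    next
      case (Suc i)
      have "\<bar>D (p (Suc i)) - D (p i)\<bar> \<le> 3 * e * (W (p (Suc i)) - W (p i))"
      proof (rule step[OF p(1) p(2) pT[OF Suc.prems]])
        fix s assume s: "s \<in> {p i..p (Suc i)}"
        have "dist (y (p (Suc i))) (y s) < e"
        proof (rule d(2))
          have "0 \<le> p i" "p (Suc i) \<le> T" using p pT[OF Suc.prems] by auto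
          then show "s \<in> {0..T}" "p (Suc i) \<in> {0..T}" using s p(1)[of "Suc i"] by auto
          show "dist (p (Suc i)) s < d" using s gap[of i] by (auto simp: dist_real_def)
        qed
        then show "\<bar>y (p (Suc i)) - y s\<bar> \<le> e" by (simp add: dist_real_def)
      qed
      moreover have "\<bar>D (p i)\<bar> \<le> 3 * e * W (p i)" using Suc by simp
      ultimately show ?case unfolding right_diff_distrib by linarith
    qed
    from this[of N] have "\<bar>D t\<bar> \<le> 3 * e * W t" using N0 by (simp add: p_def)
    also have "\<dots> = r * (W t / (W t + 1))" using W0 by (simp add: e_def field_simps)
    also have "\<dots> \<le> r * 1" using W0 r by (intro mult_left_mono) auto
    finally show ?thesis by simp
  qed
  then have "\<bar>D t\<bar> \<le> 0" by (rule field_le_epsilon)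
  then show "(y t)\<^sup>2 = (y 0)\<^sup>2 + 2 * (LINT s|lebesgue_on {0..t}. y s * g s)"
    using ygI(3)[of 0 t] t by (simp add: D_def)
qed

text \<open>The bound \<open>F\<close> on \<open>E\<close> satisfies \<open>F' \<le> K (F + F\<^sup>2)\<close>, so that \<open>F / (1 + F)\<close> obeys a linear Gronwall inequality.\<close>

lemma quadratic_Gronwall:
  fixes E :: "real \<Rightarrow> real"
  assumes T: "0 \<le> T" and cont: "continuous_on {0..T} E" and E0: "\<And>t. t \<in> {0..T} \<Longrightarrow> 0 \<le> E t"
    and K: "0 \<le> K" and \<delta>: "0 \<le> \<delta>" "\<delta> * exp (K * T) \<le> 1/2"
    and le: "\<And>t. t \<in> {0..T} \<Longrightarrow> E t \<le> \<delta> + K * integral {0..t} (\<lambda>s. E s + (E s)\<^sup>2)"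
    and t: "t \<in> {0..T}"
  shows "E t \<le> 2 * \<delta> * exp (K * T)"
proof -
  let ?q = "\<lambda>s. E s + (E s)\<^sup>2"
  have qc: "continuous_on {0..T} ?q" by (intro continuous_intros cont)
  have qi: "?q integrable_on {0..s}" if "s \<le> T" for s
    by (rule integrable_continuous_real) (rule continuous_on_subset[OF qc], use that in auto)
  define F where "F s = \<delta> + K * integral {0..s} ?q" for s
  have F0: "0 \<le> F s" if "s \<in> {0..T}" for s
  proof -
    have "0 \<le> integral {0..s} ?q"
      using that E0 qi[of s] by (intro Henstock_Kurzweil_Integration.integral_nonneg) auto
    then show ?thesis using K \<delta> by (simp add: F_def)
  qed
  have Fc: "continuous_on {0..T} F" unfolding F_def
    by (intro continuous_intros indefinite_integral_continuous_1 qi) auto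
  define G where "G s = F s / (1 + F s) * exp (- K * s)" for s
  have "G t \<le> G 0"
  proof (rule DERIV_nonpos_imp_decreasing_open[where f=G and a=0 and b=t])
    show "0 \<le> t" using t by simp
    have n: "1 + F s \<noteq> 0" if "s \<in> {0..T}" for s using F0[OF that] by linarith
    show "continuous_on {0..t} G" unfolding G_def
      using t n by (intro continuous_intros continuous_on_subset[OF Fc]) auto
    fix s assume s: "0 < s" "s < t"
    then have sT: "s \<in> {0..T}" using t by auto
    have "((\<lambda>x. integral {0..x} ?q) has_real_derivative ?q s) (at s within {0..T})"
      by (rule integral_has_real_derivative[OF qc sT])
    then have "((\<lambda>x. integral {0..x} ?q) has_real_derivative ?q s) (at s)"
      using s t at_within_Icc_at[of 0 s T] by simp
    then have dF: "(F has_real_derivative K * ?q s) (at s)"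
      unfolding F_def[abs_def] by (auto intro!: derivative_eq_intros)
    have p: "0 < 1 + F s" using F0[OF sT] by linarith
    have dG: "(G has_real_derivative (K * ?q s / (1 + F s)\<^sup>2 - K * (F s / (1 + F s))) * exp (- K * s)) (at s)"
    proof -
      have "((\<lambda>x. 1 + F x) has_real_derivative K * ?q s) (at s)"
        using DERIV_add[OF DERIV_const dF] by simp
      from DERIV_quotient[OF dF this] p
      have "((\<lambda>x. F x / (1 + F x)) has_real_derivative K * ?q s / (1 + F s)\<^sup>2) (at s)"
        by (simp add: numeral_2_eq_2 algebra_simps)
      moreover have "((\<lambda>x. exp (- K * x)) has_real_derivative exp (- K * s) * (- K)) (at s)"
        by (auto intro!: derivative_eq_intros)
      ultimately have "(G has_real_derivative K * ?q s / (1 + F s)\<^sup>2 * exp (- K * s) + exp (- K * s) * (- K) * (F s / (1 + F s))) (at s)"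
        unfolding G_def[abs_def] by (rule DERIV_mult)
      moreover have "K * ?q s / (1 + F s)\<^sup>2 * exp (- K * s) + exp (- K * s) * (- K) * (F s / (1 + F s))
          = (K * ?q s / (1 + F s)\<^sup>2 - K * (F s / (1 + F s))) * exp (- K * s)"
        unfolding left_diff_distrib by (simp only: mult_minus_left mult_minus_right mult_ac diff_conv_add_uminus)
      ultimately show ?thesis by (simp only:)
    qed
    have EF: "E s \<le> F s" using le[OF sT] by (simp add: F_def)
    have "?q s \<le> F s + (F s)\<^sup>2" using EF E0[OF sT] by (intro add_mono power_mono) auto
    also have "\<dots> = F s / (1 + F s) * (1 + F s)\<^sup>2" using p by (simp add: power2_eq_square field_simps)
    finally have "?q s / (1 + F s)\<^sup>2 \<le> F s / (1 + F s)" using p by (simp add: divide_le_eq)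
    then have "K * (?q s / (1 + F s)\<^sup>2) \<le> K * (F s / (1 + F s))" by (rule mult_left_mono[OF _ K])
    then have "(K * ?q s / (1 + F s)\<^sup>2 - K * (F s / (1 + F s))) * exp (- K * s) \<le> 0"
      by (intro mult_nonpos_nonneg) auto
    then show "\<exists>y. (G has_real_derivative y) (at s) \<and> y \<le> 0" using dG by blast
  qed
  also have "G 0 = \<delta> / (1 + \<delta>)" by (simp add: G_def F_def)
  also have "\<dots> \<le> \<delta>" using \<delta>(1) by (simp add: divide_le_eq distrib_left)
  finally have "F t / (1 + F t) * exp (- K * t) \<le> \<delta>" by (simp add: G_def)
  then have "F t / (1 + F t) * exp (- K * t) * exp (K * t) \<le> \<delta> * exp (K * t)" by (rule mult_right_mono) simp
  then have "F t / (1 + F t) \<le> \<delta> * exp (K * t)" by (simp add: mult.assoc exp_add[symmetric])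
  also have "\<dots> \<le> \<delta> * exp (K * T)" using t K \<delta>(1) by (intro mult_left_mono) (auto intro: mult_left_mono)
  finally have h: "F t / (1 + F t) \<le> \<delta> * exp (K * T)" .
  have p: "0 < 1 + F t" using F0[OF t] by linarith
  \<comment> \<open>Solving F / (1 + F) \<le> \<theta> for F is possible only for \<theta> below 1.
    The smallness hypothesis gives \<theta> \<le> 1/2 and the harmless factor 2.\<close>
  have "F t \<le> \<delta> * exp (K * T) * (1 + F t)" using h p by (simp add: divide_le_eq)
  moreover have "\<delta> * exp (K * T) * F t \<le> 1/2 * F t" by (rule mult_right_mono[OF \<delta>(2) F0[OF t]])
  ultimately have "F t \<le> 2 * (\<delta> * exp (K * T))" by (simp add: distrib_left)
  moreover have "E t \<le> F t" using le[OF t] by (simp add: F_def)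
  ultimately show ?thesis by simp
qed

section \<open>Coefficients of H-valued absolutely continuous functions\<close>

context stokes_basis
begin

text \<open>The weak identity is tested with \<open>w j\<close>. Measurability of the scalar
  derivative comes from the simple functions in Bochner measurability, whose coefficients converge
  almost everywhere by Cauchy-Schwarz; the norm of \<open>g\<close> is an integrable
  majorant.\<close>

lemma time_derivative_coefficient:
  assumes h: "has_time_derivative L T v g" and T: "0 \<le> T"
  shows "integrable (lebesgue_on {0..T}) (\<lambda>s. cf (g s) j)"
    "t \<in> {0..T} \<Longrightarrow> cf (v t) j = cf (v 0) j + (LINT s|lebesgue_on {0..t}. cf (g s) j)"
    "t \<in> {0..T} \<Longrightarrow> v t \<in> H_space L" "AE t in lebesgue_on {0..T}. g t \<in> H_space L"
proof -
  show "t \<in> {0..T} \<Longrightarrow> v t \<in> H_space L"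
    and "t \<in> {0..T} \<Longrightarrow> cf (v t) j = cf (v 0) j + (LINT s|lebesgue_on {0..t}. cf (g s) j)"
    using h w_H[of j] unfolding has_time_derivative_def by blast+
  have gb: "g \<in> bochner_Lp T 1 (H_space L) (L2_norm L)" using h unfolding has_time_derivative_def by blast
  then obtain s where gH: "AE t in lebesgue_on {0..T}. g t \<in> H_space L"
    and s: "\<And>k. simple_function (lebesgue_on {0..T}) (s k)" "\<And>k. s k ` {0..T} \<subseteq> H_space L"
    and lim: "AE t in lebesgue_on {0..T}. (\<lambda>k. L2_norm L (\<lambda>x. s k t x - g t x)) \<longlonglongrightarrow> 0"
    and int: "integrable (lebesgue_on {0..T}) (\<lambda>t. L2_norm L (g t))"
    unfolding bochner_Lp_def bochner_measurable_def by (auto simp: Bex_def)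
  show "AE t in lebesgue_on {0..T}. g t \<in> H_space L" by (rule gH)
  have w1: "L2_norm L (w j) = 1" by (simp add: L2_norm_def w_orth flip: L2_inner_def)
  have cs: "\<bar>cf f j\<bar> \<le> L2_norm L f" if "f \<in> L2 L" for f
    using L2_inner_Cauchy_Schwarz[OF that w_L2[of j]] by (simp add: w1)
  have sm: "(\<lambda>t. cf (s k t) j) \<in> borel_measurable (lebesgue_on {0..T})" for k
    using simple_function_compose1[OF s(1), of "\<lambda>f. cf f j"] by (rule borel_measurable_simple_function)
  have "AE t in lebesgue_on {0..T}. cf (g t) j = lim (\<lambda>k. cf (s k t) j)"
    using gH lim AE_space
  proof eventually_elim
    case (elim t)
    have sH: "s k t \<in> L2 L" for k
      by (rule H_L2[OF subsetD[OF s(2)]]) (use elim(3) in auto)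
    have gL: "g t \<in> L2 L" by (rule H_L2[OF elim(1)])
    have "(\<lambda>k. cf (s k t) j - cf (g t) j) \<longlonglongrightarrow> 0"
    proof (rule Lim_null_comparison[OF _ elim(2)])
      show "\<forall>\<^sub>F k in sequentially. norm (cf (s k t) j - cf (g t) j) \<le> L2_norm L (\<lambda>x. s k t x - g t x)"
        using cs[OF L2_diff[OF sH gL]] by (simp add: L2_inner_diff_left[OF sH gL w_L2])
    qed
    then have "(\<lambda>k. cf (s k t) j) \<longlonglongrightarrow> cf (g t) j" by (rule LIM_zero_cancel)
    then show ?case by (simp add: limI)
  qed
  moreover have "(\<lambda>t. lim (\<lambda>k. cf (s k t) j)) \<in> borel_measurable (lebesgue_on {0..T})"
    by (rule borel_measurable_lim_metric[OF sm])
  ultimately have m: "(\<lambda>t. cf (g t) j) \<in> borel_measurable (lebesgue_on {0..T})"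
    by (rule lebesgue_on_AE_measurable[rotated]) auto
  show "integrable (lebesgue_on {0..T}) (\<lambda>s. cf (g s) j)"
  proof (rule Bochner_Integration.integrable_bound[OF int m])
    show "AE t in lebesgue_on {0..T}. norm (cf (g t) j) \<le> norm (L2_norm L (g t))"
      using gH
    proof eventually_elim
      case (elim t)
      then show ?case using cs[OF H_L2[OF elim]] by (simp add: L2_norm_eq)
    qed
  qed
qed

end

text \<open>Young's inequality b a \<le> (\<nu>/2) a^2 + b^2 / (2\<nu>) with a = sqrt D and
  \<open>b\<close> the rest of the trilinear bound: half of the viscous term survives. The factor
  \<open>4 * M\<^sup>2 + 1\<close> comes from (2 M p + P)^2 \<le> 2 (4 M^2 P + P^2), where p = sqrt
  P.\<close>

lemma young_absorb:
  fixes D P M C \<nu> :: real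
  assumes \<nu>: "0 < \<nu>" and D: "0 \<le> D" and P: "0 \<le> P"
  shows "- \<nu> * D + C * (2 * M * sqrt P + P) * sqrt D \<le> - (\<nu> / 2) * D + C\<^sup>2 * (4 * M\<^sup>2 + 1) / \<nu> * (P + P\<^sup>2)"
proof -
  define a where "a = sqrt D"
  define p where "p = sqrt P"
  have aD: "a\<^sup>2 = D" and pP: "p\<^sup>2 = P" using D P by (auto simp: a_def p_def)
  define b where "b = C * (2 * M * p + P)"
  have "0 \<le> (\<nu> * a - b)\<^sup>2" by simp
  then have "2 * \<nu> * (b * a) \<le> \<nu>\<^sup>2 * a\<^sup>2 + b\<^sup>2" by (simp add: power2_diff power_mult_distrib mult_ac)
  then have "b * a \<le> (\<nu>\<^sup>2 * a\<^sup>2 + b\<^sup>2) / (2 * \<nu>)" using \<nu> by (simp add: field_simps)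
  also have "\<dots> = \<nu> / 2 * D + b\<^sup>2 / (2 * \<nu>)" unfolding aD[symmetric] using \<nu> by (simp add: power2_eq_square field_simps)
  also have "b\<^sup>2 / (2 * \<nu>) \<le> C\<^sup>2 * (4 * M\<^sup>2 + 1) / \<nu> * (P + P\<^sup>2)"
  proof -
    have "0 \<le> (2 * M * p - P)\<^sup>2" by simp
    then have "(2 * M * p + P)\<^sup>2 \<le> 2 * ((4 * M\<^sup>2) * P + P\<^sup>2)"
      unfolding pP[symmetric] by (simp add: power2_sum power2_diff power_mult_distrib)
    also have "\<dots> \<le> 2 * ((4 * M\<^sup>2 + 1) * (P + P\<^sup>2))"
      using P by (simp add: distrib_left distrib_right)
    finally have "C\<^sup>2 * (2 * M * p + P)\<^sup>2 \<le> C\<^sup>2 * (2 * ((4 * M\<^sup>2 + 1) * (P + P\<^sup>2)))"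
      by (rule mult_left_mono) simp
    then have "b\<^sup>2 / (2 * \<nu>) \<le> C\<^sup>2 * (2 * ((4 * M\<^sup>2 + 1) * (P + P\<^sup>2))) / (2 * \<nu>)"
      unfolding b_def power_mult_distrib using \<nu> by (intro divide_right_mono) auto
    then show ?thesis by simp
  qed
  finally show ?thesis by (simp add: b_def a_def p_def mult_ac)
qed

lemma LINT_mono_upper:
  fixes h :: "real \<Rightarrow> real"
  assumes h: "integrable (lebesgue_on {0..T}) h" and nn: "\<And>s. 0 \<le> h s" and t: "t \<in> {0..T}"
  shows "(LINT s|lebesgue_on {0..t}. h s) \<le> (LINT s|lebesgue_on {0..T}. h s)"
proof -
  note hI = integrable_subinterval_real[OF h]
  have "integral {0..t} h \<le> integral {0..T} h"
    by (rule integral_subset_le) (use t nn hI(2)[of 0] in auto)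
  then show ?thesis using hI(3)[of 0 t] hI(3)[of 0 T] t by simp
qed

text \<open>Supplies the time grid for step approximations: composing with any function of the
  integer index yields a simple function with values in an arbitrary set.\<close>

lemma simple_function_floor:
  fixes T :: real
  shows "simple_function (lebesgue_on {0..T}) (\<lambda>t. \<lfloor>real (Suc k) * t\<rfloor>)"
  unfolding simple_function_def
proof (intro conjI ballI)
  have "(\<lambda>t. \<lfloor>real (Suc k) * t\<rfloor>) ` space (lebesgue_on {0..T}) \<subseteq> {0..\<lfloor>real (Suc k) * T\<rfloor>}"
    by (auto intro!: floor_mono mult_left_mono)
  then show "finite ((\<lambda>t. \<lfloor>real (Suc k) * t\<rfloor>) ` space (lebesgue_on {0..T}))"
    by (rule finite_subset) simp
  fix i
  have m: "(\<lambda>t. real (Suc k) * t) \<in> borel_measurable (lebesgue_on {0..T})"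
    by (rule continuous_imp_measurable_on_sets_lebesgue) (auto intro!: continuous_intros)
  have "{t \<in> space (lebesgue_on {0..T}). real_of_int i \<le> real (Suc k) * t \<and> real (Suc k) * t < real_of_int i + 1} \<in> sets (lebesgue_on {0..T})"
    using m by measurable
  moreover have "(\<lambda>t. \<lfloor>real (Suc k) * t\<rfloor>) -` {i} \<inter> space (lebesgue_on {0..T})
      = {t \<in> space (lebesgue_on {0..T}). real_of_int i \<le> real (Suc k) * t \<and> real (Suc k) * t < real_of_int i + 1}"
    by (auto simp: floor_eq_iff)
  ultimately show "(\<lambda>t. \<lfloor>real (Suc k) * t\<rfloor>) -` {i} \<inter> space (lebesgue_on {0..T}) \<in> sets (lebesgue_on {0..T})"
    by simp
qed

section \<open>Norm identities, measurability in time and the energy identity\<close>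

context stokes_basis
begin

abbreviation vn :: "nat \<Rightarrow> vfield \<Rightarrow> real" where
  "vn m g \<equiv> Vm_norm L w lam m g"

text \<open>A field in P_nH has no modes from \<open>n\<close> on, so the squared norm of the
  difference is the error in the first \<open>n\<close> modes plus the spectral tail of
  \<open>a\<close>.\<close>

lemma Vm_norm_split:
  assumes m: "1 \<le> m" and a: "a \<in> Vm L m" and v: "v \<in> PnH L w n"
  shows "(vn m (\<lambda>x. a x - v x))\<^sup>2
     = (\<Sum>j<n. lam j ^ m * (cf a j - cf v j)\<^sup>2) + ((vn m a)\<^sup>2 - (\<Sum>j<n. lam j ^ m * (cf a j)\<^sup>2))"
proof -
  have vV: "v \<in> Vm L m" by (rule PnH_E(2)[OF v m])
  have c: "cf (\<lambda>x. a x - v x) j = cf a j - cf v j" for j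
    by (rule L2_inner_diff_left[OF Vm_L2[OF m a] Vm_L2[OF m vV] w_L2])
  let ?d = "\<lambda>j. if j \<in> {..<n} then lam j ^ m * (cf a j - cf v j)\<^sup>2 - lam j ^ m * (cf a j)\<^sup>2 else 0"
  have "(\<lambda>j. lam j ^ m * (cf a j)\<^sup>2 + ?d j) sums ((vn m a)\<^sup>2 + (\<Sum>j<n. lam j ^ m * (cf a j - cf v j)\<^sup>2 - lam j ^ m * (cf a j)\<^sup>2))"
    by (intro sums_add Vm_norm_sums m a sums_If_finite_set) simp
  moreover have "lam j ^ m * (cf a j)\<^sup>2 + ?d j = lam j ^ m * (cf (\<lambda>x. a x - v x) j)\<^sup>2" for j
    using PnH_E(4)[OF v, of j] by (simp add: c)
  ultimately show ?thesis
    using sums_unique2[OF Vm_norm_sums[OF m Vm_diff[OF m a vV]]] by (simp add: sum_subtractf)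
qed

lemma Vm_norm_minus_commute:
  assumes m: "1 \<le> m" and a: "a \<in> Vm L m" and b: "b \<in> Vm L m"
  shows "vn m (\<lambda>x. a x - b x) = vn m (\<lambda>x. b x - a x)"
proof -
  have e: "(cf (\<lambda>x. a x - b x) j)\<^sup>2 = (cf (\<lambda>x. b x - a x) j)\<^sup>2" for j
    unfolding L2_inner_diff_left[OF Vm_L2[OF m a] Vm_L2[OF m b] w_L2] L2_inner_diff_left[OF Vm_L2[OF m b] Vm_L2[OF m a] w_L2]
    by (rule power2_commute)
  have "(vn m (\<lambda>x. a x - b x))\<^sup>2 = (vn m (\<lambda>x. b x - a x))\<^sup>2"
    using Vm_norm_sums[OF m Vm_diff[OF m a b]] unfolding e
    by (rule sums_unique2[OF _ Vm_norm_sums[OF m Vm_diff[OF m b a]]])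
  then show ?thesis by (simp add: power2_eq_iff_nonneg)
qed

lemma PnH_norm:
  assumes m: "1 \<le> m" and v: "v \<in> PnH L w n"
  shows "vn m v = sqrt (\<Sum>j<n. lam j ^ m * (cf v j)\<^sup>2)"
proof -
  have "lam j ^ m * (cf v j)\<^sup>2 = (if j \<in> {..<n} then lam j ^ m * (cf v j)\<^sup>2 else 0)" for j
    using PnH_E(4)[OF v, of j] by simp
  then have "(\<lambda>j. lam j ^ m * (cf v j)\<^sup>2) sums (\<Sum>j<n. lam j ^ m * (cf v j)\<^sup>2)"
    using sums_If_finite_set[of "{..<n}" "\<lambda>j. lam j ^ m * (cf v j)\<^sup>2"] by simp
  then have "(vn m v)\<^sup>2 = (\<Sum>j<n. lam j ^ m * (cf v j)\<^sup>2)"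
    using sums_unique2[OF Vm_norm_sums[OF m PnH_E(2)[OF v m]]] by blast
  then show ?thesis by (metis Vm_norm_nonneg real_sqrt_unique)
qed

text \<open>The field is sampled at grid points to the left of \<open>t\<close>; since only finitely
  many continuous coefficients are involved, the step functions converge in every \<open>Vm\<close>
  norm.\<close>

lemma bochner_measurable_PnH:
  assumes m: "1 \<le> m" and v: "\<And>t. t \<in> {0..T} \<Longrightarrow> v t \<in> PnH L w n"
    and c: "\<And>j. continuous_on {0..T} (\<lambda>t. cf (v t) j)"
  shows "bochner_measurable T (Vm L m) (vn m) v"
  unfolding bochner_measurable_def
proof (intro conjI exI allI)
  show "AE t in lebesgue_on {0..T}. v t \<in> Vm L m"
    by (rule AE_I2) (use PnH_E(2)[OF v m] in auto)
  \<comment> \<open>Indexing the samples by the integer part makes the approximation a function of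
    \<open>simple_function_floor\<close>; \<open>Suc k\<close> avoids division by zero.\<close>
  define F where "F k i = (\<lambda>x. \<Sum>j<n. cf (v (real_of_int i / real (Suc k))) j *\<^sub>R w j x)" for k :: nat and i :: int
  define s where "s k t = F k \<lfloor>real (Suc k) * t\<rfloor>" for k t
  show "simple_function (lebesgue_on {0..T}) (s k)" for k
    unfolding s_def using simple_function_compose1[OF simple_function_floor[of T k], of "F k"] .
  show "s k ` {0..T} \<subseteq> Vm L m" for k
    unfolding s_def F_def by (auto intro!: Vm_sum Vm_scaleR w_Vm m)
  show "AE t in lebesgue_on {0..T}. (\<lambda>k. vn m (\<lambda>x. s k t x - v t x)) \<longlonglongrightarrow> 0"
  proof (rule AE_I2)
    fix t assume "t \<in> space (lebesgue_on {0..T})"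
    then have t: "t \<in> {0..T}" by simp
    define p where "p k = real_of_int \<lfloor>real (Suc k) * t\<rfloor> / real (Suc k)" for k
    have p1: "p k \<le> t" for k
    proof -
      have "real_of_int \<lfloor>real (Suc k) * t\<rfloor> \<le> real (Suc k) * t" by (rule of_int_floor_le)
      then show ?thesis unfolding p_def by (simp add: pos_divide_le_eq mult.commute)
    qed
    have p0: "0 \<le> p k" for k using t by (simp add: p_def)
    have p2: "t - inverse (real (Suc k)) \<le> p k" for k
    proof -
      have "real (Suc k) * t - 1 \<le> real_of_int \<lfloor>real (Suc k) * t\<rfloor>" by linarith
      then have "(real (Suc k) * t - 1) / real (Suc k) \<le> p k" unfolding p_def by (intro divide_right_mono) auto
      then show ?thesis by (simp add: diff_divide_distrib inverse_eq_divide)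
    qed
    have pl: "p \<longlonglongrightarrow> t"
    proof (rule tendsto_sandwich[where h="\<lambda>k. t"])
      show "(\<lambda>k. t - inverse (real (Suc k))) \<longlonglongrightarrow> t"
        using tendsto_diff[OF tendsto_const[of t] LIMSEQ_inverse_real_of_nat] by simp
    qed (use p1 p2 in auto)
    have pT: "p k \<in> {0..T}" for k using p0 p1[of k] t by auto
    have cl: "(\<lambda>k. cf (v (p k)) j) \<longlonglongrightarrow> cf (v t) j" for j
      using continuous_on_tendsto_compose[OF c pl t] pT by simp
    have e: "(\<lambda>x. s k t x - v t x) \<in> PnH L w n" "cf (\<lambda>x. s k t x - v t x) j = (if j < n then cf (v (p k)) j - cf (v t) j else 0)" for k j
    proof -
      have S: "s k t \<in> L2 L" unfolding s_def F_def by (intro L2_sum L2_scaleR w_L2)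
      have "ae_eq L (\<lambda>x. s k t x - v t x) (\<lambda>x. \<Sum>j<n. (cf (v (p k)) j - cf (v t) j) *\<^sub>R w j x)"
        using PnH_E(3)[OF v[OF t]] unfolding ae_eq_def
        by eventually_elim (simp add: s_def F_def p_def scaleR_diff_left sum_subtractf)
      then show "(\<lambda>x. s k t x - v t x) \<in> PnH L w n"
        unfolding PnH_def by (intro CollectI exI[of _ "\<lambda>j. cf (v (p k)) j - cf (v t) j"])
      have "cf (s k t) j = (if j < n then cf (v (p k)) j else 0)"
        unfolding s_def F_def p_def using cf_sum[of "{..<n}" _ j] by simp
      then show "cf (\<lambda>x. s k t x - v t x) j = (if j < n then cf (v (p k)) j - cf (v t) j else 0)"
        using L2_inner_diff_left[OF S PnH_E(1)[OF v[OF t]] w_L2] PnH_E(4)[OF v[OF t], of j] by auto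
    qed
    have "(\<lambda>k. sqrt (\<Sum>j<n. lam j ^ m * (cf (v (p k)) j - cf (v t) j)\<^sup>2)) \<longlonglongrightarrow> sqrt (\<Sum>j<n. lam j ^ m * (cf (v t) j - cf (v t) j)\<^sup>2)"
      by (intro tendsto_intros cl)
    then show "(\<lambda>k. vn m (\<lambda>x. s k t x - v t x)) \<longlonglongrightarrow> 0"
      unfolding PnH_norm[OF m e(1)] e(2) by simp
  qed
qed

text \<open>The weights correspond to pairing with A^2. It is applied to the modes
  \<open>{n..<N}\<close> of \<open>u\<close> for the tail bound, and to the first \<open>n\<close>
  modes of u - u_n for the error.\<close>

lemma energy_identity:
  fixes x h :: "nat \<Rightarrow> real \<Rightarrow> real"
  assumes T: "0 \<le> T" and J: "finite J" and h: "\<And>j. integrable (lebesgue_on {0..T}) (h j)"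
    and x: "\<And>j t. t \<in> {0..T} \<Longrightarrow> x j t = x j 0 + (LINT s|lebesgue_on {0..t}. h j s)"
  shows "integrable (lebesgue_on {0..T}) (\<lambda>s. \<Sum>j\<in>J. (lam j)\<^sup>2 * (x j s * h j s))"
    "t \<in> {0..T} \<Longrightarrow> (\<Sum>j\<in>J. (lam j)\<^sup>2 * (x j t)\<^sup>2)
       = (\<Sum>j\<in>J. (lam j)\<^sup>2 * (x j 0)\<^sup>2) + 2 * (LINT s|lebesgue_on {0..t}. (\<Sum>j\<in>J. (lam j)\<^sup>2 * (x j s * h j s)))"
proof -
  note sq = square_of_indefinite_integral[OF T h x]
  show i: "integrable (lebesgue_on {0..T}) (\<lambda>s. \<Sum>j\<in>J. (lam j)\<^sup>2 * (x j s * h j s))"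
    by (intro Bochner_Integration.integrable_sum integrable_mult_right sq(2))
  assume t: "t \<in> {0..T}"
  have ij: "integrable (lebesgue_on {0..t}) (\<lambda>s. x j s * h j s)" for j
    by (rule integrable_subinterval_real(1)[OF sq(2)]) (use t in auto)
  have "(LINT s|lebesgue_on {0..t}. (\<Sum>j\<in>J. (lam j)\<^sup>2 * (x j s * h j s))) = (\<Sum>j\<in>J. (lam j)\<^sup>2 * (LINT s|lebesgue_on {0..t}. x j s * h j s))"
    by (subst Bochner_Integration.integral_sum) (auto intro!: integrable_mult_right ij)
  moreover have "(lam j)\<^sup>2 * (x j t)\<^sup>2 = (lam j)\<^sup>2 * (x j 0)\<^sup>2 + 2 * ((lam j)\<^sup>2 * (LINT s|lebesgue_on {0..t}. x j s * h j s))" for j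
    by (subst sq(3)[OF _ t]) (simp_all add: distrib_left)
  ultimately show "(\<Sum>j\<in>J. (lam j)\<^sup>2 * (x j t)\<^sup>2)
       = (\<Sum>j\<in>J. (lam j)\<^sup>2 * (x j 0)\<^sup>2) + 2 * (LINT s|lebesgue_on {0..t}. (\<Sum>j\<in>J. (lam j)\<^sup>2 * (x j s * h j s)))"
    by (simp add: sum.distrib sum_distrib_left)
qed

lemma sum_Cauchy_Schwarz: "(\<Sum>j\<in>J. a j * b j) \<le> sqrt (\<Sum>j\<in>J. (a j)\<^sup>2) * sqrt (\<Sum>j\<in>J. (b j)\<^sup>2)" for a b :: "'i \<Rightarrow> real"
proof -
  have "(\<Sum>j\<in>J. a j * b j) \<le> (\<Sum>j\<in>J. \<bar>a j\<bar> * \<bar>b j\<bar>)" by (intro sum_mono) (simp flip: abs_mult)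
  also have "\<dots> \<le> L2_set a J * L2_set b J" by (rule L2_set_mult_ineq)
  finally show ?thesis by (simp add: L2_set_def)
qed

end

section \<open>The energy argument\<close>

locale galerkin_approximation = stokes_basis L w lam for L :: real and w :: "nat \<Rightarrow> vfield" and lam :: "nat \<Rightarrow> real" +
  fixes T \<nu> :: real and u0 :: vfield and f u :: "real \<Rightarrow> vfield" and un :: "nat \<Rightarrow> real \<Rightarrow> vfield"
  assumes T: "T > 0" and \<nu>: "\<nu> > 0" and u0: "u0 \<in> Vm L 2"
    and f: "f \<in> bochner_Lp T 2 (Vm L 1) (Vm_norm L w lam 1)"
    and u_Linf: "u \<in> bochner_Linf T (Vm L 2) (Vm_norm L w lam 2)"
    and u_L2: "u \<in> bochner_Lp T 2 (Vm L 3) (Vm_norm L w lam 3)"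
    and strong: "strong_solution L w lam T \<nu> f u0 u"
    and galerkin: "galerkin_solution L w T \<nu> f u0 n (un n)"
begin

abbreviation "M \<equiv> lebesgue_on {0..T}"

definition "du = (SOME du. has_time_derivative L T u du \<and>
       (AE t in M. ae_eq L (\<lambda>x. du t x + \<nu> *\<^sub>R stokes L (u t) x + NS_B L (u t) (u t) x) (f t)))"

definition "dv n = (SOME dv. has_time_derivative L T (un n) dv \<and>
       (AE t in M. ae_eq L (\<lambda>x. dv t x + \<nu> *\<^sub>R stokes L (un n t) x + Pn L w n (NS_B L (un n t) (un n t)) x) (Pn L w n (f t))))"

lemma du: "has_time_derivative L T u du"
  "AE t in M. ae_eq L (\<lambda>x. du t x + \<nu> *\<^sub>R stokes L (u t) x + NS_B L (u t) (u t) x) (f t)"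
proof -
  have "\<exists>du. has_time_derivative L T u du \<and>
       (AE t in M. ae_eq L (\<lambda>x. du t x + \<nu> *\<^sub>R stokes L (u t) x + NS_B L (u t) (u t) x) (f t))"
    using strong unfolding strong_solution_def by blast
  from someI_ex[OF this] show "has_time_derivative L T u du"
    "AE t in M. ae_eq L (\<lambda>x. du t x + \<nu> *\<^sub>R stokes L (u t) x + NS_B L (u t) (u t) x) (f t)"
    unfolding du_def by blast+
qed

lemma dv: "has_time_derivative L T (un n) (dv n)"
  "AE t in M. ae_eq L (\<lambda>x. dv n t x + \<nu> *\<^sub>R stokes L (un n t) x + Pn L w n (NS_B L (un n t) (un n t)) x) (Pn L w n (f t))"
proof -
  have "\<exists>dv. has_time_derivative L T (un n) dv \<and>
       (AE t in M. ae_eq L (\<lambda>x. dv t x + \<nu> *\<^sub>R stokes L (un n t) x + Pn L w n (NS_B L (un n t) (un n t)) x) (Pn L w n (f t)))"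
    using galerkin unfolding galerkin_solution_def by blast
  from someI_ex[OF this] show "has_time_derivative L T (un n) (dv n)"
    "AE t in M. ae_eq L (\<lambda>x. dv n t x + \<nu> *\<^sub>R stokes L (un n t) x + Pn L w n (NS_B L (un n t) (un n t)) x) (Pn L w n (f t))"
    unfolding dv_def by blast+
qed

abbreviation "y j t \<equiv> cf (u t) j"
abbreviation "c n j t \<equiv> cf (un n t) j"

lemma T0: "0 \<le> T" "0 \<in> {0..T}"
  using T by auto

lemma y_eq: "integrable M (\<lambda>s. cf (du s) j)" "t \<in> {0..T} \<Longrightarrow> y j t = y j 0 + (LINT s|lebesgue_on {0..t}. cf (du s) j)"
  using time_derivative_coefficient(1,2)[OF du(1) T0(1)] by blast+

lemma c_eq: "integrable M (\<lambda>s. cf (dv n s) j)" "t \<in> {0..T} \<Longrightarrow> c n j t = c n j 0 + (LINT s|lebesgue_on {0..t}. cf (dv n s) j)"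
  using time_derivative_coefficient(1,2)[OF dv(1) T0(1)] by blast+

lemma y_cont: "continuous_on {0..T} (y j)"
  by (rule square_of_indefinite_integral(1)[OF T0(1) y_eq])

lemma c_cont: "continuous_on {0..T} (c n j)"
  by (rule square_of_indefinite_integral(1)[OF T0(1) c_eq])

lemma continuous_measurable: "continuous_on {0..T} g \<Longrightarrow> g \<in> borel_measurable M" for g :: "real \<Rightarrow> real"
  by (rule continuous_imp_measurable_on_sets_lebesgue) auto

lemma un_PnH: "t \<in> {0..T} \<Longrightarrow> un n t \<in> PnH L w n"
  using galerkin unfolding galerkin_solution_def by blast

lemma y_0: "y j 0 = cf u0 j"
  by (rule ae_eq_L2_inner) (use strong Vm_L2[OF _ u0] in \<open>auto simp: strong_solution_def\<close>)

lemma c_0: "j < n \<Longrightarrow> c n j 0 = cf u0 j"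
proof -
  assume j: "j < n"
  have u0L: "u0 \<in> L2 L" by (rule Vm_L2[OF _ u0]) simp
  have "ae_eq L (un n 0) (Pn L w n u0)" using galerkin unfolding galerkin_solution_def by blast
  then have "c n j 0 = cf (Pn L w n u0) j"
    by (rule ae_eq_L2_inner) (use PnH_E(1)[OF Pn_correct(1)[OF u0L]] in auto)
  then show ?thesis using Pn_correct(2)[OF u0L j] by simp
qed

text \<open>Since \<open>w j\<close> lies in H, the Leray projection disappears when the nonlinear
  term is paired with it.\<close>

lemma NS_B_cf:
  assumes a: "a \<in> Vm L 2"
  shows "NS_B L a a \<in> H_space L" "cf (NS_B L a a) j = cf (advect L a a) j"
  unfolding NS_B_def using leray_correct[OF L advect_L2(2)[OF a a]] w_H by auto

lemma f_AE: "AE t in M. f t \<in> Vm L 1"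
  using f unfolding bochner_Lp_def bochner_measurable_def by blast

lemma u_AE: "AE t in M. u t \<in> Vm L 2" "AE t in M. u t \<in> Vm L 3"
  using u_Linf u_L2 unfolding bochner_Lp_def bochner_Linf_def bochner_measurable_def by blast+

text \<open>The equation reduced to scalar equations. One null set serves all \<open>j\<close>,
  because the equation holds as an identity of fields at almost every time; this permits sums over
  modes at a fixed time.\<close>

lemma du_AE: "AE s in M. \<forall>j. cf (du s) j = cf (f s) j - \<nu> * lam j * y j s - cf (advect L (u s) (u s)) j"
  using du(2) f_AE u_AE(1) time_derivative_coefficient(4)[OF du(1) T0(1)]
proof eventually_elim
  case (elim s)
  show ?case
  proof
    fix j
    have fL: "f s \<in> L2 L" by (rule Vm_L2[OF _ elim(2)]) simp
    have dL: "du s \<in> L2 L" by (rule H_L2[OF elim(4)])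
    have sL: "(\<lambda>x. \<nu> *\<^sub>R stokes L (u s) x) \<in> L2 L" by (rule L2_scaleR[OF H_L2[OF stokes_vcoef(1)[OF L elim(3)]]])
    have BL: "NS_B L (u s) (u s) \<in> L2 L" by (rule H_L2[OF NS_B_cf(1)[OF elim(3)]])
    have "cf (\<lambda>x. du s x + \<nu> *\<^sub>R stokes L (u s) x + NS_B L (u s) (u s) x) j = cf (f s) j"
      by (rule ae_eq_L2_inner[OF elim(1) fL w_L2])
    moreover have "cf (\<lambda>x. du s x + \<nu> *\<^sub>R stokes L (u s) x + NS_B L (u s) (u s) x) j
        = cf (du s) j + \<nu> * (lam j * y j s) + cf (advect L (u s) (u s)) j"
      by (simp add: L2_inner_add_left[OF L2_add[OF dL sL] BL w_L2] L2_inner_add_left[OF dL sL w_L2]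
          L2_inner_scaleR_left stokes_cf[OF elim(3)] NS_B_cf(2)[OF elim(3)])
    ultimately show "cf (du s) j = cf (f s) j - \<nu> * lam j * y j s - cf (advect L (u s) (u s)) j" by simp
  qed
qed

text \<open>For \<open>j < n\<close> the projection \<open>Pn\<close> also disappears against
  \<open>w j\<close>, so \<open>u\<close> and \<open>un n\<close> satisfy equations of the same form
  in these modes and the forcing cancels in their difference.\<close>

lemma dv_AE: "AE s in M. \<forall>j<n. cf (dv n s) j = cf (f s) j - \<nu> * lam j * c n j s - cf (advect L (un n s) (un n s)) j"
  using dv(2)[of n] f_AE time_derivative_coefficient(4)[OF dv(1)[of n] T0(1)] AE_space
proof eventually_elim
  case (elim s)
  have v: "un n s \<in> Vm L 2" using PnH_E(2)[OF un_PnH] elim(4) by auto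
  show ?case
  proof (intro allI impI)
    fix j assume j: "j < n"
    have fL: "f s \<in> L2 L" by (rule Vm_L2[OF _ elim(2)]) simp
    have dL: "dv n s \<in> L2 L" by (rule H_L2[OF elim(3)])
    have sL: "(\<lambda>x. \<nu> *\<^sub>R stokes L (un n s) x) \<in> L2 L" by (rule L2_scaleR[OF H_L2[OF stokes_vcoef(1)[OF L v]]])
    have BL: "NS_B L (un n s) (un n s) \<in> L2 L" by (rule H_L2[OF NS_B_cf(1)[OF v]])
    have PL: "Pn L w n g \<in> L2 L" if "g \<in> L2 L" for g by (rule PnH_E(1)[OF Pn_correct(1)[OF that]])
    have "cf (\<lambda>x. dv n s x + \<nu> *\<^sub>R stokes L (un n s) x + Pn L w n (NS_B L (un n s) (un n s)) x) j = cf (f s) j"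
      using ae_eq_L2_inner[OF elim(1) PL[OF fL] w_L2] Pn_correct(2)[OF fL j] by simp
    moreover have "cf (\<lambda>x. dv n s x + \<nu> *\<^sub>R stokes L (un n s) x + Pn L w n (NS_B L (un n s) (un n s)) x) j
        = cf (dv n s) j + \<nu> * (lam j * c n j s) + cf (advect L (un n s) (un n s)) j"
      by (simp add: L2_inner_add_left[OF L2_add[OF dL sL] PL[OF BL] w_L2] L2_inner_add_left[OF dL sL w_L2]
          L2_inner_scaleR_left stokes_cf[OF v] Pn_correct(2)[OF BL j] NS_B_cf(2)[OF v])
    ultimately show "cf (dv n s) j = cf (f s) j - \<nu> * lam j * c n j s - cf (advect L (un n s) (un n s)) j" by simp
  qed
qed

section \<open>Bounds on the exact solution and its spectral tail\<close>

definition "B = 36 * wiener_const"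

lemma B_nonneg: "0 \<le> B"
  by (simp add: B_def wiener_const_nonneg)

lemma u_bounded: "\<exists>R\<ge>0. AE s in M. vn 2 (u s) \<le> R"
proof -
  have "bochner_Linf_norm T (vn 2) u < \<infinity>" using u_Linf by (simp add: bochner_Linf_def)
  then obtain r where r: "bochner_Linf_norm T (vn 2) u \<le> ereal r"
    by (cases "bochner_Linf_norm T (vn 2) u") auto
  have "AE s in M. ereal (vn 2 (u s)) \<le> bochner_Linf_norm T (vn 2) u"
    unfolding bochner_Linf_norm_def by (rule esssup_AE)
  then have "AE s in M. vn 2 (u s) \<le> max 0 r"
  proof eventually_elim
    case (elim s)
    then have "ereal (vn 2 (u s)) \<le> ereal r" using r by (rule order_trans)
    then show ?case by simp
  qed
  then show ?thesis by (intro exI[of _ "max 0 r"]) auto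
qed

definition "R = (SOME R. R \<ge> 0 \<and> (AE s in M. vn 2 (u s) \<le> R))"

lemma R: "R \<ge> 0" "AE s in M. vn 2 (u s) \<le> R"
proof -
  have "\<exists>R. R \<ge> 0 \<and> (AE s in M. vn 2 (u s) \<le> R)" using u_bounded by blast
  from someI_ex[OF this] show "R \<ge> 0" "AE s in M. vn 2 (u s) \<le> R" unfolding R_def by blast+
qed

text \<open>The essential supremum of a nonmeasurable function is infinite by convention, so
  finiteness of the norm of \<open>u\<close> carries measurability with it.\<close>

lemma vn2_measurable: "(\<lambda>s. vn 2 (u s)) \<in> borel_measurable M"
proof -
  have "(\<lambda>s. ereal (vn 2 (u s))) \<in> borel_measurable M"
  proof (rule ccontr)
    assume "(\<lambda>s. ereal (vn 2 (u s))) \<notin> borel_measurable M"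
    then have "bochner_Linf_norm T (vn 2) u = \<infinity>"
      unfolding bochner_Linf_norm_def by (simp add: esssup_non_measurable top_ereal_def)
    then show False using u_Linf by (simp add: bochner_Linf_def)
  qed
  from borel_measurable_real_of_ereal[OF this] show ?thesis by simp
qed

lemma vn3_sq: "integrable M (\<lambda>s. (vn 3 (u s))\<^sup>2)"
  using u_L2 by (simp add: bochner_Lp_def)

text \<open>Integrability of the square already includes measurability of the square; for a
  nonnegative function the square root recovers it.\<close>

lemma sq_int_of_sq:
  fixes g :: "'a \<Rightarrow> real"
  assumes "integrable N (\<lambda>s. (g s)\<^sup>2)" "\<And>s. 0 \<le> g s"
  shows "sq_int N g"
proof -
  have "(\<lambda>s. sqrt ((g s)\<^sup>2)) \<in> borel_measurable N" using borel_measurable_integrable[OF assms(1)] by measurable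
  then show ?thesis using assms by (simp add: sq_int_def)
qed

lemma vn3_sq_int: "sq_int M (\<lambda>s. vn 3 (u s))"
  by (rule sq_int_of_sq[OF vn3_sq]) simp

lemma f_sq_int: "sq_int M (\<lambda>s. vn 1 (f s))"
  by (rule sq_int_of_sq) (use f in \<open>auto simp: bochner_Lp_def\<close>)

text \<open>The V^3 norm of q at almost every time. The maximum with 0 covers the exceptional times
  at which \<open>u s\<close> is outside V^3 and the difference may be negative.\<close>

definition "tail3 n s = sqrt (max 0 ((vn 3 (u s))\<^sup>2 - (\<Sum>j<n. lam j ^ 3 * (y j s)\<^sup>2)))"
text \<open>Bounds the V^1 norm of f - B(u,u) in the pairing with A^2: \<open>B * R\<^sup>2\<close>
  is the contribution of the nonlinear term by \<open>advect_estimate\<close>.\<close>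

definition "forcing s = vn 1 (f s) + B * R\<^sup>2"

lemma tail3_nonneg: "0 \<le> tail3 n s" and forcing_nonneg: "0 \<le> forcing s"
  by (auto simp: tail3_def forcing_def B_nonneg)

lemma tail3_le: "tail3 n s \<le> vn 3 (u s)"
proof -
  have "max 0 ((vn 3 (u s))\<^sup>2 - (\<Sum>j<n. lam j ^ 3 * (y j s)\<^sup>2)) \<le> (vn 3 (u s))\<^sup>2"
    by (auto intro!: sum_nonneg mult_nonneg_nonneg less_imp_le[OF lam_pos])
  then show ?thesis unfolding tail3_def by (intro real_le_lsqrt) auto
qed

lemma tail3_measurable [measurable]: "tail3 n \<in> borel_measurable M"
proof -
  note [measurable] = sq_intD(1)[OF vn3_sq_int] continuous_measurable[OF y_cont]
  show ?thesis unfolding tail3_def[abs_def] by measurable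
qed

lemma forcing_sq_int: "sq_int M forcing"
proof -
  have "sq_int M (\<lambda>s. B * R\<^sup>2)" by (simp add: sq_int_def)
  from sq_int_add[OF f_sq_int this] show ?thesis by (simp add: forcing_def[abs_def])
qed

lemma tail3_tendsto: "AE s in M. (\<lambda>n. tail3 n s) \<longlonglongrightarrow> 0"
  using u_AE(2)
proof eventually_elim
  case (elim s)
  have "(\<lambda>n. sqrt (max 0 ((vn 3 (u s))\<^sup>2 - (\<Sum>j<n. lam j ^ 3 * (y j s)\<^sup>2)))) \<longlonglongrightarrow> sqrt (max 0 ((vn 3 (u s))\<^sup>2 - (vn 3 (u s))\<^sup>2))"
    using Vm_norm_sums[OF _ elim] unfolding sums_def by (intro tendsto_intros) auto
  then show ?case by (simp add: tail3_def)
qed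

text \<open>Dominated convergence: the tail vanishes pointwise and is dominated by the full V^3
  norm, whose product with \<open>forcing\<close> is integrable as both are square integrable in
  time.\<close>

lemma tail3_forcing:
  "integrable M (\<lambda>s. tail3 n s * forcing s)" "(\<lambda>n. LINT s|M. tail3 n s * forcing s) \<longlonglongrightarrow> 0"
proof -
  note [measurable] = sq_intD(1)[OF forcing_sq_int]
  have d: "integrable M (\<lambda>s. vn 3 (u s) * forcing s)"
    using sq_int_norm_mult[OF vn3_sq_int forcing_sq_int] forcing_nonneg by simp
  have le: "norm (tail3 n s * forcing s) \<le> vn 3 (u s) * forcing s" for n s
    using mult_right_mono[OF tail3_le forcing_nonneg, of n s] tail3_nonneg forcing_nonneg by simp
  show "integrable M (\<lambda>s. tail3 n s * forcing s)"
    by (rule Bochner_Integration.integrable_bound[OF d]) (use le forcing_nonneg in auto)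
  have "(\<lambda>n. LINT s|M. tail3 n s * forcing s) \<longlonglongrightarrow> (LINT s|M. 0)"
  proof (rule integral_dominated_convergence[OF _ _ d])
    show "AE s in M. (\<lambda>n. tail3 n s * forcing s) \<longlonglongrightarrow> 0"
      using tail3_tendsto by eventually_elim (rule tendsto_mult_left_zero)
  qed (use le in auto)
  then show "(\<lambda>n. LINT s|M. tail3 n s * forcing s) \<longlonglongrightarrow> 0" by simp
qed

lemma tail3_sq:
  "integrable M (\<lambda>s. (tail3 n s)\<^sup>2)" "(\<lambda>n. LINT s|M. (tail3 n s)\<^sup>2) \<longlonglongrightarrow> 0"
proof -
  have le: "norm ((tail3 n s)\<^sup>2) \<le> (vn 3 (u s))\<^sup>2" for n s
    using power_mono[OF tail3_le tail3_nonneg, of n s 2] by simp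
  show "integrable M (\<lambda>s. (tail3 n s)\<^sup>2)"
    by (rule Bochner_Integration.integrable_bound[OF vn3_sq]) (use le in auto)
  have "(\<lambda>n. LINT s|M. (tail3 n s)\<^sup>2) \<longlonglongrightarrow> (LINT s|M. 0)"
  proof (rule integral_dominated_convergence[OF _ _ vn3_sq])
    show "AE s in M. (\<lambda>n. (tail3 n s)\<^sup>2) \<longlonglongrightarrow> 0"
      using tail3_tendsto by eventually_elim (auto dest: tendsto_power[where n=2])
  qed (use le in auto)
  then show "(\<lambda>n. LINT s|M. (tail3 n s)\<^sup>2) \<longlonglongrightarrow> 0" by simp
qed

text \<open>The right side of the tail energy estimate: the squared V^2 norm of the initial modes
  from \<open>n\<close> on, plus twice the integrated power.\<close>

definition "\<tau> n = ((vn 2 u0)\<^sup>2 - (\<Sum>j<n. (lam j)\<^sup>2 * (cf u0 j)\<^sup>2)) + 2 * (LINT s|M. tail3 n s * forcing s)"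

lemma \<tau>_tendsto: "\<tau> \<longlonglongrightarrow> 0"
proof -
  have "(\<lambda>n. ((vn 2 u0)\<^sup>2 - (\<Sum>j<n. (lam j)\<^sup>2 * (cf u0 j)\<^sup>2)) + 2 * (LINT s|M. tail3 n s * forcing s))
      \<longlonglongrightarrow> ((vn 2 u0)\<^sup>2 - (vn 2 u0)\<^sup>2) + 2 * 0"
    using Vm_norm_sums[OF _ u0] unfolding sums_def by (intro tendsto_intros tail3_forcing(2)) auto
  then show ?thesis by (simp add: \<tau>_def[abs_def])
qed

lemma \<tau>_nonneg: "0 \<le> \<tau> n"
proof -
  have "(\<Sum>j<n. (lam j)\<^sup>2 * (cf u0 j)\<^sup>2) \<le> (vn 2 u0)\<^sup>2" by (rule Vm_norm_partial[OF _ u0]) auto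
  moreover have "0 \<le> (LINT s|M. tail3 n s * forcing s)"
    by (intro Bochner_Integration.integral_nonneg mult_nonneg_nonneg tail3_nonneg forcing_nonneg)
  ultimately show ?thesis by (simp add: \<tau>_def)
qed

text \<open>The viscous contribution of the modes from \<open>n\<close> on is nonpositive and is
  dropped. Both remaining terms contain the V^3 norm of those modes as a factor, bounded by
  \<open>tail3\<close>.\<close>

lemma tail_power: "AE s in M. (\<Sum>j\<in>{n..<N}. (lam j)\<^sup>2 * (y j s * cf (du s) j)) \<le> tail3 n s * forcing s"
  using du_AE f_AE u_AE R(2)
proof eventually_elim
  case (elim s)
  let ?J = "{n..<N}"
  let ?r = "sqrt (\<Sum>j\<in>?J. lam j ^ 3 * (y j s)\<^sup>2)"
  have rt: "?r \<le> tail3 n s"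
  proof -
    have "(\<Sum>j<n. lam j ^ 3 * (y j s)\<^sup>2) + (\<Sum>j\<in>?J. lam j ^ 3 * (y j s)\<^sup>2) = (\<Sum>j\<in>{..<n} \<union> ?J. lam j ^ 3 * (y j s)\<^sup>2)"
      by (rule sum.union_disjoint[symmetric]) auto
    also have "\<dots> \<le> (vn 3 (u s))\<^sup>2" by (rule Vm_norm_partial[OF _ elim(4)]) auto
    finally show ?thesis unfolding tail3_def by (intro real_sqrt_le_mono) simp
  qed
  \<comment> \<open>The weight is split as lam^2 = lam^(3/2) lam^(1/2), so that Cauchy-Schwarz
    charges three half-derivative pairs to \<open>u\<close> and one to \<open>f\<close>: the V^3 and
    V^1 norms.\<close>
  have fs: "(\<Sum>j\<in>?J. (lam j)\<^sup>2 * (y j s * cf (f s) j)) \<le> ?r * vn 1 (f s)"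
  proof -
    have p: "lam j ^ 3 = (lam j * sqrt (lam j))\<^sup>2" "lam j = (sqrt (lam j))\<^sup>2" for j
      using lam_pos[of j] by (simp_all add: power_mult_distrib power2_eq_square power3_eq_cube)
    have "(\<Sum>j\<in>?J. (lam j)\<^sup>2 * (y j s * cf (f s) j)) = (\<Sum>j\<in>?J. (lam j * sqrt (lam j) * y j s) * (sqrt (lam j) * cf (f s) j))"
    proof (rule sum.cong)
      fix j
      have "sqrt (lam j) * sqrt (lam j) = lam j" using lam_pos[of j] by simp
      then show "(lam j)\<^sup>2 * (y j s * cf (f s) j) = (lam j * sqrt (lam j) * y j s) * (sqrt (lam j) * cf (f s) j)"
        by (metis (no_types, opaque_lifting) mult.assoc mult.left_commute power2_eq_square)
    qed simp
    also have "\<dots> \<le> sqrt (\<Sum>j\<in>?J. (lam j * sqrt (lam j) * y j s)\<^sup>2) * sqrt (\<Sum>j\<in>?J. (sqrt (lam j) * cf (f s) j)\<^sup>2)"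
      by (rule sum_Cauchy_Schwarz)
    also have "(\<Sum>j\<in>?J. (lam j * sqrt (lam j) * y j s)\<^sup>2) = (\<Sum>j\<in>?J. lam j ^ 3 * (y j s)\<^sup>2)"
      by (simp only: power_mult_distrib[of _ "cf _ _"] p(1)[symmetric])
    also have "(\<Sum>j\<in>?J. (sqrt (lam j) * cf (f s) j)\<^sup>2) = (\<Sum>j\<in>?J. lam j ^ 1 * (cf (f s) j)\<^sup>2)"
      by (simp only: power_mult_distrib p(2)[symmetric] power_one_right)
    also have "?r * sqrt (\<Sum>j\<in>?J. lam j ^ 1 * (cf (f s) j)\<^sup>2) \<le> ?r * vn 1 (f s)"
      using Vm_norm_partial[OF _ elim(2), of ?J] by (intro mult_left_mono real_le_lsqrt real_sqrt_ge_zero sum_nonneg) (auto simp: lam_pos less_imp_le)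
    finally show ?thesis .
  qed
  have aL: "advect L (u s) (u s) \<in> L2 L" by (rule advect_L2(2)[OF elim(3) elim(3)])
  have as: "- (\<Sum>j\<in>?J. (lam j)\<^sup>2 * (y j s * cf (advect L (u s) (u s)) j)) \<le> ?r * (B * R\<^sup>2)"
  proof -
    have "(\<Sum>j\<in>?J. (lam j)\<^sup>2 * (y j s * cf (advect L (u s) (u s)) j))
        = L2_inner L (advect L (u s) (u s)) (\<lambda>x. \<Sum>j\<in>?J. ((lam j)\<^sup>2 * y j s) *\<^sub>R w j x)"
      by (subst L2_inner_partial[OF aL]) (auto simp: mult.assoc)
    then have "- (\<Sum>j\<in>?J. (lam j)\<^sup>2 * (y j s * cf (advect L (u s) (u s)) j)) \<le> B * vn 2 (u s) * vn 2 (u s) * ?r"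
      using advect_estimate[OF elim(3) elim(3), of ?J "\<lambda>j. y j s"] unfolding B_def by simp
    also have "\<dots> \<le> B * R * R * ?r"
      using elim(5) B_nonneg R(1) by (intro mult_right_mono mult_mono mult_nonneg_nonneg real_sqrt_ge_zero sum_nonneg) (auto simp: lam_pos less_imp_le)
    finally show ?thesis by (simp add: power2_eq_square mult_ac)
  qed
  have "(\<Sum>j\<in>?J. (lam j)\<^sup>2 * (y j s * cf (du s) j))
      = (\<Sum>j\<in>?J. (lam j)\<^sup>2 * (y j s * cf (f s) j)) - (\<Sum>j\<in>?J. (lam j)\<^sup>2 * (\<nu> * lam j * (y j s)\<^sup>2))
        - (\<Sum>j\<in>?J. (lam j)\<^sup>2 * (y j s * cf (advect L (u s) (u s)) j))"
    unfolding sum_subtractf[symmetric] elim(1)[rule_format]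
    by (intro sum.cong) (simp_all add: algebra_simps power2_eq_square)
  also have "\<dots> \<le> ?r * vn 1 (f s) - 0 + ?r * (B * R\<^sup>2)"
  proof -
    have "0 \<le> (\<Sum>j\<in>?J. (lam j)\<^sup>2 * (\<nu> * lam j * (y j s)\<^sup>2))"
      using \<nu> by (intro sum_nonneg mult_nonneg_nonneg) (auto simp: lam_pos less_imp_le)
    then show ?thesis using fs as by linarith
  qed
  also have "\<dots> = ?r * forcing s" by (simp add: forcing_def distrib_left)
  also have "\<dots> \<le> tail3 n s * forcing s" by (rule mult_right_mono[OF rt forcing_nonneg])
  finally show ?case .
qed

text \<open>This replaces the regularity \<open>u \<in> C([0,T]; V\<^sup>2)\<close>, which is not among the hypotheses.\<close>

lemma tail_uniform:
  assumes t: "t \<in> {0..T}"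
  shows "(\<Sum>j\<in>{n..<N}. (lam j)\<^sup>2 * (y j t)\<^sup>2) \<le> \<tau> n"
proof -
  let ?J = "{n..<N}"
  note en = energy_identity[where x=y and h="\<lambda>j s. cf (du s) j" and J="?J", OF T0(1) finite_atLeastLessThan y_eq]
  have "(LINT s|lebesgue_on {0..t}. (\<Sum>j\<in>?J. (lam j)\<^sup>2 * (y j s * cf (du s) j))) \<le> (LINT s|lebesgue_on {0..t}. tail3 n s * forcing s)"
    using t by (intro integral_mono_AE integrable_subinterval_real(1)[OF en(1)] integrable_subinterval_real(1)[OF tail3_forcing(1)]
        AE_subinterval[OF tail_power]) auto
  also have "\<dots> \<le> (LINT s|M. tail3 n s * forcing s)"
    by (rule LINT_mono_upper[OF tail3_forcing(1) _ t]) (simp add: tail3_nonneg forcing_nonneg)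
  finally have "(\<Sum>j\<in>?J. (lam j)\<^sup>2 * (y j t)\<^sup>2) \<le> (\<Sum>j\<in>?J. (lam j)\<^sup>2 * (cf u0 j)\<^sup>2) + 2 * (LINT s|M. tail3 n s * forcing s)"
    using en(2)[OF _ t] by (simp add: y_0)
  moreover have "(\<Sum>j<n. (lam j)\<^sup>2 * (cf u0 j)\<^sup>2) + (\<Sum>j\<in>?J. (lam j)\<^sup>2 * (cf u0 j)\<^sup>2) \<le> (vn 2 u0)\<^sup>2"
  proof -
    have "(\<Sum>j<n. (lam j)\<^sup>2 * (cf u0 j)\<^sup>2) + (\<Sum>j\<in>?J. (lam j)\<^sup>2 * (cf u0 j)\<^sup>2) = (\<Sum>j\<in>{..<n} \<union> ?J. (lam j)\<^sup>2 * (cf u0 j)\<^sup>2)"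
      by (rule sum.union_disjoint[symmetric]) auto
    also have "\<dots> \<le> (vn 2 u0)\<^sup>2" by (rule Vm_norm_partial[OF _ u0]) auto
    finally show ?thesis .
  qed
  ultimately show ?thesis by (simp add: \<tau>_def)
qed

text \<open>Lets the upper end of the finite block in \<open>tail_uniform\<close> tend to infinity,
  which requires that \<open>u t\<close> belongs to V^2 at that time.\<close>

lemma tail2_le:
  assumes t: "t \<in> {0..T}" and u: "u t \<in> Vm L 2"
  shows "(vn 2 (u t))\<^sup>2 - (\<Sum>j<n. (lam j)\<^sup>2 * (y j t)\<^sup>2) \<le> \<tau> n"
proof -
  have "(vn 2 (u t))\<^sup>2 \<le> (\<Sum>j<n. (lam j)\<^sup>2 * (y j t)\<^sup>2) + \<tau> n"
  proof (rule tendsto_upperbound)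
    show "(\<lambda>N. \<Sum>j<N. (lam j)\<^sup>2 * (y j t)\<^sup>2) \<longlonglongrightarrow> (vn 2 (u t))\<^sup>2"
      using Vm_norm_sums[OF _ u] by (simp add: sums_def)
    have "(\<Sum>j<N. (lam j)\<^sup>2 * (y j t)\<^sup>2) \<le> (\<Sum>j<n. (lam j)\<^sup>2 * (y j t)\<^sup>2) + \<tau> n" if "n \<le> N" for N
    proof -
      have "(\<Sum>j<n. (lam j)\<^sup>2 * (y j t)\<^sup>2) + (\<Sum>j\<in>{n..<N}. (lam j)\<^sup>2 * (y j t)\<^sup>2) = (\<Sum>j\<in>{..<n} \<union> {n..<N}. (lam j)\<^sup>2 * (y j t)\<^sup>2)"
        by (rule sum.union_disjoint[symmetric]) auto
      also have "{..<n} \<union> {n..<N} = {..<N}" using that by auto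
      finally show ?thesis using tail_uniform[OF t, where n=n and N=N] by linarith
    qed
    then show "\<forall>\<^sub>F N in sequentially. (\<Sum>j<N. (lam j)\<^sup>2 * (y j t)\<^sup>2) \<le> (\<Sum>j<n. (lam j)\<^sup>2 * (y j t)\<^sup>2) + \<tau> n"
      by (rule eventually_sequentiallyI)
  qed simp
  then show ?thesis by simp
qed

end

section \<open>The differential inequality for z\<close>

context galerkin_approximation
begin

text \<open>Squared V^2 norm of z; like \<open>D\<close>, its V^3 counterpart, it is written in
  coefficients and is thus defined and continuous at every time.\<close>

definition "E n t = (\<Sum>j<n. (lam j)\<^sup>2 * (y j t - c n j t)\<^sup>2)"
definition "D n t = (\<Sum>j<n. lam j ^ 3 * (y j t - c n j t)\<^sup>2)"
text \<open>The constant of \<open>young_absorb\<close> with C = \<open>B\<close> and M =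
  \<open>R\<close>.\<close>

definition "K = B\<^sup>2 * (4 * R\<^sup>2 + 1) / \<nu>"
text \<open>What the discarded modes contribute: with P \<le> E + \<tau> the quantity P + P^2 leaves
  \<tau> + 2 \<tau>^2; the 2 comes from the energy identity and \<open>T\<close> from integration in
  time.\<close>

definition "\<delta> n = 2 * K * T * (\<tau> n + 2 * (\<tau> n)\<^sup>2)"
text \<open>The bound of \<open>quadratic_Gronwall\<close> for the constant 4 K: one factor 2 is
  from the energy identity, the other from P^2 \<le> 2 E^2 + 2 \<tau>^2.\<close>

definition "\<epsilon> n = 2 * \<delta> n * exp (4 * K * T)"

lemma K_nonneg: "0 \<le> K"
  using \<nu> by (simp add: K_def)

lemma E_cont: "continuous_on {0..T} (E n)" and D_cont: "continuous_on {0..T} (D n)"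
  unfolding E_def[abs_def] D_def[abs_def] by (intro continuous_intros y_cont c_cont)+

lemma E_nonneg: "0 \<le> E n t" and D_nonneg: "0 \<le> D n t"
  by (auto simp: E_def D_def intro!: sum_nonneg mult_nonneg_nonneg less_imp_le[OF lam_pos])

lemma error_norm_sq:
  assumes t: "t \<in> {0..T}" and u: "u t \<in> Vm L 2"
  shows "(vn 2 (\<lambda>x. u t x - un n t x))\<^sup>2 = E n t + ((vn 2 (u t))\<^sup>2 - (\<Sum>j<n. (lam j)\<^sup>2 * (y j t)\<^sup>2))"
    "(vn 2 (\<lambda>x. u t x - un n t x))\<^sup>2 \<le> E n t + \<tau> n"
  using Vm_norm_split[OF _ u un_PnH[OF t, of n]] tail2_le[OF t u, of n] by (simp_all add: E_def)

text \<open>Both equations are subtracted and paired with A^2 z. The expansion around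
  \<open>u\<close> together with \<open>advect_estimate\<close> bounds the nonlinear difference by a
  multiple of the V^3 norm of z, which viscosity absorbs.\<close>

lemma error_power:
  "AE s in M. 2 * (\<Sum>j<n. (lam j)\<^sup>2 * ((y j s - c n j s) * (cf (du s) j - cf (dv n s) j)))
    \<le> - \<nu> * D n s + 4 * K * (E n s + (E n s)\<^sup>2) + 2 * K * (\<tau> n + 2 * (\<tau> n)\<^sup>2)"
  using du_AE dv_AE[of n] u_AE(1) R(2) AE_space
proof eventually_elim
  case (elim s)
  have s: "s \<in> {0..T}" using elim(5) by simp
  have uV: "u s \<in> Vm L 2" and vV: "un n s \<in> Vm L 2"
    using elim(3) PnH_E(2)[OF un_PnH[OF s]] by auto
  define e where "e = (\<lambda>x. u s x - un n s x)"
  have eV: "e \<in> Vm L 2" unfolding e_def by (rule Vm_diff[OF _ uV vV]) simp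
  define Z where "Z = (\<lambda>x. \<Sum>j<n. ((lam j)\<^sup>2 * (y j s - c n j s)) *\<^sub>R w j x)"
  have ZL: "Z \<in> L2 L" unfolding Z_def by (intro L2_sum L2_scaleR w_L2)
  \<comment> \<open>The full error e = z + q, not z alone: the nonlinear term also sees the
    discarded modes, and their share is controlled by \<open>\<tau>\<close>.\<close>
  define P where "P = (vn 2 e)\<^sup>2"
  have P0: "0 \<le> P" and sP: "sqrt P = vn 2 e" by (simp_all add: P_def)
  have PE: "P \<le> E n s + \<tau> n" unfolding P_def e_def by (rule error_norm_sq(2)[OF s uV])
  have tri: "\<bar>L2_inner L (advect L a b) Z\<bar> \<le> B * vn 2 a * vn 2 b * sqrt (D n s)"
    if "a \<in> Vm L 2" "b \<in> Vm L 2" for a b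
    using advect_estimate[OF that, of "{..<n}" "\<lambda>j. y j s - c n j s"] by (simp add: Z_def B_def D_def)
  have inn: "(\<Sum>j<n. (lam j)\<^sup>2 * ((y j s - c n j s) * cf g j)) = L2_inner L g Z" if "g \<in> L2 L" for g
    unfolding Z_def by (subst L2_inner_partial[OF that]) (auto simp: mult.assoc)
  have "(\<Sum>j<n. (lam j)\<^sup>2 * ((y j s - c n j s) * (cf (du s) j - cf (dv n s) j)))
      = (\<Sum>j<n. (lam j)\<^sup>2 * ((y j s - c n j s) * (- \<nu> * lam j * (y j s - c n j s)
          - cf (advect L (u s) (u s)) j + cf (advect L (un n s) (un n s)) j)))"
  proof (intro sum.cong refl)
    fix j assume "j \<in> {..<n}"
    then have "cf (du s) j - cf (dv n s) j = - \<nu> * lam j * (y j s - c n j s)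
          - cf (advect L (u s) (u s)) j + cf (advect L (un n s) (un n s)) j"
      unfolding elim(1)[rule_format] by (simp add: elim(2) right_diff_distrib)
    then show "(lam j)\<^sup>2 * ((y j s - c n j s) * (cf (du s) j - cf (dv n s) j))
        = (lam j)\<^sup>2 * ((y j s - c n j s) * (- \<nu> * lam j * (y j s - c n j s)
          - cf (advect L (u s) (u s)) j + cf (advect L (un n s) (un n s)) j))" by (simp only:)
  qed
  also have "\<dots> = (\<Sum>j<n. - \<nu> * (lam j ^ 3 * (y j s - c n j s)\<^sup>2) - (lam j)\<^sup>2 * ((y j s - c n j s) * cf (advect L (u s) (u s)) j)
      + (lam j)\<^sup>2 * ((y j s - c n j s) * cf (advect L (un n s) (un n s)) j))"
    by (intro sum.cong) (simp_all add: algebra_simps power2_eq_square power3_eq_cube)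
  also have "\<dots> = - \<nu> * D n s - L2_inner L (advect L (u s) (u s)) Z + L2_inner L (advect L (un n s) (un n s)) Z"
    by (simp add: sum.distrib sum_subtractf inn advect_L2 uV vV D_def sum_distrib_left sum_negf)
  also have "\<dots> = - \<nu> * D n s - (L2_inner L (advect L e (u s)) Z + L2_inner L (advect L (u s) e) Z - L2_inner L (advect L e e) Z)"
    using advect_diff[OF uV vV ZL, folded e_def] by simp
  also have "\<dots> \<le> - \<nu> * D n s + (B * vn 2 e * vn 2 (u s) * sqrt (D n s) + B * vn 2 (u s) * vn 2 e * sqrt (D n s)
      + B * vn 2 e * vn 2 e * sqrt (D n s))"
    using tri[OF eV uV] tri[OF uV eV] tri[OF eV eV] by linarith
  also have "\<dots> = - \<nu> * D n s + B * (2 * vn 2 (u s) * sqrt P + P) * sqrt (D n s)"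
    unfolding sP P_def by (simp add: algebra_simps power2_eq_square)
  also have "\<dots> \<le> - \<nu> * D n s + B * (2 * R * sqrt P + P) * sqrt (D n s)"
    using elim(4) B_nonneg P0 D_nonneg[of n s]
    by (intro add_left_mono mult_right_mono mult_left_mono add_right_mono) auto
  also have "\<dots> \<le> - (\<nu> / 2) * D n s + K * (P + P\<^sup>2)"
    unfolding K_def by (rule young_absorb[OF \<nu> D_nonneg P0])
  also have "\<dots> \<le> - (\<nu> / 2) * D n s + K * (2 * (E n s + (E n s)\<^sup>2) + (\<tau> n + 2 * (\<tau> n)\<^sup>2))"
  proof (intro add_left_mono mult_left_mono K_nonneg)
    have "P\<^sup>2 \<le> (E n s + \<tau> n)\<^sup>2" by (rule power_mono[OF PE P0])
    also have "\<dots> \<le> 2 * (E n s)\<^sup>2 + 2 * (\<tau> n)\<^sup>2"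
      using zero_le_power2[of "E n s - \<tau> n"] by (simp add: power2_sum power2_diff)
    finally show "P + P\<^sup>2 \<le> 2 * (E n s + (E n s)\<^sup>2) + (\<tau> n + 2 * (\<tau> n)\<^sup>2)"
      using PE E_nonneg[of n s] by simp
  qed
  finally show ?case by (simp add: algebra_simps)
qed

lemma error_inequality:
  assumes t: "t \<in> {0..T}"
  shows "E n t + \<nu> * integral {0..t} (D n) \<le> \<delta> n + 4 * K * integral {0..t} (\<lambda>s. E n s + (E n s)\<^sup>2)"
proof -
  let ?x = "\<lambda>j s. y j s - c n j s" and ?h = "\<lambda>j s. cf (du s) j - cf (dv n s) j"
  let ?q = "\<lambda>s. E n s + (E n s)\<^sup>2"
  define k where "k = 2 * K * (\<tau> n + 2 * (\<tau> n)\<^sup>2)"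
  have h: "integrable M (?h j)" for j by (intro Bochner_Integration.integrable_diff y_eq(1) c_eq(1))
  have x: "?x j s = ?x j 0 + (LINT r|lebesgue_on {0..s}. ?h j r)" if "s \<in> {0..T}" for j s
  proof -
    have "(LINT r|lebesgue_on {0..s}. ?h j r) = (LINT r|lebesgue_on {0..s}. cf (du r) j) - (LINT r|lebesgue_on {0..s}. cf (dv n r) j)"
      using that by (intro Bochner_Integration.integral_diff integrable_subinterval_real(1)[OF y_eq(1)] integrable_subinterval_real(1)[OF c_eq(1)]) auto
    then show ?thesis using y_eq(2)[OF that, of j] c_eq(2)[OF that, of n j] by linarith
  qed
  note en = energy_identity[where x="?x" and h="?h" and J="{..<n}", OF T0(1) finite_lessThan h x]
  have cD: "continuous_on {0..t} (D n)" and cE: "continuous_on {0..t} ?q"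
    using t by (auto intro!: continuous_intros continuous_on_subset[OF D_cont] continuous_on_subset[OF E_cont])
  note iD = continuous_imp_integrable_real[OF cD] and iq = continuous_imp_integrable_real[OF cE]
  have eD: "(LINT s|lebesgue_on {0..t}. D n s) = integral {0..t} (D n)"
    and eq: "(LINT s|lebesgue_on {0..t}. ?q s) = integral {0..t} ?q"
    by (rule lebesgue_integral_eq_integral[OF iD], simp) (rule lebesgue_integral_eq_integral[OF iq], simp)
  have ic: "integrable (lebesgue_on {0..t}) (\<lambda>s. k)" and ec: "(LINT s|lebesgue_on {0..t}. k) = k * t"
    using t by (auto simp: measure_restrict_space)
  have "E n t = 2 * (LINT s|lebesgue_on {0..t}. (\<Sum>j<n. (lam j)\<^sup>2 * (?x j s * ?h j s)))"
  proof -
    \<comment> \<open>Below \<open>n\<close> the Galerkin initial value has the coefficients of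
      \<open>u0\<close>, so z starts at zero.\<close>
    have "(\<Sum>j<n. (lam j)\<^sup>2 * (?x j 0)\<^sup>2) = 0"
      by (rule sum.neutral) (simp add: y_0 c_0)
    then show ?thesis using en(2)[OF _ t] by (simp add: E_def)
  qed
  also have "\<dots> = (LINT s|lebesgue_on {0..t}. 2 * (\<Sum>j<n. (lam j)\<^sup>2 * (?x j s * ?h j s)))"
    by (rule integral_mult_right_zero[symmetric])
  also have "\<dots> \<le> (LINT s|lebesgue_on {0..t}. - \<nu> * D n s + 4 * K * ?q s + k)"
  proof (rule integral_mono_AE)
    show "integrable (lebesgue_on {0..t}) (\<lambda>s. 2 * (\<Sum>j<n. (lam j)\<^sup>2 * (?x j s * ?h j s)))"
      using t by (intro integrable_mult_right integrable_subinterval_real(1)[OF en(1)]) auto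
    show "integrable (lebesgue_on {0..t}) (\<lambda>s. - \<nu> * D n s + 4 * K * ?q s + k)"
      by (intro Bochner_Integration.integrable_add integrable_mult_right iD iq ic)
    show "AE s in lebesgue_on {0..t}. 2 * (\<Sum>j<n. (lam j)\<^sup>2 * (?x j s * ?h j s)) \<le> - \<nu> * D n s + 4 * K * ?q s + k"
      using t unfolding k_def by (intro AE_subinterval[OF error_power]) auto
  qed
  also have "\<dots> = - \<nu> * integral {0..t} (D n) + 4 * K * integral {0..t} ?q + k * t"
  proof -
    have "(LINT s|lebesgue_on {0..t}. - \<nu> * D n s + 4 * K * ?q s + k)
        = (LINT s|lebesgue_on {0..t}. - \<nu> * D n s) + (LINT s|lebesgue_on {0..t}. 4 * K * ?q s) + (LINT s|lebesgue_on {0..t}. k)"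
      by (simp only: Bochner_Integration.integral_add Bochner_Integration.integrable_add integrable_mult_right iD iq ic)
    then show ?thesis by (simp only: integral_mult_right_zero eD eq ec)
  qed
  also have "k * t \<le> \<delta> n"
  proof -
    have "0 \<le> k" unfolding k_def using K_nonneg \<tau>_nonneg[of n] by simp
    then have "k * t \<le> k * T" using t by (intro mult_left_mono) auto
    then show ?thesis by (simp add: \<delta>_def k_def mult_ac)
  qed
  finally show ?thesis by simp
qed

lemma \<delta>_nonneg: "0 \<le> \<delta> n"
  using K_nonneg \<tau>_nonneg[of n] T by (simp add: \<delta>_def)

lemma \<delta>_tendsto: "\<delta> \<longlonglongrightarrow> 0" and \<epsilon>_tendsto: "\<epsilon> \<longlonglongrightarrow> 0"
proof -
  have "(\<lambda>n. 2 * K * T * (\<tau> n + 2 * (\<tau> n)\<^sup>2)) \<longlonglongrightarrow> 2 * K * T * (0 + 2 * 0\<^sup>2)"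
    by (intro tendsto_intros \<tau>_tendsto)
  then show d: "\<delta> \<longlonglongrightarrow> 0" by (simp add: \<delta>_def[abs_def])
  have "(\<lambda>n. 2 * \<delta> n * exp (4 * K * T)) \<longlonglongrightarrow> 2 * 0 * exp (4 * K * T)"
    by (intro tendsto_intros d)
  then show "\<epsilon> \<longlonglongrightarrow> 0" by (simp add: \<epsilon>_def[abs_def])
qed

text \<open>The viscous integral is discarded to apply Gronwall. The bound so obtained on E is then
  inserted into the same inequality, now keeping that integral.\<close>

lemma error_small:
  assumes small: "\<delta> n * exp (4 * K * T) \<le> 1/2"
  shows "t \<in> {0..T} \<Longrightarrow> E n t \<le> \<epsilon> n"
    "\<nu> * integral {0..T} (D n) \<le> \<delta> n + 4 * K * (T * (\<epsilon> n + (\<epsilon> n)\<^sup>2))"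
proof -
  have nD: "0 \<le> integral {0..t} (D n)" if "t \<in> {0..T}" for t
    by (rule Henstock_Kurzweil_Integration.integral_nonneg)
      (use D_nonneg that in \<open>auto intro!: integrable_continuous_real continuous_on_subset[OF D_cont]\<close>)
  have le: "E n t \<le> \<delta> n + 4 * K * integral {0..t} (\<lambda>s. E n s + (E n s)\<^sup>2)" if "t \<in> {0..T}" for t
  proof -
    have "0 \<le> \<nu> * integral {0..t} (D n)" using nD[OF that] \<nu> by simp
    then show ?thesis using error_inequality[OF that, of n] by linarith
  qed
  have Ee: "E n t \<le> \<epsilon> n" if "t \<in> {0..T}" for t
    unfolding \<epsilon>_def using quadratic_Gronwall[OF T0(1) E_cont E_nonneg _ \<delta>_nonneg small le that] K_nonneg by simp
  then show "t \<in> {0..T} \<Longrightarrow> E n t \<le> \<epsilon> n" .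
  have "integral {0..T} (\<lambda>s. E n s + (E n s)\<^sup>2) \<le> integral {0..T} (\<lambda>s. \<epsilon> n + (\<epsilon> n)\<^sup>2)"
    by (rule integral_le) (auto intro!: integrable_continuous_real continuous_intros E_cont add_mono power_mono Ee E_nonneg)
  also have "\<dots> = T * (\<epsilon> n + (\<epsilon> n)\<^sup>2)" using T by simp
  finally have "4 * K * integral {0..T} (\<lambda>s. E n s + (E n s)\<^sup>2) \<le> 4 * K * (T * (\<epsilon> n + (\<epsilon> n)\<^sup>2))"
    using K_nonneg by (intro mult_left_mono) auto
  moreover have "E n T + \<nu> * integral {0..T} (D n) \<le> \<delta> n + 4 * K * integral {0..T} (\<lambda>s. E n s + (E n s)\<^sup>2)"
    by (rule error_inequality) (use T in simp)
  ultimately show "\<nu> * integral {0..T} (D n) \<le> \<delta> n + 4 * K * (T * (\<epsilon> n + (\<epsilon> n)\<^sup>2))"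
    using E_nonneg[of n T] by linarith
qed

lemma eventually_small: "\<forall>\<^sub>F n in sequentially. \<delta> n * exp (4 * K * T) \<le> 1/2"
proof -
  have "(\<lambda>n. \<delta> n * exp (4 * K * T)) \<longlonglongrightarrow> 0 * exp (4 * K * T)" by (intro tendsto_intros \<delta>_tendsto)
  then have "\<forall>\<^sub>F n in sequentially. \<delta> n * exp (4 * K * T) < 1/2" by (rule order_tendstoD) simp
  then show ?thesis by eventually_elim simp
qed

section \<open>Galerkin solutions in the Bochner spaces and convergence\<close>

lemma un_norm:
  assumes m: "1 \<le> m" and t: "t \<in> {0..T}"
  shows "vn m (un n t) = sqrt (\<Sum>j<n. lam j ^ m * (c n j t)\<^sup>2)"
  by (rule PnH_norm[OF m un_PnH[OF t]])

lemma un_norm_cont: "1 \<le> m \<Longrightarrow> continuous_on {0..T} (\<lambda>t. vn m (un n t))"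
proof (rule continuous_on_eq)
  show "continuous_on {0..T} (\<lambda>t. sqrt (\<Sum>j<n. lam j ^ m * (c n j t)\<^sup>2))" by (intro continuous_intros c_cont)
qed (simp add: un_norm)

lemma un_bochner_measurable: "1 \<le> m \<Longrightarrow> bochner_measurable T (Vm L m) (vn m) (un n)"
  by (rule bochner_measurable_PnH[OF _ un_PnH c_cont])

lemma un_Linf: "un n \<in> bochner_Linf T (Vm L 2) (vn 2)"
proof -
  have c: "continuous_on {0..T} (\<lambda>t. vn 2 (un n t))" by (rule un_norm_cont) simp
  have "bounded ((\<lambda>t. vn 2 (un n t)) ` {0..T})"
    using compact_continuous_image[OF c] compact_imp_bounded by blast
  then obtain b where "\<forall>x\<in>(\<lambda>t. vn 2 (un n t)) ` {0..T}. norm x \<le> b" unfolding bounded_iff by blast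
  then have b: "vn 2 (un n t) \<le> b" if "t \<in> {0..T}" for t using that by auto
  have "bochner_Linf_norm T (vn 2) (un n) \<le> ereal b"
    unfolding bochner_Linf_norm_def
  proof (rule esssup_I)
    show "(\<lambda>t. ereal (vn 2 (un n t))) \<in> borel_measurable M"
      using continuous_measurable[OF c] by measurable
    show "AE t in M. ereal (vn 2 (un n t)) \<le> ereal b" by (rule AE_I2) (use b in auto)
  qed
  then have "bochner_Linf_norm T (vn 2) (un n) < \<infinity>" using le_less_trans by fastforce
  then show ?thesis using un_bochner_measurable by (simp add: bochner_Linf_def)
qed

lemma un_L2: "un n \<in> bochner_Lp T 2 (Vm L 3) (vn 3)"
  unfolding bochner_Lp_def
  by (intro CollectI conjI un_bochner_measurable continuous_imp_integrable_real continuous_intros un_norm_cont) auto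

text \<open>Besides its value, this gives measurability of the error norm: the right side is
  assembled from continuous coefficients and the measurable norm of \<open>u\<close>.\<close>

lemma error_norm2_AE: "AE t in M. vn 2 (\<lambda>x. un n t x - u t x) = sqrt (E n t + ((vn 2 (u t))\<^sup>2 - (\<Sum>j<n. (lam j)\<^sup>2 * (y j t)\<^sup>2)))"
  using u_AE(1) AE_space
proof eventually_elim
  case (elim t)
  then have t: "t \<in> {0..T}" by simp
  have "vn 2 (\<lambda>x. un n t x - u t x) = vn 2 (\<lambda>x. u t x - un n t x)"
    by (rule Vm_norm_minus_commute[OF _ PnH_E(2)[OF un_PnH[OF t]] elim(1)]) auto
  then show ?case unfolding error_norm_sq(1)[OF t elim(1), of n, symmetric] by simp
qed

lemma error_norm3_AE: "AE t in M. (vn 3 (\<lambda>x. un n t x - u t x))\<^sup>2 = D n t + (tail3 n t)\<^sup>2"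
  using u_AE(2) AE_space
proof eventually_elim
  case (elim t)
  then have t: "t \<in> {0..T}" by simp
  have "vn 3 (\<lambda>x. un n t x - u t x) = vn 3 (\<lambda>x. u t x - un n t x)"
    by (rule Vm_norm_minus_commute[OF _ PnH_E(2)[OF un_PnH[OF t]] elim(1)]) auto
  moreover have "(\<Sum>j<n. lam j ^ 3 * (y j t)\<^sup>2) \<le> (vn 3 (u t))\<^sup>2" by (rule Vm_norm_partial[OF _ elim(1)]) auto
  then have "(tail3 n t)\<^sup>2 = (vn 3 (u t))\<^sup>2 - (\<Sum>j<n. lam j ^ 3 * (y j t)\<^sup>2)"
    by (simp add: tail3_def)
  ultimately show ?case
    using Vm_norm_split[OF _ elim(1) un_PnH[OF t, of n]] by (simp add: D_def)
qed

theorem convergence_Linf: "converges_Linf T (Vm L 2) (vn 2) un u"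
  unfolding converges_Linf_def
proof (intro conjI allI un_Linf u_Linf)
  let ?N = "\<lambda>n. bochner_Linf_norm T (vn 2) (\<lambda>t x. un n t x - u t x)"
  have upper: "?N n \<le> ereal (sqrt (\<epsilon> n + \<tau> n))" if small: "\<delta> n * exp (4 * K * T) \<le> 1/2" for n
    unfolding bochner_Linf_norm_def
  proof (rule esssup_I)
    note [measurable] = vn2_measurable continuous_measurable[OF y_cont] continuous_measurable[OF E_cont]
    have "(\<lambda>t. sqrt (E n t + ((vn 2 (u t))\<^sup>2 - (\<Sum>j<n. (lam j)\<^sup>2 * (y j t)\<^sup>2)))) \<in> borel_measurable M"
      by measurable
    from lebesgue_on_AE_measurable[OF _ error_norm2_AE this]
    have "(\<lambda>t. vn 2 (\<lambda>x. un n t x - u t x)) \<in> borel_measurable M" by simp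
    then show "(\<lambda>t. ereal (vn 2 (\<lambda>x. un n t x - u t x))) \<in> borel_measurable M" by measurable
    show "AE t in M. ereal (vn 2 (\<lambda>x. un n t x - u t x)) \<le> ereal (sqrt (\<epsilon> n + \<tau> n))"
      using error_norm2_AE[of n] u_AE(1) AE_space
    proof eventually_elim
      case (elim t)
      then have t: "t \<in> {0..T}" by simp
      have "E n t + ((vn 2 (u t))\<^sup>2 - (\<Sum>j<n. (lam j)\<^sup>2 * (y j t)\<^sup>2)) \<le> \<epsilon> n + \<tau> n"
        using error_small(1)[OF small t] tail2_le[OF t elim(2), of n] by linarith
      then show ?case unfolding elim(1) by simp
    qed
  qed
  have lower: "0 \<le> ?N n" for n
  proof -
    \<comment> \<open>Positive length of the interval matters: it makes the essential supremum of
      the constant 0 equal to 0, and monotonicity then bounds the norm of the error from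
      below.\<close>
    have "emeasure M (space M) \<noteq> 0" using T by (simp add: emeasure_restrict_space)
    then have "(0::ereal) = esssup M (\<lambda>t. 0)" by (rule esssup_const[symmetric])
    also have "\<dots> \<le> ?N n" unfolding bochner_Linf_norm_def by (rule esssup_mono) auto
    finally show ?thesis .
  qed
  show "?N \<longlonglongrightarrow> 0"
  proof (rule tendsto_sandwich)
    show "\<forall>\<^sub>F n in sequentially. 0 \<le> ?N n" using lower by simp
    show "\<forall>\<^sub>F n in sequentially. ?N n \<le> ereal (sqrt (\<epsilon> n + \<tau> n))"
      using eventually_small by eventually_elim (rule upper)
    have "(\<lambda>n. sqrt (\<epsilon> n + \<tau> n)) \<longlonglongrightarrow> sqrt (0 + 0)" by (intro tendsto_intros \<epsilon>_tendsto \<tau>_tendsto)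
    then show "(\<lambda>n. ereal (sqrt (\<epsilon> n + \<tau> n))) \<longlonglongrightarrow> 0" by (simp add: zero_ereal_def)
  qed simp
qed

theorem convergence_L2: "converges_Lp T 2 (Vm L 3) (vn 3) un u"
  unfolding converges_Lp_def
proof (intro conjI allI un_L2 u_L2)
  let ?I = "\<lambda>n. LINT t|M. (vn 3 (\<lambda>x. un n t x - u t x))\<^sup>2"
  let ?b = "\<lambda>n. (\<delta> n + 4 * K * (T * (\<epsilon> n + (\<epsilon> n)\<^sup>2))) / \<nu> + (LINT s|M. (tail3 n s)\<^sup>2)"
  have upper: "?I n \<le> ?b n" if small: "\<delta> n * exp (4 * K * T) \<le> 1/2" for n
  proof -
    have iD: "integrable M (D n)" by (rule continuous_imp_integrable_real[OF D_cont])
    have m: "(\<lambda>t. D n t + (tail3 n t)\<^sup>2) \<in> borel_measurable M"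
      by (intro borel_measurable_integrable Bochner_Integration.integrable_add iD tail3_sq(1))
    have m': "(\<lambda>t. (vn 3 (\<lambda>x. un n t x - u t x))\<^sup>2) \<in> borel_measurable M"
      by (rule lebesgue_on_AE_measurable[OF _ error_norm3_AE m]) simp
    have "?I n = (LINT t|M. D n t + (tail3 n t)\<^sup>2)"
      by (rule integral_cong_AE[OF m' m error_norm3_AE])
    also have "\<dots> = integral {0..T} (D n) + (LINT s|M. (tail3 n s)\<^sup>2)"
      using Bochner_Integration.integral_add[OF iD tail3_sq(1), of n] lebesgue_integral_eq_integral[OF iD] by simp
    finally have "?I n = integral {0..T} (D n) + (LINT s|M. (tail3 n s)\<^sup>2)" .
    moreover have "integral {0..T} (D n) \<le> (\<delta> n + 4 * K * (T * (\<epsilon> n + (\<epsilon> n)\<^sup>2))) / \<nu>"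
      using error_small(2)[OF small] \<nu> by (simp add: le_divide_eq mult.commute)
    ultimately show ?thesis by linarith
  qed
  have "?I \<longlonglongrightarrow> 0"
  proof (rule tendsto_sandwich)
    have "0 \<le> ?I n" for n by (rule Bochner_Integration.integral_nonneg) (rule zero_le_power2)
    then show "\<forall>\<^sub>F n in sequentially. 0 \<le> ?I n" by (rule always_eventually[OF allI])
    show "\<forall>\<^sub>F n in sequentially. ?I n \<le> ?b n" using eventually_small by eventually_elim (rule upper)
    have "(\<lambda>n. (\<delta> n + 4 * K * (T * (\<epsilon> n + (\<epsilon> n)\<^sup>2))) / \<nu>) \<longlonglongrightarrow> (0 + 4 * K * (T * (0 + 0\<^sup>2))) / \<nu>"
      by (intro tendsto_intros \<delta>_tendsto \<epsilon>_tendsto) (use \<nu> in simp)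
    from tendsto_add[OF this tail3_sq(2)] show "?b \<longlonglongrightarrow> 0" by simp
  qed simp
  then have "(\<lambda>n. root 2 (?I n)) \<longlonglongrightarrow> root 2 0" by (rule tendsto_real_root)
  then show "(\<lambda>n. bochner_Lp_norm T 2 (vn 3) (\<lambda>t x. un n t x - u t x)) \<longlonglongrightarrow> 0"
    by (simp add: bochner_Lp_norm_def)
qed

end

theorem theorem5p2:
  fixes L T \<nu> :: real
    and w :: "nat \<Rightarrow> vfield" and lam :: "nat \<Rightarrow> real"
    and u0 :: vfield and f u :: "real \<Rightarrow> vfield"
    and un :: "nat \<Rightarrow> real \<Rightarrow> vfield"
  assumes "L > 0" and "T > 0" and "\<nu> > 0"
    and "stokes_eigenbasis L w lam"
    and "u0 \<in> Vm L 2"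
    and "f \<in> bochner_Lp T 2 (Vm L 1) (Vm_norm L w lam 1) \<inter> bochner_Lp T 1 (Vm L 2) (Vm_norm L w lam 2)"
    and "u \<in> bochner_Linf T (Vm L 2) (Vm_norm L w lam 2) \<inter> bochner_Lp T 2 (Vm L 3) (Vm_norm L w lam 3)"
    and "strong_solution L w lam T \<nu> f u0 u"
    and "\<And>n. galerkin_solution L w T \<nu> f u0 n (un n)"
  shows "converges_Linf T (Vm L 2) (Vm_norm L w lam 2) un u
       \<and> converges_Lp T 2 (Vm L 3) (Vm_norm L w lam 3) un u"
proof -
  interpret galerkin_approximation L w lam T \<nu> u0 f u un
    by unfold_locales (rule assms IntD1[OF assms(6)] IntD1[OF assms(7)] IntD2[OF assms(7)])+
  show ?thesis using convergence_Linf convergence_L2 by blast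
qed

end
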